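(* Assume that $F$ is orthogonally invariant and satisfies F1, F2 and F3, that $A\in C^2(\bar\Omega\times\mathbb R\times\mathbb R^n)$ is regular in $\bar\Omega$, that $B\in C^2(\bar\Omega\times\mathbb R\times\mathbb R^n)$ satisfies $B>a_0$ and is convex in $p$, that $u\in C^4(\Omega)\cap C^2(\bar\Omega)$ is an admissible solution of $$F[D^2u-A(\cdot,u,Du)]=B(\cdot,u,Du)\quad\text{in }\Omega,$$ and that $\bar u\in C^2(\Omega)\cap C^1(\bar\Omega)$ is admissible with respect to $u$. Assume further that either (i) F5$^+$ holds, or (ii) $\bar u$ also satisfies the subsolution condition $F(M_u[\bar u])\ge B(\cdot,u,D\bar u)$ in $\Omega$. Then $$\sup_\Omega|D^2u|\le C\Big(1+\sup_{\partial\Omega}|D^2u|\Big),$$ where the constant $C$ depends on $A,B,F,\Omega,\bar u$ and $|u|_{1;\Omega}$.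
   Context: $\Omega\subset\mathbb R^n$ is a bounded smooth domain; $\mathbb S^n$ is the space of real symmetric $n\times n$ matrices; $K^+$ is the cone of positive definite matrices. $\Gamma\subset\mathbb S^n$ is an open convex cone with vertex at $0$ containing $K^+$; $F\in C^2(\Gamma)$, $F_r=[F_{r_{ij}}]$, $\mathcal T(r)=\operatorname{trace}F_r(r)$. Conditions: F1: $F_r>0$ in $\Gamma$. F2: $F$ is concave in $\Gamma$. F3: $F(\Gamma)=(a_0,\infty)$ for a constant $a_0\ge-\infty$, with $\sup_{r_0\in\partial\Gamma}\limsup_{r\to r_0}F(r)\le a_0$. F5$^+$: $\mathcal T(r)\to\infty$ as $|r|\to\infty$, uniformly for $F(r)\in\mathcal I$, for every interval $\mathcal I\subset\subset F(\Gamma)$. Orthogonally invariant means $Q\Gamma Q^{t}=\Gamma$ and $F(QrQ^t)=F(r)$ for all $r\in\Gamma$ and orthogonal $Q$. $A$ is a symmetric-matrix valued function of $(x,z,p)$; with $A^{kl}_{ij}=D^2_{p_kp_l}A_{ij}$, $A$ is regular if $\sum A^{kl}_{ij}\xi_i\xi_j\eta_k\eta_l\ge0$ whenever $\xi,\eta\in\mathbb R^n$ and $\xi\cdot\eta=0$, at all $(x,z,p)$. $M[u]=D^2u-A(\cdot,u,Du)$; $u$ is admissible if $M[u]\in\Gamma$. $M_u[\bar u]=D^2\bar u-A(\cdot,u,D\bar u)$; $\bar u$ is called admissible with respect to $u$ if $M_u[\bar u]\in\Gamma$ in $\bar\Omega$ (a definition the authors formulate for functions $\bar u$ that are $C^2$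 up to the boundary). $|u|_{1;\Omega}=\sup_\Omega|u|+\sup_\Omega|Du|$.
   Formalization: In case (i) the constant C may also depend on a compact subset of Γ containing the values of M_u[ū] (without this the claim fails when A depends on z); "admissible with respect to u" is read as: M_u[ū] maps Ω into a compact subset of Γ. *)

theory Defs
  imports "HOL-Analysis.Analysis"
begin

section \<open>Classes of differentiable functions\<close>

definition dir_deriv :: "('a::real_normed_vector \<Rightarrow> 'b::real_normed_vector) \<Rightarrow> 'a \<Rightarrow> 'a \<Rightarrow> 'b"
  where "dir_deriv f v x = frechet_derivative f (at x) v"

text \<open>Intended for open sets in finite-dimensional spaces.\<close>

primrec Ck_on :: "nat \<Rightarrow> 'a::real_normed_vector set \<Rightarrow> ('a \<Rightarrow> 'b::real_normed_vector) \<Rightarrow> bool"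
  where
    "Ck_on 0 S f \<longleftrightarrow> continuous_on S f"
  | "Ck_on (Suc k) S f \<longleftrightarrow> f differentiable_on S \<and> (\<forall>v. Ck_on k S (dir_deriv f v))"

definition extends_continuously ::
    "'a::real_normed_vector set \<Rightarrow> ('a \<Rightarrow> 'b::real_normed_vector) \<Rightarrow> bool"
  where "extends_continuously S f \<longleftrightarrow>
    (\<exists>g. continuous_on (closure S) g \<and> (\<forall>x\<in>S. g x = f x))"

primrec Ck_ext :: "nat \<Rightarrow> 'a::real_normed_vector set \<Rightarrow> ('a \<Rightarrow> 'b::real_normed_vector) \<Rightarrow> bool"
  where
    "Ck_ext 0 S f \<longleftrightarrow> extends_continuously S f"
  | "Ck_ext (Suc k) S f \<longleftrightarrow> extends_continuously S f \<and> f differentiable_on S \<and>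
       (\<forall>v. Ck_ext k S (dir_deriv f v))"

text \<open>
  \<open>Ck_closure k S f\<close> is membership of \<open>f\<close> in \<open>C\<^sup>k\<close> of the closure of the open set \<open>S\<close>: all
  derivatives of order at most \<open>k\<close> in \<open>S\<close> extend continuously to the closure. The function itself
  has to agree with its extension on the frontier; the derivatives need not, since
  \<^const>\<open>frechet_derivative\<close> carries no information at points of the frontier.
\<close>

definition Ck_closure :: "nat \<Rightarrow> 'a::real_normed_vector set \<Rightarrow> ('a \<Rightarrow> 'b::real_normed_vector) \<Rightarrow> bool"
  where "Ck_closure k S f \<longleftrightarrow> continuous_on (closure S) f \<and> Ck_ext k S f"

definition grad :: "(real^'n \<Rightarrow> real) \<Rightarrow> real^'n \<Rightarrow> real^'n"
  where "grad u x = (\<chi> i. dir_deriv u (axis i 1) x)"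

definition hess :: "(real^'n \<Rightarrow> real) \<Rightarrow> real^'n \<Rightarrow> real^'n^'n"
  where "hess u x = (\<chi> i j. dir_deriv (dir_deriv u (axis i 1)) (axis j 1) x)"

text \<open>The values on the frontier of a function given in \<open>\<Omega>\<close>, by continuous extension.\<close>

definition bdry_value :: "(real^'n) set \<Rightarrow> (real^'n \<Rightarrow> 'b::t2_space) \<Rightarrow> real^'n \<Rightarrow> 'b"
  where "bdry_value \<Omega> f x = Lim (at x within \<Omega>) f"

text \<open>Smoothness of the boundary is expressed by local defining functions.\<close>

definition bounded_smooth_domain :: "(real^'n) set \<Rightarrow> bool"
  where "bounded_smooth_domain \<Omega> \<longleftrightarrow>
    open \<Omega> \<and> connected \<Omega> \<and> \<Omega> \<noteq> {} \<and> bounded \<Omega> \<and>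
    (\<forall>x0\<in>frontier \<Omega>. \<exists>U \<rho>. open U \<and> x0 \<in> U \<and> (\<forall>k. Ck_on k U \<rho>) \<and>
       (\<forall>x\<in>U. grad \<rho> x \<noteq> 0) \<and> \<Omega> \<inter> U = {x\<in>U. \<rho> x < 0})"

definition C1_norm :: "(real^'n) set \<Rightarrow> (real^'n \<Rightarrow> real) \<Rightarrow> real"
  where "C1_norm \<Omega> u = (SUP x\<in>\<Omega>. \<bar>u x\<bar>) + (SUP x\<in>\<Omega>. norm (grad u x))"


section \<open>The operator\<close>

definition sym_mats :: "(real^'n^'n) set"
  where "sym_mats = {r. transpose r = r}"

definition pos_def_mats :: "(real^'n^'n) set"
  where "pos_def_mats = {r \<in> sym_mats. \<forall>\<xi>. \<xi> \<noteq> 0 \<longrightarrow> \<xi> \<bullet> (r *v \<xi>) > 0}"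

text \<open>
  A cone with vertex at the origin is only required to be invariant under positive dilations;
  \<^const>\<open>cone\<close> and \<^const>\<open>conic\<close> would force the origin into \<open>\<Gamma>\<close>.
\<close>

definition open_convex_cone :: "(real^'n^'n) set \<Rightarrow> bool"
  where "open_convex_cone \<Gamma> \<longleftrightarrow>
    openin (top_of_set sym_mats) \<Gamma> \<and> convex \<Gamma> \<and> (\<forall>r\<in>\<Gamma>. \<forall>t>0. t *\<^sub>R r \<in> \<Gamma>)"

text \<open>
  \<open>mat_grad F r\<close> is the symmetric matrix \<open>[F\<^sub>i\<^sub>j(r)]\<close> with \<open>dF(r) s = (\<Sum>i j. F\<^sub>i\<^sub>j(r) s\<^sub>i\<^sub>j)\<close> for symmetric
  \<open>s\<close>; the sum is the inner product of \<open>real^'n^'n\<close>. Derivatives are relative to the space of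
  symmetric matrices, so that the values of \<open>F\<close> at other matrices are irrelevant.
\<close>

definition mat_grad :: "(real^'n^'n \<Rightarrow> real) \<Rightarrow> real^'n^'n \<Rightarrow> real^'n^'n"
  where "mat_grad F r =
    (THE G. G \<in> sym_mats \<and> (F has_derivative (\<lambda>s. G \<bullet> s)) (at r within sym_mats))"

definition mat_C2_on :: "(real^'n^'n) set \<Rightarrow> (real^'n^'n \<Rightarrow> real) \<Rightarrow> bool"
  where "mat_C2_on \<Gamma> F \<longleftrightarrow>
    (\<forall>r\<in>\<Gamma>. F differentiable (at r within sym_mats)) \<and>
    (\<exists>H. (\<forall>r\<in>\<Gamma>. (mat_grad F has_derivative H r) (at r within sym_mats)) \<and>
         (\<forall>s\<in>sym_mats. continuous_on \<Gamma> (\<lambda>r. H r s)))"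

definition F1 :: "(real^'n^'n) set \<Rightarrow> (real^'n^'n \<Rightarrow> real) \<Rightarrow> bool"
  where "F1 \<Gamma> F \<longleftrightarrow> (\<forall>r\<in>\<Gamma>. mat_grad F r \<in> pos_def_mats)"

definition F2 :: "(real^'n^'n) set \<Rightarrow> (real^'n^'n \<Rightarrow> real) \<Rightarrow> bool"
  where "F2 \<Gamma> F \<longleftrightarrow> concave_on \<Gamma> F"

definition F3 :: "(real^'n^'n) set \<Rightarrow> (real^'n^'n \<Rightarrow> real) \<Rightarrow> ereal \<Rightarrow> bool"
  where "F3 \<Gamma> F a0 \<longleftrightarrow>
    F ` \<Gamma> = {t. a0 < ereal t} \<and>
    (SUP r0 \<in> top_of_set sym_mats frontier_of \<Gamma>. Limsup (at r0 within \<Gamma>) (\<lambda>r. ereal (F r))) \<le> a0"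

definition F5_plus :: "(real^'n^'n) set \<Rightarrow> (real^'n^'n \<Rightarrow> real) \<Rightarrow> bool"
  where "F5_plus \<Gamma> F \<longleftrightarrow>
    (\<forall>I. is_interval I \<and> bounded I \<and> closure I \<subseteq> F ` \<Gamma> \<longrightarrow>
      (\<forall>N. \<exists>R. \<forall>r\<in>\<Gamma>. F r \<in> I \<and> norm r \<ge> R \<longrightarrow> trace (mat_grad F r) \<ge> N))"

definition orth_invariant :: "(real^'n^'n) set \<Rightarrow> (real^'n^'n \<Rightarrow> real) \<Rightarrow> bool"
  where "orth_invariant \<Gamma> F \<longleftrightarrow>
    (\<forall>Q. orthogonal_matrix Q \<longrightarrow>
      (\<lambda>r. Q ** r ** transpose Q) ` \<Gamma> = \<Gamma> \<and> (\<forall>r\<in>\<Gamma>. F (Q ** r ** transpose Q) = F r))"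


section \<open>The augmented Hessian\<close>

text \<open>\<open>D2pp A x z p k l $ i $ j\<close> is the derivative of \<open>A\<^sub>i\<^sub>j\<close> with respect to \<open>p\<^sub>k\<close> and \<open>p\<^sub>l\<close>.\<close>

definition D2pp ::
    "(real^'n \<Rightarrow> real \<Rightarrow> real^'n \<Rightarrow> real^'n^'n) \<Rightarrow> real^'n \<Rightarrow> real \<Rightarrow> real^'n \<Rightarrow> 'n \<Rightarrow> 'n \<Rightarrow> real^'n^'n"
  where "D2pp A x z p k l = dir_deriv (dir_deriv (A x z) (axis l 1)) (axis k 1) p"

definition regular_on ::
    "(real^'n) set \<Rightarrow> (real^'n \<Rightarrow> real \<Rightarrow> real^'n \<Rightarrow> real^'n^'n) \<Rightarrow> bool"
  where "regular_on S A \<longleftrightarrow>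
    (\<forall>x\<in>S. \<forall>z p \<xi> \<eta>. \<xi> \<bullet> \<eta> = 0 \<longrightarrow>
      (\<Sum>i\<in>UNIV. \<Sum>j\<in>UNIV. \<Sum>k\<in>UNIV. \<Sum>l\<in>UNIV.
         D2pp A x z p k l $ i $ j * \<xi> $ i * \<xi> $ j * \<eta> $ k * \<eta> $ l) \<ge> 0)"

text \<open>\<open>M\<^sub>u[v] = D\<^sup>2v - A(\<cdot>, u, Dv)\<close>; the augmented Hessian of \<open>u\<close> itself is \<open>M\<^sub>u[u]\<close>.\<close>

definition aug_hess_wrt ::
    "(real^'n \<Rightarrow> real \<Rightarrow> real^'n \<Rightarrow> real^'n^'n) \<Rightarrow> (real^'n \<Rightarrow> real) \<Rightarrow> (real^'n \<Rightarrow> real) \<Rightarrow>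
      real^'n \<Rightarrow> real^'n^'n"
  where "aug_hess_wrt A u v x = hess v x - A x (u x) (grad v x)"

definition aug_hess ::
    "(real^'n \<Rightarrow> real \<Rightarrow> real^'n \<Rightarrow> real^'n^'n) \<Rightarrow> (real^'n \<Rightarrow> real) \<Rightarrow> real^'n \<Rightarrow> real^'n^'n"
  where "aug_hess A u = aug_hess_wrt A u u"

definition admissible_solution ::
    "(real^'n) set \<Rightarrow> (real^'n^'n) set \<Rightarrow> (real^'n^'n \<Rightarrow> real) \<Rightarrow>
      (real^'n \<Rightarrow> real \<Rightarrow> real^'n \<Rightarrow> real^'n^'n) \<Rightarrow> (real^'n \<Rightarrow> real \<Rightarrow> real^'n \<Rightarrow> real) \<Rightarrow>
      (real^'n \<Rightarrow> real) \<Rightarrow> bool"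
  where "admissible_solution \<Omega> \<Gamma> F A B u \<longleftrightarrow>
    (\<forall>x\<in>\<Omega>. aug_hess A u x \<in> \<Gamma> \<and> F (aug_hess A u x) = B x (u x) (grad u x))"

text \<open>
  For \<open>v\<close> of class \<open>C\<^sup>2\<close> up to the boundary, \<open>M\<^sub>u[v] \<in> \<Gamma>\<close> on the closure of \<open>\<Omega>\<close> says precisely that
  \<open>M\<^sub>u[v]\<close> maps \<open>\<Omega>\<close> into a compact subset of \<open>\<Gamma>\<close>. The latter formulation also makes sense when
  \<open>v\<close> is \<open>C\<^sup>2\<close> only in \<open>\<Omega>\<close>, and is the definition adopted here.
\<close>

definition admissible_wrt ::
    "(real^'n) set \<Rightarrow> (real^'n^'n) set \<Rightarrow> (real^'n \<Rightarrow> real \<Rightarrow> real^'n \<Rightarrow> real^'n^'n) \<Rightarrow>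
      (real^'n \<Rightarrow> real) \<Rightarrow> (real^'n \<Rightarrow> real) \<Rightarrow> bool"
  where "admissible_wrt \<Omega> \<Gamma> A u v \<longleftrightarrow>
    (\<exists>S. compact S \<and> S \<subseteq> \<Gamma> \<and> aug_hess_wrt A u v ` \<Omega> \<subseteq> S)"

definition subsolution_wrt ::
    "(real^'n) set \<Rightarrow> (real^'n^'n \<Rightarrow> real) \<Rightarrow> (real^'n \<Rightarrow> real \<Rightarrow> real^'n \<Rightarrow> real^'n^'n) \<Rightarrow>
      (real^'n \<Rightarrow> real \<Rightarrow> real^'n \<Rightarrow> real) \<Rightarrow> (real^'n \<Rightarrow> real) \<Rightarrow> (real^'n \<Rightarrow> real) \<Rightarrow> bool"
  where "subsolution_wrt \<Omega> F A B u v \<longleftrightarrow>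
    (\<forall>x\<in>\<Omega>. F (aug_hess_wrt A u v x) \<ge> B x (u x) (grad v x))"

definition second_deriv_bound :: "(real^'n) set \<Rightarrow> (real^'n \<Rightarrow> real) \<Rightarrow> real \<Rightarrow> bool"
  where "second_deriv_bound \<Omega> u C \<longleftrightarrow>
    (SUP x\<in>\<Omega>. norm (hess u x)) \<le> C * (1 + (SUP x\<in>frontier \<Omega>. norm (bdry_value \<Omega> (hess u) x)))"

text \<open>
  In the second derivative estimate the constant is uniform over all \<open>u\<close> with \<^const>\<open>C1_norm\<close> at most \<open>K\<close>. Since
  \<open>M\<^sub>u[v]\<close> involves the values of \<open>u\<close>, a bound for \<open>u\<close> does not by itself keep \<open>M\<^sub>u[v]\<close> uniformly
  away from the boundary of \<open>\<Gamma>\<close>, and without this there is no uniform constant under \<^const>\<open>F5_plus\<close>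
  alone. There the compact set \<open>S\<close> witnessing \<^const>\<open>admissible_wrt\<close> is therefore one of the data on
  which the constant depends. For \<open>A\<close> independent of \<open>z\<close> this is no additional dependence, because
  \<open>M\<^sub>u[v]\<close> is then determined by \<open>A\<close> and \<open>v\<close>. For subsolutions \<open>v\<close> no such set is needed: the
  inequality \<open>F(M\<^sub>u[v]) \<ge> B > a\<^sub>0\<close> supplies one.
\<close>

end

theory Submission
  imports Defs
begin

text \<open>
  The function \<open>(\<xi> \<bullet> M[u] \<xi>) e\<^sup>\<phi>\<close> with \<open>\<phi> = \<tau> |Du|\<^sup>2 / 2 + \<kappa> exp (k (ubar - u))\<close> is maximised over the closure of \<open>\<Omega>\<close> and
  unit vectors \<open>\<xi>\<close>. At an interior maximum the third derivatives coming from the exponential factor are absorbed by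
  the concavity of \<open>F\<close> together with its orthogonal invariance. Instead of the formula for the second derivatives of
  a spectral function, only the supporting plane inequality for \<open>F\<close> along a rotating orthonormal frame is used, so that
  \<open>F\<close> is differentiated once. Regularity of \<open>A\<close> makes the linearised operator nonnegative on \<open>ubar - u\<close> up to
  terms absorbed by the exponential; it is either strictly positive there, or the equation is uniformly elliptic
  at the point and \<open>\<tau> |Du|\<^sup>2 / 2\<close> suffices.
\<close>

section \<open>Directional derivatives\<close>

text \<open>The obstacle is the sum of \<open>f j * (p1 (e j))^2\<close> which the exponential
  factor leaves at the maximum with the wrong sign: the eigenvalues \<open>f j\<close> of the
  gradient of \<open>F\<close> have no common bound. Indices with \<open>f j \<le> f m\<close>
  reduce to \<open>f m\<close>, and \<open>f m * (l m)^2\<close> is part of the good term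
  \<open>s\<close> that half the squared gradient produces. Very negative \<open>l j\<close> have a
  square comparable to \<open>(l m)^2\<close> and are charged to \<open>s\<close> too. The rotation
  pays for the rest. The supporting plane bounds \<open>F\<close> in every frame, with equality in
  the eigenframe at the point itself, so the speed of the rotation is a free parameter. Its optimal
  value would reproduce the quotient \<open>(f i - f m) / (l m - l i)\<close> of spectral calculus;
  the cruder speed \<open>\<omega> i / l m\<close> suffices and never divides by a difference of
  eigenvalues. Freezing the direction at the maximum avoids differentiating the top eigenvalue,
  which may be multiple. Only upper eigenvalues have to be estimated, because concavity and a lower
  bound for \<open>F\<close> then control the negative ones. All constants are fixed before
  \<open>u\<close>, from bounds of the data on a compact set of arguments.\<close>

lemma dir_deriv_has_derivative:
  assumes "f differentiable (at x)"
  shows "(f has_derivative (\<lambda>v. dir_deriv f v x)) (at x)"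
  using assms unfolding dir_deriv_def by (simp add: frechet_derivative_works)

lemma dir_deriv_eq:
  assumes "(f has_derivative f') (at x)"
  shows "dir_deriv f v x = f' v"
  using frechet_derivative_at[OF assms] unfolding dir_deriv_def by simp

lemma linear_dir_deriv:
  assumes "f differentiable (at x)"
  shows "linear (\<lambda>v. dir_deriv f v x)"
  using dir_deriv_has_derivative[OF assms] has_derivative_linear by blast

lemma dir_deriv_cong:
  assumes "open S" "x \<in> S" "\<And>y. y \<in> S \<Longrightarrow> f y = g y"
  shows "dir_deriv f v x = dir_deriv g v x"
proof -
  have "(f has_derivative h) (at x) \<longleftrightarrow> (g has_derivative h) (at x)" for h
    by (intro iffI; erule has_derivative_transform_within_open[OF _ assms(1,2)]) (simp_all add: assms(3))
  then show ?thesis by (simp add: dir_deriv_def frechet_derivative_def)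
qed

lemma Ck_on_SucD:
  assumes "open S" "Ck_on (Suc k) S f" "x \<in> S"
  shows "f differentiable (at x)"
  using assms by (auto simp: differentiable_on_eq_differentiable_at)

lemma Ck_on_dir_deriv: "Ck_on (Suc k) S f \<Longrightarrow> Ck_on k S (dir_deriv f v)"
  by simp

lemma Ck_on_Suc_imp: "Ck_on (Suc k) S f \<Longrightarrow> Ck_on k S f"
  by (induction k arbitrary: f) (auto simp: differentiable_imp_continuous_on)

lemma Ck_on_le:
  assumes "Ck_on m S f" "k \<le> m"
  shows "Ck_on k S f"
  using assms(2,1) by (induction rule: dec_induct) (use Ck_on_Suc_imp in blast)+

lemma Ck_ext_imp_Ck_on:
  assumes "Ck_ext k S f"
  shows "Ck_on k S f"
proof -
  have cont: "continuous_on S g" if g: "extends_continuously S g" for g :: "'a \<Rightarrow> 'b"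
  proof -
    from g obtain h where h: "continuous_on (closure S) h" "\<forall>x\<in>S. h x = g x"
      unfolding extends_continuously_def by (elim exE conjE)
    have "continuous_on S h" using h(1) closure_subset by (rule continuous_on_subset)
    then show ?thesis by (rule continuous_on_eq) (simp add: h(2))
  qed
  show ?thesis using assms
  proof (induction k arbitrary: f)
    case 0
    then show ?case using cont[of f] by simp
  next
    case (Suc k)
    then show ?case using Suc.IH[of "dir_deriv f v" for v] by simp
  qed
qed

lemma has_derivative_along_line:
  assumes "(f has_derivative f') (at (x + s *\<^sub>R v))"
  shows "((\<lambda>s. f (x + s *\<^sub>R v)) has_derivative (\<lambda>h. h *\<^sub>R f' v)) (at s)"
proof -
  have "((\<lambda>s. x + s *\<^sub>R v) has_derivative (\<lambda>h. h *\<^sub>R v)) (at s)"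
    by (auto intro!: derivative_eq_intros)
  from has_derivative_compose[OF this assms]
  show ?thesis using linear_scale[OF has_derivative_linear[OF assms]] by simp
qed

text \<open>The difference quotient is symmetric in \<open>v\<close> and \<open>w\<close>, hence so is its limit.\<close>

lemma second_difference_tendsto:
  fixes f :: "'a::real_normed_vector \<Rightarrow> real"
  assumes S: "open S" "x \<in> S" and f: "Ck_on 2 S f"
  shows "((\<lambda>h. (f (x + h *\<^sub>R v + h *\<^sub>R w) - f (x + h *\<^sub>R v) - f (x + h *\<^sub>R w) + f x) / h\<^sup>2)
      \<longlongrightarrow> dir_deriv (dir_deriv f v) w x) (at_right 0)"
proof (rule tendstoI)
  fix \<epsilon> :: real assume "\<epsilon> > 0"
  have f': "Ck_on (Suc 1) S f" using f by (simp add: numeral_2_eq_2)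
  have d1: "(f has_derivative (\<lambda>v. dir_deriv f v y)) (at y)" if "y \<in> S" for y
    using Ck_on_SucD[OF S(1) f' that] by (rule dir_deriv_has_derivative)
  have d2: "(dir_deriv f v has_derivative (\<lambda>w. dir_deriv (dir_deriv f v) w y)) (at y)" if "y \<in> S" for y
    using f' that S(1) by (intro dir_deriv_has_derivative) (auto simp: differentiable_on_eq_differentiable_at)
  have "continuous_on S (dir_deriv (dir_deriv f v) w)" using f' by simp
  then have "isCont (dir_deriv (dir_deriv f v) w) x" using S continuous_on_eq_continuous_at by blast
  then obtain d where "d > 0" and d: "\<forall>y. dist y x < d \<longrightarrow>
      dist (dir_deriv (dir_deriv f v) w y) (dir_deriv (dir_deriv f v) w x) < \<epsilon>"
    unfolding continuous_at_eps_delta using \<open>\<epsilon> > 0\<close> by blast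
  obtain d' where "d' > 0" and d': "ball x d' \<subseteq> S" using S openE by blast
  \<comment> \<open>For \<open>h < \<delta>\<close> the whole parallelogram with sides
    \<open>h v\<close> and \<open>h w\<close> stays in \<open>S\<close> and in the ball where the
    mixed derivative varies by less than \<epsilon>.\<close>
  define \<delta> where "\<delta> = min d d' / (norm v + norm w + 1)"
  have pos: "norm v + norm w + 1 > 0" by (simp add: add_nonneg_pos)
  have "\<delta> > 0" using \<open>d > 0\<close> \<open>d' > 0\<close> pos by (simp add: \<delta>_def)
  have near: "dist (x + a *\<^sub>R v + b *\<^sub>R w) x < min d d'" if "0 \<le> a" "a \<le> h" "0 \<le> b" "b \<le> h" "0 < h" "h < \<delta>" for a b h
  proof -
    have "dist (x + a *\<^sub>R v + b *\<^sub>R w) x \<le> a * norm v + b * norm w"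
      using that norm_triangle_ineq[of "a *\<^sub>R v" "b *\<^sub>R w"] by (simp add: dist_norm)
    also have "\<dots> \<le> h * norm v + h * norm w"
      using that by (intro add_mono mult_right_mono) auto
    also have "\<dots> \<le> h * (norm v + norm w + 1)"
      using that by (simp add: algebra_simps)
    also have "\<dots> < \<delta> * (norm v + norm w + 1)"
      using that pos by simp
    finally show ?thesis using pos by (simp add: \<delta>_def)
  qed
  have "dist ((f (x + h *\<^sub>R v + h *\<^sub>R w) - f (x + h *\<^sub>R v) - f (x + h *\<^sub>R w) + f x) / h\<^sup>2)
      (dir_deriv (dir_deriv f v) w x) < \<epsilon>" if h: "0 < h" "h < \<delta>" for h
  proof -
    \<comment> \<open>Two mean value theorems, the first along \<open>v\<close> for the increment
      over \<open>h w\<close>, the second along \<open>w\<close>, turn the second difference into a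
      mixed derivative at an intermediate point.\<close>
    define g where "g s = f (x + s *\<^sub>R v + h *\<^sub>R w) - f (x + s *\<^sub>R v)" for s
    have inS: "x + a *\<^sub>R v + b *\<^sub>R w \<in> S" if "0 \<le> a" "a \<le> h" "0 \<le> b" "b \<le> h" for a b
    proof -
      have "x + a *\<^sub>R v + b *\<^sub>R w \<in> ball x d'" using near[OF that h] by (simp add: dist_commute)
      with d' show ?thesis by (rule subsetD)
    qed
    have inS0: "x + a *\<^sub>R v \<in> S" if "0 \<le> a" "a \<le> h" for a
      using inS[of a 0] that h by simp
    have "(g has_derivative (\<lambda>y. y * (dir_deriv f v (x + s *\<^sub>R v + h *\<^sub>R w) - dir_deriv f v (x + s *\<^sub>R v)))) (at s)"
      if "0 \<le> s" "s \<le> h" for s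
    proof -
      have "x + h *\<^sub>R w + s *\<^sub>R v \<in> S" using inS[of s h] that h by (simp add: add_ac)
      from has_derivative_diff[OF has_derivative_along_line[OF d1[OF this]] has_derivative_along_line[OF d1[OF inS0[OF that]]]]
      show ?thesis unfolding g_def by (simp add: algebra_simps)
    qed
    note dg = this
    note mvt_simple[OF h(1), of g "\<lambda>s y. y * (dir_deriv f v (x + s *\<^sub>R v + h *\<^sub>R w) - dir_deriv f v (x + s *\<^sub>R v))",
      OF has_derivative_at_withinI[OF dg]]
    then obtain s where s: "0 < s" "s < h" and
      gs: "g h - g 0 = h * (dir_deriv f v (x + s *\<^sub>R v + h *\<^sub>R w) - dir_deriv f v (x + s *\<^sub>R v))"
      by auto
    have "((\<lambda>t. dir_deriv f v (x + s *\<^sub>R v + t *\<^sub>R w)) has_derivative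
        (\<lambda>y. y * dir_deriv (dir_deriv f v) w (x + s *\<^sub>R v + t *\<^sub>R w))) (at t)" if "0 \<le> t" "t \<le> h" for t
    proof -
      have "x + s *\<^sub>R v + t *\<^sub>R w \<in> S" using inS that s by simp
      from has_derivative_along_line[OF d2[OF this]] show ?thesis by simp
    qed
    note dv = this
    note mvt_simple[OF h(1), of "\<lambda>t. dir_deriv f v (x + s *\<^sub>R v + t *\<^sub>R w)"
      "\<lambda>t y. y * dir_deriv (dir_deriv f v) w (x + s *\<^sub>R v + t *\<^sub>R w)", OF has_derivative_at_withinI[OF dv]]
    then obtain t where t: "0 < t" "t < h" and
      gt: "dir_deriv f v (x + s *\<^sub>R v + h *\<^sub>R w) - dir_deriv f v (x + s *\<^sub>R v) = h * dir_deriv (dir_deriv f v) w (x + s *\<^sub>R v + t *\<^sub>R w)"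
      by auto
    have "f (x + h *\<^sub>R v + h *\<^sub>R w) - f (x + h *\<^sub>R v) - f (x + h *\<^sub>R w) + f x = g h - g 0"
      by (simp add: g_def)
    also have "\<dots> = h\<^sup>2 * dir_deriv (dir_deriv f v) w (x + s *\<^sub>R v + t *\<^sub>R w)"
      by (simp add: gs gt power2_eq_square)
    finally have "(f (x + h *\<^sub>R v + h *\<^sub>R w) - f (x + h *\<^sub>R v) - f (x + h *\<^sub>R w) + f x) / h\<^sup>2 = dir_deriv (dir_deriv f v) w (x + s *\<^sub>R v + t *\<^sub>R w)"
      using h by simp
    moreover have "dist (dir_deriv (dir_deriv f v) w (x + s *\<^sub>R v + t *\<^sub>R w)) (dir_deriv (dir_deriv f v) w x) < \<epsilon>"
      using near[of s h t] s t h d by simp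
    ultimately show ?thesis by simp
  qed
  then show "\<forall>\<^sub>F h in at_right 0. dist ((f (x + h *\<^sub>R v + h *\<^sub>R w) - f (x + h *\<^sub>R v) - f (x + h *\<^sub>R w) + f x) / h\<^sup>2)
      (dir_deriv (dir_deriv f v) w x) < \<epsilon>"
    unfolding eventually_at_right_field using \<open>\<delta> > 0\<close> by blast
qed

lemma dir_deriv_commute:
  fixes f :: "'a::real_normed_vector \<Rightarrow> real"
  assumes "open S" "x \<in> S" "Ck_on 2 S f"
  shows "dir_deriv (dir_deriv f v) w x = dir_deriv (dir_deriv f w) v x"
proof (rule tendsto_unique[OF _ second_difference_tendsto[OF assms]])
  show "((\<lambda>h. (f (x + h *\<^sub>R v + h *\<^sub>R w) - f (x + h *\<^sub>R v) - f (x + h *\<^sub>R w) + f x) / h\<^sup>2)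
      \<longlongrightarrow> dir_deriv (dir_deriv f w) v x) (at_right 0)"
    using second_difference_tendsto[OF assms, of w v] by (simp add: algebra_simps)
qed simp

text \<open>The direction of the inner derivative is a parameter: its linearity holds at all points
  of \<open>S\<close>, so it survives the outer differentiation. The outer direction is the easier
  \<open>linear_dir_deriv2\<close>.\<close>

lemma linear_dir_deriv_dir_deriv:
  assumes S: "open S" "x \<in> S" and f: "Ck_on 2 S f"
  shows "linear (\<lambda>v. dir_deriv (dir_deriv f v) w x)"
proof -
  have f': "Ck_on (Suc 1) S f" using f by (simp add: numeral_2_eq_2)
  have d1: "linear (\<lambda>v. dir_deriv f v y)" if "y \<in> S" for y
    using Ck_on_SucD[OF S(1) f' that] by (rule linear_dir_deriv)
  have d2: "(dir_deriv f v has_derivative (\<lambda>w. dir_deriv (dir_deriv f v) w x)) (at x)" for v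
    using f' S by (intro dir_deriv_has_derivative) (auto simp: differentiable_on_eq_differentiable_at)
  show ?thesis
  proof (rule linearI)
    fix a b
    have "dir_deriv (dir_deriv f (a + b)) w x = dir_deriv (\<lambda>y. dir_deriv f a y + dir_deriv f b y) w x"
      using linear_add[OF d1] by (intro dir_deriv_cong[OF S]) auto
    also have "\<dots> = dir_deriv (dir_deriv f a) w x + dir_deriv (dir_deriv f b) w x"
      by (rule dir_deriv_eq) (intro has_derivative_add d2)
    finally show "dir_deriv (dir_deriv f (a + b)) w x = dir_deriv (dir_deriv f a) w x + dir_deriv (dir_deriv f b) w x" .
  next
    fix c a
    have "dir_deriv (dir_deriv f (c *\<^sub>R a)) w x = dir_deriv (\<lambda>y. c *\<^sub>R dir_deriv f a y) w x"
      using linear_scale[OF d1] by (intro dir_deriv_cong[OF S]) auto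
    also have "\<dots> = c *\<^sub>R dir_deriv (dir_deriv f a) w x"
      by (rule dir_deriv_eq) (intro has_derivative_scaleR_right d2)
    finally show "dir_deriv (dir_deriv f (c *\<^sub>R a)) w x = c *\<^sub>R dir_deriv (dir_deriv f a) w x" .
  qed
qed

lemma linear_dir_deriv2:
  assumes S: "open S" "x \<in> S" and f: "Ck_on 2 S f"
  shows "linear (\<lambda>w. dir_deriv (dir_deriv f v) w x)"
  using assms by (intro linear_dir_deriv) (auto simp: differentiable_on_eq_differentiable_at numeral_2_eq_2)

section \<open>Second order jets of functions of one real variable\<close>

text \<open>Just the smoothness that tests at a maximum use: a derivative near 0 that is itself
  differentiable at 0. All later differentiation runs along curves, so one-variable jets with sum,
  product and chain rules suffice.\<close>

definition jet2 :: "(real \<Rightarrow> 'a::real_normed_vector) \<Rightarrow> 'a \<Rightarrow> 'a \<Rightarrow> bool"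
  where "jet2 f a b \<longleftrightarrow> (\<exists>f'. (\<forall>\<^sub>F t in nhds 0. (f has_vector_derivative f' t) (at t)) \<and>
    f' 0 = a \<and> (f' has_vector_derivative b) (at 0))"

lemma jet2I:
  assumes "\<forall>\<^sub>F t in nhds 0. (f has_vector_derivative f' t) (at t)" "f' 0 = a"
    "(f' has_vector_derivative b) (at 0)"
  shows "jet2 f a b"
  using assms unfolding jet2_def by blast

lemma jet2_imp_deriv: "jet2 f a b \<Longrightarrow> (f has_vector_derivative a) (at 0)"
  unfolding jet2_def by (metis eventually_nhds_x_imp_x)

lemma jet2_const: "jet2 (\<lambda>_. c) 0 0"
  by (rule jet2I[where f' = "\<lambda>_. 0"]) auto

lemma jet2_add:
  assumes "jet2 f a b" "jet2 g c d"
  shows "jet2 (\<lambda>t. f t + g t) (a + c) (b + d)"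
proof -
  obtain f' g' where f: "\<forall>\<^sub>F t in nhds 0. (f has_vector_derivative f' t) (at t)" "f' 0 = a" "(f' has_vector_derivative b) (at 0)"
    and g: "\<forall>\<^sub>F t in nhds 0. (g has_vector_derivative g' t) (at t)" "g' 0 = c" "(g' has_vector_derivative d) (at 0)"
    using assms unfolding jet2_def by blast
  show ?thesis
  proof (rule jet2I[where f' = "\<lambda>t. f' t + g' t"])
    show "\<forall>\<^sub>F t in nhds 0. ((\<lambda>t. f t + g t) has_vector_derivative f' t + g' t) (at t)"
      using f(1) g(1) by eventually_elim (rule has_vector_derivative_add)
  qed (use f g in \<open>auto intro: has_vector_derivative_add\<close>)
qed

lemma jet2_linear:
  assumes "bounded_linear L" "jet2 f a b"
  shows "jet2 (\<lambda>t. L (f t)) (L a) (L b)"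
proof -
  obtain f' where f: "\<forall>\<^sub>F t in nhds 0. (f has_vector_derivative f' t) (at t)" "f' 0 = a" "(f' has_vector_derivative b) (at 0)"
    using assms unfolding jet2_def by blast
  show ?thesis
  proof (rule jet2I[where f' = "\<lambda>t. L (f' t)"])
    show "\<forall>\<^sub>F t in nhds 0. ((\<lambda>t. L (f t)) has_vector_derivative L (f' t)) (at t)"
      using f(1) by eventually_elim (rule bounded_linear.has_vector_derivative[OF assms(1)])
  qed (use f in \<open>auto intro: bounded_linear.has_vector_derivative[OF assms(1)]\<close>)
qed

lemma jet2_diff: "jet2 f a b \<Longrightarrow> jet2 g c d \<Longrightarrow> jet2 (\<lambda>t. f t - g t) (a - c) (b - d)"
  using jet2_add[of f a b "\<lambda>t. - g t" "- c" "- d"] jet2_linear[OF bounded_linear_minus[OF bounded_linear_ident], of g c d]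
  by simp

lemma jet2_sum:
  assumes "finite I" "\<And>i. i \<in> I \<Longrightarrow> jet2 (f i) (a i) (b i)"
  shows "jet2 (\<lambda>t. \<Sum>i\<in>I. f i t) (\<Sum>i\<in>I. a i) (\<Sum>i\<in>I. b i)"
  using assms by (induction rule: finite_induct) (simp_all add: jet2_const jet2_add)

text \<open>One Leibniz rule serves products of reals, inner products and matrices applied to
  vectors.\<close>

lemma jet2_bilinear:
  assumes "bounded_bilinear P" "jet2 f a b" "jet2 g c d"
  shows "jet2 (\<lambda>t. P (f t) (g t)) (P a (g 0) + P (f 0) c) (P b (g 0) + 2 *\<^sub>R P a c + P (f 0) d)"
proof -
  obtain f' g' where f: "\<forall>\<^sub>F t in nhds 0. (f has_vector_derivative f' t) (at t)" "f' 0 = a" "(f' has_vector_derivative b) (at 0)"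
    and g: "\<forall>\<^sub>F t in nhds 0. (g has_vector_derivative g' t) (at t)" "g' 0 = c" "(g' has_vector_derivative d) (at 0)"
    using assms unfolding jet2_def by blast
  note B = bounded_bilinear.has_vector_derivative[OF assms(1)]
  have "((\<lambda>t. P (f' t) (g t) + P (f t) (g' t)) has_vector_derivative
      (P (f' 0) c + P b (g 0)) + (P (f 0) d + P a (g' 0))) (at 0)"
    using f g jet2_imp_deriv[OF assms(2)] jet2_imp_deriv[OF assms(3)]
    by (intro has_vector_derivative_add B)
  then have D: "((\<lambda>t. P (f' t) (g t) + P (f t) (g' t)) has_vector_derivative
      (P b (g 0) + 2 *\<^sub>R P a c + P (f 0) d)) (at 0)"
    by (simp add: f(2) g(2) scaleR_2 algebra_simps)
  show ?thesis
  proof (rule jet2I[where f' = "\<lambda>t. P (f' t) (g t) + P (f t) (g' t)"])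
    show "\<forall>\<^sub>F t in nhds 0. ((\<lambda>t. P (f t) (g t)) has_vector_derivative P (f' t) (g t) + P (f t) (g' t)) (at t)"
      using f(1) g(1) by eventually_elim (subst add.commute, rule B)
  qed (use f g D in auto)
qed

lemmas jet2_mult = jet2_bilinear[OF bounded_bilinear_mult]
lemmas jet2_inner = jet2_bilinear[OF bounded_bilinear_inner]

lemma jet2_Pair:
  assumes "jet2 f a b" "jet2 g c d"
  shows "jet2 (\<lambda>t. (f t, g t)) (a, c) (b, d)"
proof -
  have "jet2 (\<lambda>t. (f t, 0) + (0, g t)) ((a, 0) + (0, c)) ((b, 0) + (0, d))"
    by (intro jet2_add jet2_linear[of "\<lambda>x. (x, 0)"] jet2_linear[of "\<lambda>x. (0, x)"]
        bounded_linear_Pair bounded_linear_ident bounded_linear_zero assms)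
  then show ?thesis by simp
qed

lemma jet2_line: "jet2 (\<lambda>t. x + t *\<^sub>R v) v 0"
  by (rule jet2I[where f' = "\<lambda>_. v"]) (auto intro!: derivative_eq_intros eventuallyI)

lemma jet2_real_iff:
  fixes f :: "real \<Rightarrow> real"
  shows "jet2 f a b \<longleftrightarrow> (\<exists>f'. (\<forall>\<^sub>F t in nhds 0. (f has_real_derivative f' t) (at t)) \<and>
    f' 0 = a \<and> (f' has_real_derivative b) (at 0))"
  unfolding jet2_def has_real_derivative_iff_has_vector_derivative ..

lemma jet2_exp:
  fixes f :: "real \<Rightarrow> real"
  assumes "jet2 f a b"
  shows "jet2 (\<lambda>t. exp (f t)) (a * exp (f 0)) ((b + a\<^sup>2) * exp (f 0))"
proof -
  obtain f' where f: "\<forall>\<^sub>F t in nhds 0. (f has_real_derivative f' t) (at t)" "f' 0 = a" "(f' has_real_derivative b) (at 0)"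
    using assms unfolding jet2_real_iff by blast
  have f0: "(f has_real_derivative a) (at 0)" using f(1,2) eventually_nhds_x_imp_x by fastforce
  show ?thesis unfolding jet2_real_iff
  proof (intro exI conjI)
    show "\<forall>\<^sub>F t in nhds 0. ((\<lambda>t. exp (f t)) has_real_derivative f' t * exp (f t)) (at t)"
      using f(1) by eventually_elim (auto intro!: derivative_eq_intros)
    show "((\<lambda>t. f' t * exp (f t)) has_real_derivative (b + a\<^sup>2) * exp (f 0)) (at 0)"
      using f f0 by (auto intro!: derivative_eq_intros simp: algebra_simps power2_eq_square)
  qed (simp add: f)
qed

text \<open>If \<open>b\<close> were positive, \<open>f'\<close> would be positive just to the right
  of 0, since it vanishes at 0, and \<open>f\<close> would increase there.\<close>

lemma jet2_local_max:
  fixes f :: "real \<Rightarrow> real"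
  assumes "jet2 f a b" and max: "\<forall>\<^sub>F t in nhds 0. f t \<le> f 0"
  shows "a = 0" "b \<le> 0"
proof -
  obtain f' where f: "\<forall>\<^sub>F t in nhds 0. (f has_real_derivative f' t) (at t)" "f' 0 = a" "(f' has_real_derivative b) (at 0)"
    using assms(1) unfolding jet2_real_iff by blast
  from eventually_conj[OF f(1) max] obtain d where "d > 0" and
    d: "\<forall>t. dist t 0 < d \<longrightarrow> (f has_real_derivative f' t) (at t) \<and> f t \<le> f 0"
    unfolding eventually_nhds_metric by blast
  have df: "(f has_real_derivative f' t) (at t)" "f t \<le> f 0" if "\<bar>t\<bar> < d" for t
    using d that by (simp_all add: dist_real_def)
  have "(f has_real_derivative a) (at 0)" using df(1)[of 0] \<open>d > 0\<close> f(2) by simp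
  then show "a = 0"
    by (rule DERIV_local_max[OF _ \<open>d > 0\<close>]) (simp add: df(2))
  show "b \<le> 0"
  proof (rule ccontr)
    assume "\<not> b \<le> 0"
    then have "b > 0" by simp
    from DERIV_pos_inc_right[OF f(3) this] obtain e where e: "e > 0" "\<forall>h>0. h < e \<longrightarrow> f' 0 < f' (0 + h)"
      by blast
    define m where "m = min d e / 2"
    have m: "0 < m" "m < d" "m < e" using \<open>d > 0\<close> e(1) by (simp_all add: m_def min_def)
    have "f 0 < f m"
    proof (rule DERIV_pos_imp_increasing_open[OF m(1)])
      fix x assume x: "0 < x" "x < m"
      have "(f has_real_derivative f' x) (at x)" by (rule df) (use x m in simp)
      moreover have "f' x > 0" using e(2) x m f(2) \<open>a = 0\<close> by simp
      ultimately show "\<exists>y. DERIV f x :> y \<and> y > 0" by blast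
    next
      show "continuous_on {0..m} f"
      proof (rule DERIV_continuous_on)
        fix x assume "x \<in> {0..m}"
        then have "\<bar>x\<bar> < d" using m by simp
        from has_field_derivative_at_within[OF df(1)[OF this]]
        show "(f has_real_derivative f' x) (at x within {0..m})" .
      qed
    qed
    then show False using df(2)[of m] m by simp
  qed
qed

lemma jet2_local_min:
  fixes f :: "real \<Rightarrow> real"
  assumes "jet2 f a b" and "\<forall>\<^sub>F t in nhds 0. f 0 \<le> f t"
  shows "a = 0" "b \<ge> 0"
  using jet2_local_max[of "\<lambda>t. - f t" "- a" "- b"] jet2_linear[OF bounded_linear_minus[OF bounded_linear_ident] assms(1)] assms(2)
  by auto

lemma jet2_compose:
  fixes g :: "'a::euclidean_space \<Rightarrow> 'b::real_normed_vector"
  assumes Y: "open Y" and g: "Ck_on 2 Y g" and \<gamma>: "jet2 \<gamma> a b" and y: "\<gamma> 0 = y" "y \<in> Y"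
  shows "jet2 (\<lambda>t. g (\<gamma> t)) (dir_deriv g a y) (dir_deriv (dir_deriv g a) a y + dir_deriv g b y)"
proof -
  have g': "Ck_on (Suc 1) Y g" using g by (simp add: numeral_2_eq_2)
  have d1: "(g has_derivative (\<lambda>v. dir_deriv g v y)) (at y)" if "y \<in> Y" for y
    using Ck_on_SucD[OF Y g' that] by (rule dir_deriv_has_derivative)
  have d2: "(dir_deriv g v has_derivative (\<lambda>w. dir_deriv (dir_deriv g v) w y)) (at y)" if "y \<in> Y" for y v
    using g' that Y by (intro dir_deriv_has_derivative) (auto simp: differentiable_on_eq_differentiable_at)
  note lin = has_derivative_linear[OF d1]
  obtain \<gamma>' where \<gamma>': "\<forall>\<^sub>F t in nhds 0. (\<gamma> has_vector_derivative \<gamma>' t) (at t)" "\<gamma>' 0 = a" "(\<gamma>' has_vector_derivative b) (at 0)"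
    using \<gamma> unfolding jet2_def by blast
  have \<gamma>0: "(\<gamma> has_vector_derivative a) (at 0)" using jet2_imp_deriv[OF \<gamma>] .
  have "(\<gamma> \<longlongrightarrow> \<gamma> 0) (nhds 0)"
    using has_vector_derivative_continuous[OF \<gamma>0]
    unfolding isCont_def tendsto_at_iff_tendsto_nhds .
  then have \<gamma>Y: "\<forall>\<^sub>F t in nhds 0. \<gamma> t \<in> Y"
    by (rule topological_tendstoD) (use y Y in simp_all)
  \<comment> \<open>Expanding the moving velocity in a fixed basis leaves only derivatives of
    \<open>g\<close> in constant directions, the only ones that \<open>Ck_on\<close> speaks
    of.\<close>
  define G where "G t = (\<Sum>i\<in>Basis. (\<gamma>' t \<bullet> i) *\<^sub>R dir_deriv g i (\<gamma> t))" for t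
  have repr: "(\<Sum>i\<in>Basis. (v \<bullet> i) *\<^sub>R dir_deriv g i z) = dir_deriv g v z" if "z \<in> Y" for v z
    using linear_sum[OF lin[OF that], of "\<lambda>i. (v \<bullet> i) *\<^sub>R i" Basis] linear_scale[OF lin[OF that]]
    by (simp add: euclidean_representation)
  show ?thesis
  proof (rule jet2I[where f' = G])
    show "\<forall>\<^sub>F t in nhds 0. ((\<lambda>t. g (\<gamma> t)) has_vector_derivative G t) (at t)"
      using \<gamma>'(1) \<gamma>Y
    proof eventually_elim
      case (elim t)
      from has_derivative_compose[OF elim(1)[unfolded has_vector_derivative_def] d1[OF elim(2)]]
      show ?case
        by (simp add: has_vector_derivative_def G_def repr[OF elim(2)] linear_scale[OF lin[OF elim(2)]])
    qed
    show "G 0 = dir_deriv g a y" using y by (simp add: G_def repr \<gamma>')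
    have "((\<lambda>t. (\<gamma>' t \<bullet> i) *\<^sub>R dir_deriv g i (\<gamma> t)) has_vector_derivative
        ((\<gamma>' 0 \<bullet> i) *\<^sub>R dir_deriv (dir_deriv g i) a y + (b \<bullet> i) *\<^sub>R dir_deriv g i (\<gamma> 0))) (at 0)" for i
    proof (rule bounded_bilinear.has_vector_derivative[OF bounded_bilinear_scaleR])
      show "((\<lambda>t. \<gamma>' t \<bullet> i) has_vector_derivative b \<bullet> i) (at 0)"
        by (rule bounded_linear.has_vector_derivative[OF bounded_linear_inner_left \<gamma>'(3)])
      have "(dir_deriv g i has_derivative (\<lambda>w. dir_deriv (dir_deriv g i) w y)) (at (\<gamma> 0))"
        using d2 y by simp
      from has_derivative_compose[OF \<gamma>0[unfolded has_vector_derivative_def] this]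
      show "((\<lambda>t. dir_deriv g i (\<gamma> t)) has_vector_derivative dir_deriv (dir_deriv g i) a y) (at 0)"
        by (simp add: has_vector_derivative_def linear_scale[OF has_derivative_linear[OF d2[OF y(2)]]])
    qed
    then have "(G has_vector_derivative (\<Sum>i\<in>Basis. (\<gamma>' 0 \<bullet> i) *\<^sub>R dir_deriv (dir_deriv g i) a y + (b \<bullet> i) *\<^sub>R dir_deriv g i (\<gamma> 0))) (at 0)"
      unfolding G_def by (intro has_vector_derivative_sum)
    moreover have "(\<Sum>i\<in>Basis. (a \<bullet> i) *\<^sub>R dir_deriv (dir_deriv g i) a y) = dir_deriv (dir_deriv g a) a y"
      using linear_sum[OF linear_dir_deriv_dir_deriv[OF Y y(2) g], of "\<lambda>i. (a \<bullet> i) *\<^sub>R i" Basis]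
        linear_scale[OF linear_dir_deriv_dir_deriv[OF Y y(2) g]]
      by (simp add: euclidean_representation)
    ultimately show "(G has_vector_derivative dir_deriv (dir_deriv g a) a y + dir_deriv g b y) (at 0)"
      using y by (simp add: sum.distrib repr \<gamma>')
  qed
qed

lemma linear_dir_deriv0: "f differentiable (at x) \<Longrightarrow> dir_deriv f 0 x = 0"
  using linear_0[OF linear_dir_deriv] by blast

lemma jet2_along_line:
  fixes g :: "'a::euclidean_space \<Rightarrow> 'b::real_normed_vector"
  assumes "open Y" "Ck_on 2 Y g" "y \<in> Y"
  shows "jet2 (\<lambda>t. g (y + t *\<^sub>R v)) (dir_deriv g v y) (dir_deriv (dir_deriv g v) v y)"
proof -
  have "dir_deriv g 0 y = 0"
    using assms Ck_on_SucD[of Y 1 g y] by (simp add: linear_dir_deriv0 numeral_2_eq_2)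
  then show ?thesis using jet2_compose[OF assms(1,2) jet2_line[of y v], of y] assms(3) by simp
qed

section \<open>Orthonormal frames and symmetric matrices\<close>

text \<open>Indexed by the coordinate type itself, so that orthonormality alone makes the family a
  basis.\<close>

definition frame :: "('n \<Rightarrow> real^'n) \<Rightarrow> bool"
  where "frame e \<longleftrightarrow> (\<forall>i j. e i \<bullet> e j = (if i = j then 1 else 0))"

lemma frame_norm: "frame e \<Longrightarrow> norm (e i) = 1"
  by (simp add: frame_def norm_eq_1)

text \<open>For square matrices a right inverse is a left inverse, so orthonormal rows force
  orthonormal columns.\<close>

lemma frame_complete:
  assumes "frame (e :: 'n \<Rightarrow> real^'n)"
  shows "(\<Sum>j\<in>UNIV. e j $ k * e j $ l) = (if k = l then 1 else 0)"
proof -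
  define E :: "real^'n^'n" where "E = (\<chi> j k. e j $ k)"
  have "E ** transpose E = mat 1"
    using assms by (simp add: E_def frame_def matrix_matrix_mult_def transpose_def mat_def vec_eq_iff inner_vec_def)
  then have "transpose E ** E = mat 1"
    by (rule matrix_left_right_inverse[THEN iffD1])
  then have "(transpose E ** E) $ k $ l = mat 1 $ k $ l" by simp
  then show ?thesis by (simp add: E_def matrix_matrix_mult_def transpose_def mat_def)
qed

lemma frame_expand:
  assumes "frame (e :: 'n \<Rightarrow> real^'n)"
  shows "(\<Sum>j\<in>UNIV. (x \<bullet> e j) *\<^sub>R e j) = x"
proof -
  have "(\<Sum>j\<in>UNIV. (\<Sum>l\<in>UNIV. x $ l * e j $ l) * e j $ k) = x $ k" for k
  proof -
    have "(\<Sum>j\<in>UNIV. (\<Sum>l\<in>UNIV. x $ l * e j $ l) * e j $ k) = (\<Sum>j\<in>UNIV. \<Sum>l\<in>UNIV. x $ l * (e j $ l * e j $ k))"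
      by (simp add: sum_distrib_right mult.assoc)
    also have "\<dots> = (\<Sum>l\<in>UNIV. x $ l * (\<Sum>j\<in>UNIV. e j $ l * e j $ k))"
      by (subst sum.swap) (simp add: sum_distrib_left)
    also have "\<dots> = x $ k"
      by (simp add: frame_complete[OF assms] if_distrib[of "\<lambda>c. _ * c"] cong: if_cong)
    finally show ?thesis .
  qed
  then show ?thesis by (simp add: vec_eq_iff inner_vec_def)
qed

lemma frame_inner:
  assumes "frame e"
  shows "(\<Sum>j\<in>UNIV. (x \<bullet> e j) * (y \<bullet> e j)) = x \<bullet> y"
proof -
  have "x \<bullet> y = x \<bullet> (\<Sum>j\<in>UNIV. (y \<bullet> e j) *\<^sub>R e j)" by (simp add: frame_expand[OF assms])
  then show ?thesis by (simp add: inner_sum_right mult.commute)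
qed

lemma frame_inner_matrix:
  assumes "frame e"
  shows "(\<Sum>j\<in>UNIV. (G *v e j) \<bullet> (s *v e j)) = G \<bullet> s"
proof -
  have "(\<Sum>j\<in>UNIV. (G *v e j) \<bullet> (s *v e j)) = (\<Sum>j\<in>UNIV. \<Sum>i\<in>UNIV. (G $ i \<bullet> e j) * (s $ i \<bullet> e j))"
    by (simp add: inner_vec_def matrix_vector_mul_component)
  also have "\<dots> = (\<Sum>i\<in>UNIV. G $ i \<bullet> s $ i)"
    by (subst sum.swap) (simp add: frame_inner[OF assms])
  finally show ?thesis by (simp add: inner_vec_def[of G s])
qed

text \<open>The norm of a matrix is here the Euclidean norm of its entries; Cauchy-Schwarz is
  applied row by row.\<close>

lemma norm_matrix_vector_le: "norm ((M :: real^'n^'m) *v x) \<le> norm M * norm x"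
proof (rule power2_le_imp_le)
  have "(norm (M *v x))\<^sup>2 = (\<Sum>i\<in>UNIV. (M $ i \<bullet> x)\<^sup>2)"
    unfolding power2_norm_eq_inner by (simp add: inner_vec_def[of "M *v x"] matrix_vector_mul_component power2_eq_square)
  also have "\<dots> \<le> (\<Sum>i\<in>UNIV. (norm (M $ i) * norm x)\<^sup>2)"
  proof (rule sum_mono)
    fix i
    show "(M $ i \<bullet> x)\<^sup>2 \<le> (norm (M $ i) * norm x)\<^sup>2"
      using Cauchy_Schwarz_ineq2[of "M $ i" x] by (simp add: abs_le_square_iff[symmetric] abs_mult)
  qed
  also have "\<dots> = (\<Sum>i\<in>UNIV. (norm (M $ i))\<^sup>2) * (norm x)\<^sup>2"
    by (simp add: power_mult_distrib sum_distrib_right)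
  also have "(\<Sum>i\<in>UNIV. (norm (M $ i))\<^sup>2) = (norm M)\<^sup>2"
    unfolding power2_norm_eq_inner by (simp add: inner_vec_def[of M])
  also have "(norm M)\<^sup>2 * (norm x)\<^sup>2 = (norm M * norm x)\<^sup>2" by (simp add: power_mult_distrib)
  finally show "(norm (M *v x))\<^sup>2 \<le> (norm M * norm x)\<^sup>2" .
qed simp

lemma bounded_bilinear_matrix_vector: "bounded_bilinear ((*v) :: real^'n^'m \<Rightarrow> real^'n \<Rightarrow> real^'m)"
proof
  show "\<exists>K. \<forall>a b. norm ((a::real^'n^'m) *v b) \<le> norm a * norm b * K"
    by (intro exI[of _ 1]) (simp add: norm_matrix_vector_le)
qed (simp_all add: matrix_vector_mult_add_rdistrib matrix_vector_right_distrib scaleR_matrix_vector_assoc matrix_vector_mult_scaleR)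

lemma sym_mats_iff: "r \<in> sym_mats \<longleftrightarrow> transpose r = r"
  by (simp add: sym_mats_def)

lemma sym_mats_inner:
  assumes "r \<in> sym_mats"
  shows "x \<bullet> (r *v y) = (r *v x) \<bullet> y"
  using assms by (metis dot_lmul_matrix sym_mats_iff transpose_matrix_vector)

text \<open>The test value \<open>t = c / m\<close> with \<open>m > D\<close> refutes a nonzero
  \<open>c\<close>. This is the first variation argument for the Rayleigh quotient.\<close>

lemma linear_coefficient_zero:
  fixes c D :: real
  assumes "\<And>t. 2 * t * c \<le> t\<^sup>2 * D"
  shows "c = 0"
proof (rule ccontr)
  assume "c \<noteq> 0"
  define m where "m = \<bar>D\<bar> + 1"
  have m: "m > 0" "D < m" by (auto simp: m_def)
  have "2 * (c / m) * c \<le> (c / m)\<^sup>2 * D" by (rule assms)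
  then have "2 * c\<^sup>2 * m \<le> c\<^sup>2 * D" using m by (simp add: field_simps power2_eq_square)
  then have "2 * m \<le> D" using \<open>c \<noteq> 0\<close> by (simp add: mult.commute mult.left_commute)
  then show False using m by simp
qed

text \<open>A maximiser of the Rayleigh quotient on the unit sphere of \<open>U\<close> is an
  eigenvector: the residual \<open>z\<close> lies in \<open>U\<close> by invariance, hence is an
  admissible variation, and the first variation along it is its squared length.\<close>

lemma symmetric_matrix_eigenvector:
  assumes r: "r \<in> sym_mats" and U: "subspace U" "U \<noteq> {0}" and inv: "\<And>x. x \<in> U \<Longrightarrow> r *v x \<in> U"
  shows "\<exists>e\<in>U. norm e = 1 \<and> (\<exists>l. r *v e = l *\<^sub>R e)"
proof -
  have "0 \<in> U" using U(1) by (rule subspace_0)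
  then obtain x0 where x0: "x0 \<in> U" "x0 \<noteq> 0" using U(2) by blast
  have "compact (U \<inter> sphere 0 1)"
    using closed_subspace[OF U(1)] by (rule closed_Int_compact) simp
  moreover have "(1 / norm x0) *\<^sub>R x0 \<in> U \<inter> sphere 0 1"
    using x0 U(1) by (simp add: subspace_scale)
  then have "U \<inter> sphere 0 1 \<noteq> {}" by blast
  moreover have "continuous_on (U \<inter> sphere 0 1) (\<lambda>x. x \<bullet> (r *v x))"
    by (intro continuous_intros)
  ultimately obtain e where e: "e \<in> U \<inter> sphere 0 1" and max: "\<forall>y\<in>U \<inter> sphere 0 1. y \<bullet> (r *v y) \<le> e \<bullet> (r *v e)"
    using continuous_attains_sup by blast
  define l where "l = e \<bullet> (r *v e)"
  have ne: "e \<bullet> e = 1" using e by (simp add: norm_eq_1)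
  have le: "x \<bullet> (r *v x) \<le> l * (x \<bullet> x)" if "x \<in> U" for x
  proof (cases "x = 0")
    case False
    then have "(1 / norm x) *\<^sub>R x \<in> U \<inter> sphere 0 1" using that U(1) by (simp add: subspace_scale)
    with max have "((1 / norm x) *\<^sub>R x) \<bullet> (r *v ((1 / norm x) *\<^sub>R x)) \<le> l" unfolding l_def by blast
    then have "(x \<bullet> (r *v x)) / (norm x)\<^sup>2 \<le> l" by (simp add: matrix_vector_mult_scaleR power2_eq_square)
    then show ?thesis using False by (simp add: divide_le_eq power2_norm_eq_inner)
  qed simp
  define z where "z = r *v e - l *\<^sub>R e"
  have zU: "z \<in> U" unfolding z_def using e inv[of e] U(1) by (simp add: subspace_diff subspace_scale)
  have "z \<bullet> z = 0"
  proof (rule linear_coefficient_zero)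
    fix t
    have "e + t *\<^sub>R z \<in> U" using e zU U(1) by (simp add: subspace_add subspace_scale)
    from le[OF this] have "l + 2 * t * (z \<bullet> (r *v e)) + t\<^sup>2 * (z \<bullet> (r *v z)) \<le> l * (1 + 2 * t * (z \<bullet> e) + t\<^sup>2 * (z \<bullet> z))"
      using sym_mats_inner[OF r, of e z] ne
      by (simp add: l_def[symmetric] matrix_vector_right_distrib matrix_vector_mult_scaleR inner_add_left inner_add_right
          inner_commute algebra_simps power2_eq_square)
    moreover have "z \<bullet> z = z \<bullet> (r *v e) - l * (z \<bullet> e)"
      by (subst (2) z_def) (simp add: inner_diff_right)
    then have "2 * t * (z \<bullet> z) = 2 * t * (z \<bullet> (r *v e)) - 2 * t * l * (z \<bullet> e)"
      by (simp add: right_diff_distrib)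
    ultimately show "2 * t * (z \<bullet> z) \<le> t\<^sup>2 * (l * (z \<bullet> z) - z \<bullet> (r *v z))"
      by (simp add: algebra_simps)
  qed
  then have "r *v e = l *\<^sub>R e" by (simp add: z_def)
  then show ?thesis using e by auto
qed

text \<open>Induction on the dimension: by symmetry, the orthogonal complement of an eigenvector in
  \<open>U\<close> is again invariant.\<close>

lemma symmetric_matrix_eigenbasis_subspace:
  assumes r: "r \<in> sym_mats"
  shows "subspace U \<Longrightarrow> dim U = d \<Longrightarrow> (\<And>x. x \<in> U \<Longrightarrow> r *v x \<in> U) \<Longrightarrow>
    \<exists>B. B \<subseteq> U \<and> finite B \<and> card B = d \<and> pairwise orthogonal B \<and> (\<forall>x\<in>B. norm x = 1 \<and> (\<exists>l. r *v x = l *\<^sub>R x))"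
proof (induction d arbitrary: U)
  case 0
  then show ?case by (intro exI[of _ "{}"]) simp
next
  case (Suc d)
  have "U \<noteq> {0}" using Suc.prems(2) by auto
  then obtain e l where e: "e \<in> U" "norm e = 1" "r *v e = l *\<^sub>R e"
    using symmetric_matrix_eigenvector[OF r Suc.prems(1) _ Suc.prems(3)] by blast
  define V where "V = {y \<in> U. \<forall>x\<in>span {e}. orthogonal x y}"
  have V: "y \<in> V \<longleftrightarrow> y \<in> U \<and> e \<bullet> y = 0" for y
    by (auto simp: V_def span_singleton orthogonal_def)
  have "dim V + dim (span {e}) = dim U"
    unfolding V_def using e Suc.prems(1) by (intro dim_subspace_orthogonal_to_vectors) (auto simp: span_minimal)
  moreover have "dim (span {e}) = 1" using e by (auto simp: dim_insert)
  ultimately have "dim V = d" using Suc.prems(2) by simp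
  moreover have "subspace V" using Suc.prems(1) by (auto simp: subspace_def V inner_add_right)
  moreover have "r *v y \<in> V" if "y \<in> V" for y
    using that Suc.prems(3) sym_mats_inner[OF r, of e y] e(3) by (simp add: V)
  ultimately obtain B where B: "B \<subseteq> V" "finite B" "card B = d" "pairwise orthogonal B"
    "\<forall>x\<in>B. norm x = 1 \<and> (\<exists>l. r *v x = l *\<^sub>R x)"
    using Suc.IH[of V] by blast
  have orth: "e \<bullet> y = 0" if "y \<in> B" for y using B(1) V that by blast
  then have "e \<notin> B" using e(2) by (metis norm_eq_1 zero_neq_one)
  then have "card (insert e B) = Suc d" using B by simp
  moreover have "pairwise orthogonal (insert e B)"
    using B(4) orth by (simp add: pairwise_insert orthogonal_def inner_commute)
  moreover have "insert e B \<subseteq> U" using B(1) e V by blast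
  ultimately show ?case using B(2,5) e by (intro exI[of _ "insert e B"]) auto
qed

lemma symmetric_matrix_eigenframe:
  assumes r: "(r :: real^'n^'n) \<in> sym_mats"
  obtains e l where "frame e" "\<And>j. r *v e j = l j *\<^sub>R e j"
proof -
  have "dim (UNIV :: (real^'n) set) = CARD('n)" by simp
  from symmetric_matrix_eigenbasis_subspace[OF r subspace_UNIV this UNIV_I]
  obtain B where B: "finite B" "card B = CARD('n)" "pairwise orthogonal B"
    "\<forall>x\<in>B. norm x = 1 \<and> (\<exists>l. r *v x = l *\<^sub>R x)" by blast
  obtain e where e: "bij_betw e (UNIV :: 'n set) B"
    using finite_same_card_bij[OF finite B(1)] B(2) by metis
  have eB: "e j \<in> B" for j using bij_betwE[OF e] by blast
  have ee: "e i \<bullet> e j = (if i = j then 1 else 0)" for i j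
  proof (cases "i = j")
    case True
    then show ?thesis using B(4) eB[of i] by (simp add: norm_eq_1[symmetric])
  next
    case False
    then have "e i \<noteq> e j" using inj_eq[OF bij_betw_imp_inj_on[OF e]] by simp
    then have "orthogonal (e i) (e j)" using pairwiseD[OF B(3) eB eB] by blast
    then show ?thesis using False by (simp add: orthogonal_def)
  qed
  have "r *v e j = (e j \<bullet> (r *v e j)) *\<^sub>R e j" for j
  proof -
    obtain l where "r *v e j = l *\<^sub>R e j" using B(4) eB[of j] by blast
    then show ?thesis using ee[of j j] by simp
  qed
  moreover have "frame e" using ee by (simp add: frame_def)
  ultimately show ?thesis by (intro that)
qed

text \<open>The matrix is the sum of the products of \<open>e j\<close> with the transpose of
  \<open>q j\<close>. Conjugation by it makes the entries of a matrix in the frame \<open>q\<close>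
  its entries in the frame \<open>e\<close>.\<close>

lemma frame_orthogonal_matrix:
  assumes e: "frame (e :: 'n \<Rightarrow> real^'n)" and q: "frame q"
  obtains Q where "orthogonal_matrix Q" "\<And>j. transpose Q *v e j = q j"
proof
  define Q :: "real^'n^'n" where "Q = (\<chi> i k. \<Sum>j\<in>UNIV. e j $ i * q j $ k)"
  have Qv: "(transpose Q *v x) = (\<Sum>j\<in>UNIV. (e j \<bullet> x) *\<^sub>R q j)" for x
  proof -
    have "(\<Sum>i\<in>UNIV. (\<Sum>j\<in>UNIV. e j $ i * q j $ k) * x $ i) = (\<Sum>j\<in>UNIV. (\<Sum>i\<in>UNIV. e j $ i * x $ i) * q j $ k)" for k
      by (simp add: sum_distrib_right) (subst sum.swap, simp add: mult_ac)
    then show ?thesis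
      by (simp add: vec_eq_iff Q_def transpose_def matrix_vector_mult_def inner_vec_def)
  qed
  show "transpose Q *v e j = q j" for j
    using e by (simp add: Qv frame_def if_distrib[of "\<lambda>c. c *\<^sub>R _"] del: transpose_matrix_vector cong: if_cong)
  have "(Q ** transpose Q) *v x = x" for x
  proof -
    have "y \<bullet> ((Q ** transpose Q) *v x) = y \<bullet> x" for y
    proof -
      have "y \<bullet> ((Q ** transpose Q) *v x) = (transpose Q *v y) \<bullet> (transpose Q *v x)"
        by (simp add: matrix_vector_mul_assoc[symmetric] transpose_matrix_vector dot_lmul_matrix)
      also have "\<dots> = (\<Sum>j\<in>UNIV. (y \<bullet> e j) * (x \<bullet> e j))"
        using q by (simp add: Qv inner_sum_left inner_sum_right frame_def inner_commute if_distrib[of "\<lambda>c. _ * c"] del: transpose_matrix_vector cong: if_cong)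
      finally show ?thesis by (simp add: frame_inner[OF e])
    qed
    then show ?thesis using vector_eq_ldot[of "(Q ** transpose Q) *v x" x] by blast
  qed
  then have "Q ** transpose Q = mat 1" by (simp add: matrix_eq)
  then show "orthogonal_matrix Q" unfolding orthogonal_matrix_def
    using matrix_left_right_inverse[THEN iffD1] by blast
qed

lemma inner_conjugate:
  fixes x y :: "real^'n"
  shows "x \<bullet> ((Q ** r ** transpose Q) *v y) = (transpose Q *v x) \<bullet> (r *v (transpose Q *v y))"
  by (simp add: matrix_vector_mul_assoc[symmetric] transpose_matrix_vector dot_lmul_matrix)

section \<open>Rank one matrices, the trace pairing and the space of symmetric matrices\<close>

definition outer :: "real^'n \<Rightarrow> real^'n^'n"
  where "outer x = (\<chi> i j. x $ i * x $ j)"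

lemma outer_sym: "outer x \<in> sym_mats"
  by (simp add: outer_def sym_mats_def transpose_def vec_eq_iff mult.commute)

lemma inner_outer: "G \<bullet> outer x = x \<bullet> (G *v x)"
  by (simp add: outer_def inner_vec_def matrix_vector_mult_def sum_distrib_left mult_ac)

lemma norm_outer: "norm (outer x) = (norm x)\<^sup>2"
proof -
  have "(outer x *v x) = (x \<bullet> x) *\<^sub>R x"
    by (simp add: outer_def matrix_vector_mult_def vec_eq_iff inner_vec_def sum_distrib_left sum_distrib_right mult_ac)
  then have "outer x \<bullet> outer x = (x \<bullet> x) * (x \<bullet> x)"
    using inner_outer[of "outer x" x] by simp
  then have "(norm (outer x))\<^sup>2 = ((norm x)\<^sup>2)\<^sup>2"
    unfolding power2_norm_eq_inner by (simp add: power2_eq_square)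
  then show ?thesis by (rule power2_eq_imp_eq) simp_all
qed

lemma mat_sym: "(mat c :: real^'n^'n) \<in> sym_mats"
  by (simp add: sym_mats_def mat_def transpose_def vec_eq_iff)

lemma trace_eq_inner: "trace (G :: real^'n^'n) = G \<bullet> mat 1"
  by (simp add: trace_def inner_vec_def mat_def if_distrib[of "\<lambda>c. _ * c"] cong: if_cong)

lemma frame_trace:
  assumes "frame e"
  shows "trace (G :: real^'n^'n) = (\<Sum>j\<in>UNIV. e j \<bullet> (G *v e j))"
  using frame_inner_matrix[OF assms, of G "mat 1"] by (simp add: trace_eq_inner inner_commute)

lemma subspace_sym_mats: "subspace sym_mats"
  by (simp add: subspace_def sym_mats_def transpose_def vec_eq_iff)

lemmas sym_mats_add = subspace_add[OF subspace_sym_mats]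
lemmas sym_mats_diff = subspace_diff[OF subspace_sym_mats]
lemmas sym_mats_scale = subspace_scale[OF subspace_sym_mats]

lemma closed_sym_mats: "closed sym_mats"
  using closed_subspace[OF subspace_sym_mats] .

lemma eigenframe_norm_le:
  assumes "frame e" "\<And>j. w *v e j = l j *\<^sub>R e j"
  shows "norm w \<le> (\<Sum>j\<in>UNIV. \<bar>l j\<bar>)"
proof -
  have "w \<bullet> w = (\<Sum>j\<in>UNIV. (l j)\<^sup>2)"
    using frame_inner_matrix[OF assms(1), of w w] assms by (simp add: frame_def power2_eq_square)
  then have "norm w = L2_set l UNIV" by (simp add: L2_set_def norm_eq_sqrt_inner)
  then show ?thesis by (simp add: L2_set_le_sum_abs)
qed

section \<open>The gradient of the operator\<close>

lemma has_derivative_along_sym_line: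
  assumes "(F has_derivative D) (at r within sym_mats)" "r \<in> sym_mats" "v \<in> sym_mats"
  shows "((\<lambda>t. F (r + t *\<^sub>R v)) has_real_derivative D v) (at 0)"
proof -
  have "((\<lambda>t. r + t *\<^sub>R v) has_derivative (\<lambda>t. t *\<^sub>R v)) (at 0)"
    by (auto intro!: derivative_eq_intros)
  moreover have "(\<lambda>t. r + t *\<^sub>R v) ` UNIV \<subseteq> sym_mats"
    using assms(2,3) by (auto intro: sym_mats_add sym_mats_scale)
  then have "(F has_derivative D) (at (r + 0 *\<^sub>R v) within (\<lambda>t. r + t *\<^sub>R v) ` UNIV)"
    using has_derivative_subset[OF assms(1)] by simp
  ultimately have "((\<lambda>t. F (r + t *\<^sub>R v)) has_derivative (\<lambda>t. D (t *\<^sub>R v))) (at 0)"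
    by (rule has_derivative_in_compose)
  moreover have "(\<lambda>t. D (t *\<^sub>R v)) = (*) (D v)"
    using linear_scale[OF has_derivative_linear[OF assms(1)]] by (auto simp: mult.commute)
  ultimately show ?thesis by (simp add: has_field_derivative_def)
qed

lemma inner_transpose: "transpose G \<bullet> s = G \<bullet> transpose (s :: real^'n^'n)"
  by (simp add: inner_vec_def transpose_def) (subst sum.swap, rule refl)

text \<open>Riesz representation followed by symmetrisation, which does not change the pairing with
  symmetric matrices. For uniqueness, the difference of two candidates is itself a symmetric
  direction and can be tested against itself.\<close>

lemma mat_grad_exists:
  fixes F :: "real^'n^'n \<Rightarrow> real"
  assumes "F differentiable (at r within sym_mats)" "r \<in> sym_mats"
  shows "mat_grad F r \<in> sym_mats \<and> (F has_derivative (\<lambda>s. mat_grad F r \<bullet> s)) (at r within sym_mats)"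
  unfolding mat_grad_def
proof (rule theI')
  obtain D where D: "(F has_derivative D) (at r within sym_mats)"
    using assms(1) unfolding differentiable_def by blast
  define G0 where "G0 = (\<Sum>b\<in>Basis. D b *\<^sub>R b)"
  have G0: "G0 \<bullet> s = D s" for s
  proof -
    have "D s = D (\<Sum>b\<in>Basis. (s \<bullet> b) *\<^sub>R b)" by (simp add: euclidean_representation)
    also have "\<dots> = (\<Sum>b\<in>Basis. (s \<bullet> b) *\<^sub>R D b)"
      using has_derivative_linear[OF D] by (simp add: linear_sum linear_scale)
    finally show ?thesis by (simp add: G0_def inner_sum_left inner_commute[of s] mult.commute)
  qed
  define G where "G = (1/2) *\<^sub>R (G0 + transpose G0)"
  have Gs: "G \<in> sym_mats" by (simp add: G_def sym_mats_def transpose_def vec_eq_iff)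
  have GD: "G \<bullet> s = D s" if "s \<in> sym_mats" for s
    using that by (simp add: G_def inner_add_left inner_transpose sym_mats_iff G0)
  have "(F has_derivative (\<lambda>s. G \<bullet> s)) (at r within sym_mats)"
    unfolding has_derivative_within
  proof
    show "bounded_linear ((\<bullet>) G)" by (rule bounded_linear_inner_right)
    have "((\<lambda>y. (1 / norm (y - r)) *\<^sub>R (F y - (F r + D (y - r)))) \<longlongrightarrow> 0) (at r within sym_mats)"
      using D unfolding has_derivative_within by blast
    then show "((\<lambda>y. (1 / norm (y - r)) *\<^sub>R (F y - (F r + G \<bullet> (y - r)))) \<longlongrightarrow> 0) (at r within sym_mats)"
    proof (rule Lim_transform_eventually)
      show "\<forall>\<^sub>F y in at r within sym_mats. (1 / norm (y - r)) *\<^sub>R (F y - (F r + D (y - r))) =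
          (1 / norm (y - r)) *\<^sub>R (F y - (F r + G \<bullet> (y - r)))"
        unfolding eventually_at_filter using assms(2) by (simp add: GD sym_mats_diff)
    qed
  qed
  with Gs show "\<exists>!G. G \<in> sym_mats \<and> (F has_derivative (\<lambda>s. G \<bullet> s)) (at r within sym_mats)"
  proof (intro ex1I[of _ G] conjI)
    fix G' assume G': "G' \<in> sym_mats \<and> (F has_derivative (\<lambda>s. G' \<bullet> s)) (at r within sym_mats)"
    assume dG: "(F has_derivative (\<lambda>s. G \<bullet> s)) (at r within sym_mats)"
    have v: "G' - G \<in> sym_mats" using G' Gs sym_mats_diff by blast
    have "G' \<bullet> (G' - G) = G \<bullet> (G' - G)"
      using has_derivative_along_sym_line[OF conjunct2[OF G'] assms(2) v]
        has_derivative_along_sym_line[OF dG assms(2) v] by (rule DERIV_unique)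
    then have "(G' - G) \<bullet> (G' - G) = 0" by (simp add: inner_diff_left)
    then show "G' = G" by simp
  qed
qed

text \<open>A function above its chord starts at least as steeply as the chord. It is used for the
  concave \<open>F\<close> and, with reversed sign, for the convex \<open>B\<close>.\<close>

lemma right_derivative_ge_chord:
  fixes g :: "real \<Rightarrow> real"
  assumes d: "(g has_real_derivative d) (at 0)"
    and g: "\<And>t. 0 < t \<Longrightarrow> t < 1 \<Longrightarrow> (1 - t) * g 0 + t * c \<le> g t"
  shows "c - g 0 \<le> d"
proof (rule ccontr)
  assume "\<not> c - g 0 \<le> d"
  then have neg: "d - (c - g 0) < 0" by simp
  have "((\<lambda>t. g t - (g 0 + t * (c - g 0))) has_real_derivative d - (c - g 0)) (at 0)"
    using d by (auto intro!: derivative_eq_intros)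
  from DERIV_neg_dec_right[OF this neg]
  obtain e where e: "e > 0" "\<forall>h>0. h < e \<longrightarrow> g (0 + h) - (g 0 + (0 + h) * (c - g 0)) < g 0 - (g 0 + 0 * (c - g 0))"
    by blast
  define m where "m = min e 1 / 2"
  have "0 < m" "m < e" "m < 1" using e(1) by (simp_all add: m_def min_def)
  then show False using e(2) g[of m] by (auto simp: algebra_simps)
qed

lemma frame_matrix_eqI:
  assumes "frame e" "\<And>j k. e j \<bullet> (M *v e k) = e j \<bullet> (N *v e k)"
  shows "M = (N :: real^'n^'n)"
proof -
  have "M *v e k = N *v e k" for k
    using frame_expand[OF assms(1), of "M *v e k"] frame_expand[OF assms(1), of "N *v e k"] assms(2)
    by (simp add: inner_commute)
  then have "(M - N) *v e k = 0" for k by (simp add: matrix_vector_mult_diff_rdistrib)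
  then have "(M - N) \<bullet> (M - N) = 0" using frame_inner_matrix[OF assms(1), of "M - N" "M - N"] by simp
  then show ?thesis by simp
qed

locale concave_operator =
  fixes \<Gamma> :: "(real^'n^'n) set" and F :: "real^'n^'n \<Rightarrow> real"
  assumes cone: "open_convex_cone \<Gamma>" and pos_sub: "pos_def_mats \<subseteq> \<Gamma>"
    and C2: "mat_C2_on \<Gamma> F" and inv: "orth_invariant \<Gamma> F" and F1: "F1 \<Gamma> F" and F2: "F2 \<Gamma> F"
begin

abbreviation G :: "real^'n^'n \<Rightarrow> real^'n^'n"
  where "G \<equiv> mat_grad F"

lemma sym: "r \<in> \<Gamma> \<Longrightarrow> r \<in> sym_mats"
  using cone openin_imp_subset unfolding open_convex_cone_def by blast

lemma G_sym: "r \<in> \<Gamma> \<Longrightarrow> G r \<in> sym_mats"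
  using F1 by (simp add: F1_def pos_def_mats_def)

lemma G_pos: "r \<in> \<Gamma> \<Longrightarrow> \<xi> \<noteq> 0 \<Longrightarrow> \<xi> \<bullet> (G r *v \<xi>) > 0"
  using F1 by (simp add: F1_def pos_def_mats_def)

lemma has_derivative_F: "r \<in> \<Gamma> \<Longrightarrow> (F has_derivative (\<lambda>s. G r \<bullet> s)) (at r within sym_mats)"
  using mat_grad_exists[of F r] C2 sym by (simp add: mat_C2_on_def)

lemma has_derivative_line:
  "r \<in> \<Gamma> \<Longrightarrow> v \<in> sym_mats \<Longrightarrow> ((\<lambda>t. F (r + t *\<^sub>R v)) has_real_derivative G r \<bullet> v) (at 0)"
  using has_derivative_along_sym_line[OF has_derivative_F] sym by blast

lemma continuous_on_F: "continuous_on \<Gamma> F"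
  unfolding continuous_on_eq_continuous_within
  using has_derivative_continuous[OF has_derivative_F] continuous_within_subset[of _ sym_mats F \<Gamma>] sym by blast

lemma continuous_on_G: "continuous_on \<Gamma> G"
proof -
  obtain H where "\<forall>r\<in>\<Gamma>. (G has_derivative H r) (at r within sym_mats)"
    using C2 unfolding mat_C2_on_def by blast
  then have "continuous (at r within sym_mats) G" if "r \<in> \<Gamma>" for r
    using has_derivative_continuous that by blast
  then show ?thesis
    unfolding continuous_on_eq_continuous_within
    using continuous_within_subset[of _ sym_mats G \<Gamma>] sym by blast
qed

lemma supergradient:
  assumes "r \<in> \<Gamma>" "s \<in> \<Gamma>"
  shows "F s \<le> F r + G r \<bullet> (s - r)"
proof -
  have "(1 - t) * F (r + 0 *\<^sub>R (s - r)) + t * F s \<le> F (r + t *\<^sub>R (s - r))" if "0 < t" "t < 1" for t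
  proof -
    have "(1 - t) * F r + t * F s \<le> F ((1 - t) *\<^sub>R r + t *\<^sub>R s)"
      using F2 assms that unfolding F2_def concave_on_iff by simp
    also have "(1 - t) *\<^sub>R r + t *\<^sub>R s = r + t *\<^sub>R (s - r)" by (simp add: algebra_simps)
    finally show ?thesis by simp
  qed
  from right_derivative_ge_chord[OF has_derivative_line[OF assms(1) sym_mats_diff[OF sym sym]] this] assms
  show ?thesis by simp
qed

lemma eventually_in:
  assumes "r \<in> \<Gamma>"
  shows "\<exists>\<delta>>0. \<forall>s\<in>sym_mats. dist s r < \<delta> \<longrightarrow> s \<in> \<Gamma>"
  using cone assms unfolding open_convex_cone_def openin_euclidean_subtopology_iff by blast

text \<open>Conjugation leaves \<open>F\<close> unchanged, and the gradient at \<open>r0\<close>,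
  being diagonal in \<open>e\<close>, sees only the diagonal entries of the conjugate, which are
  those of \<open>r\<close> in \<open>q\<close>. The frame \<open>q\<close> is arbitrary; this
  freedom is what invariance adds to concavity.\<close>

lemma supergradient_rotated:
  assumes e: "frame e" and q: "frame q" and r: "r0 \<in> \<Gamma>" "r \<in> \<Gamma>" and f: "\<And>j. G r0 *v e j = f j *\<^sub>R e j"
  shows "F r \<le> F r0 - G r0 \<bullet> r0 + (\<Sum>j\<in>UNIV. f j * (q j \<bullet> (r *v q j)))"
proof -
  obtain Q where Q: "orthogonal_matrix Q" "\<And>j. transpose Q *v e j = q j"
    by (rule frame_orthogonal_matrix[OF e q]) blast
  define s where "s = Q ** r ** transpose Q"
  have s: "s \<in> \<Gamma>" "F s = F r" using inv Q(1) r(2) unfolding orth_invariant_def s_def by blast+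
  have "G r0 \<bullet> s = (\<Sum>j\<in>UNIV. f j * (q j \<bullet> (r *v q j)))"
    using frame_inner_matrix[OF e, of "G r0" s] by (simp add: f s_def inner_conjugate Q(2) matrix_vector_mult_scaleR del: transpose_matrix_vector)
  then show ?thesis using supergradient[OF r(1) s(1)] s(2) by (simp add: inner_diff_right)
qed

text \<open>By invariance \<open>F (r + t v)\<close> is the value of \<open>F\<close> at the
  conjugate of \<open>r + t v\<close>, which lies below the supporting plane at the fixed point
  \<open>r\<close>. So \<open>F\<close> minus a linear function of \<open>t\<close> has a two-sided
  maximum at 0 and its derivative vanishes.\<close>

lemma gradient_invariant:
  assumes Q: "orthogonal_matrix Q" and r: "r \<in> \<Gamma>" "Q ** r ** transpose Q = r" and v: "v \<in> sym_mats"
  shows "G r \<bullet> (Q ** v ** transpose Q) = G r \<bullet> v"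
proof -
  obtain \<delta> where \<delta>: "\<delta> > 0" "\<forall>s\<in>sym_mats. dist s r < \<delta> \<longrightarrow> s \<in> \<Gamma>" using eventually_in[OF r(1)] by blast
  define \<epsilon> where "\<epsilon> = \<delta> / (norm v + 1)"
  have nv: "norm v + 1 > 0" by (simp add: add_nonneg_pos)
  have "\<epsilon> > 0" using \<delta>(1) nv by (simp add: \<epsilon>_def)
  have lin: "Q ** (r + t *\<^sub>R v) ** transpose Q = r + t *\<^sub>R (Q ** v ** transpose Q)" for t
  proof -
    have "Q *v (r *v (transpose Q *v x)) = r *v x" for x
      using arg_cong[OF r(2), of "\<lambda>M. M *v x"] by (simp only: matrix_vector_mul_assoc matrix_mul_assoc)
    then show ?thesis
      by (simp add: matrix_eq matrix_vector_mul_assoc[symmetric] matrix_vector_mult_add_rdistrib matrix_vector_right_distrib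
          scaleR_matrix_vector_assoc[symmetric] matrix_vector_mult_scaleR del: transpose_matrix_vector)
  qed
  let ?\<psi> = "\<lambda>t. F (r + t *\<^sub>R v) - t * (G r \<bullet> (Q ** v ** transpose Q))"
  have "(?\<psi> has_real_derivative G r \<bullet> v - G r \<bullet> (Q ** v ** transpose Q)) (at 0)"
    using has_derivative_line[OF r(1) v] by (auto intro!: derivative_eq_intros)
  moreover have "?\<psi> t \<le> ?\<psi> 0" if "\<bar>0 - t\<bar> < \<epsilon>" for t
  proof -
    have "norm (t *\<^sub>R v) \<le> \<bar>t\<bar> * (norm v + 1)" by (simp add: mult_left_mono)
    also have "\<dots> < \<delta>" using that nv by (simp add: \<epsilon>_def pos_less_divide_eq)
    finally have "r + t *\<^sub>R v \<in> \<Gamma>" using \<delta>(2) sym[OF r(1)] v by (simp add: dist_norm sym_mats_add sym_mats_scale)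
    moreover from this have "F (Q ** (r + t *\<^sub>R v) ** transpose Q) = F (r + t *\<^sub>R v)" "Q ** (r + t *\<^sub>R v) ** transpose Q \<in> \<Gamma>"
      using inv Q unfolding orth_invariant_def by blast+
    ultimately show ?thesis using supergradient[OF r(1), of "Q ** (r + t *\<^sub>R v) ** transpose Q"] unfolding lin by simp
  qed
  ultimately have "G r \<bullet> v - G r \<bullet> (Q ** v ** transpose Q) = 0"
    using DERIV_local_max[OF _ \<open>\<epsilon> > 0\<close>] by blast
  then show ?thesis by simp
qed

text \<open>Reflections of the eigenframe fix \<open>r\<close> and hence the gradient, which kills
  every off-diagonal entry. Multiple eigenvalues need no separate treatment.\<close>

lemma gradient_diagonal:
  assumes e: "frame e" and r: "r \<in> \<Gamma>" and l: "\<And>j. r *v e j = l j *\<^sub>R e j"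
  shows "G r *v e j = (e j \<bullet> (G r *v e j)) *\<^sub>R e j"
proof -
  note ee = e[unfolded frame_def, rule_format]
  have off: "e i \<bullet> (G r *v e m) = 0" if "i \<noteq> m" for i m
  proof -
    \<comment> \<open>The sign of \<open>e i\<close> alone is changed; \<open>r\<close> is diagonal
      in \<open>e\<close>, so it commutes with this reflection.\<close>
    define q where "q j = (if j = i then - 1 else 1) *\<^sub>R e j" for j
    have q: "frame q" using ee by (auto simp: frame_def q_def)
    obtain Q where Q: "orthogonal_matrix Q" "\<And>j. transpose Q *v e j = q j"
      by (rule frame_orthogonal_matrix[OF e q]) blast
    have "Q ** r ** transpose Q = r"
      by (rule frame_matrix_eqI[OF e])
        (auto simp: inner_conjugate Q(2) l q_def ee matrix_vector_mult_scaleR simp del: transpose_matrix_vector)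
    note inv = gradient_invariant[OF Q(1) r this]
    \<comment> \<open>The reflection takes the rank one matrix of \<open>e i + e m\<close> to that
      of \<open>e m - e i\<close>; equality of the two quadratic forms is, by polarisation, the
      vanishing of the mixed entry.\<close>
    define x where "x = e i + e m"
    have "Q ** outer x ** transpose Q = outer (e m - e i)"
    proof (rule frame_matrix_eqI[OF e])
      have o: "a \<bullet> (outer y *v b) = (a \<bullet> y) * (y \<bullet> b)" for a b y :: "real^'n"
        by (simp add: outer_def inner_vec_def matrix_vector_mult_def sum_distrib_left sum_distrib_right mult_ac)
          (subst sum.swap, simp add: mult_ac)
      show "e j \<bullet> ((Q ** outer x ** transpose Q) *v e k) = e j \<bullet> (outer (e m - e i) *v e k)" for j k
        using that by (auto simp: inner_conjugate Q(2) o q_def x_def inner_add_left inner_add_right inner_diff_left inner_diff_right ee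
            simp del: transpose_matrix_vector)
    qed
    then have "(e m - e i) \<bullet> (G r *v (e m - e i)) = x \<bullet> (G r *v x)"
      using inv[OF outer_sym, of x] by (simp add: inner_outer)
    then have "4 * (e i \<bullet> (G r *v e m)) = 0"
      using sym_mats_inner[OF G_sym[OF r], of "e m" "e i"]
      by (simp add: x_def matrix_vector_right_distrib matrix_vector_mult_diff_distrib inner_add_left inner_add_right
          inner_diff_left inner_diff_right inner_commute)
    then show ?thesis by simp
  qed
  have "(G r *v e j) = (\<Sum>k\<in>UNIV. ((G r *v e j) \<bullet> e k) *\<^sub>R e k)" by (simp add: frame_expand[OF e])
  also have "\<dots> = (\<Sum>k\<in>UNIV. if k = j then (e j \<bullet> (G r *v e j)) *\<^sub>R e j else 0)"
    by (rule sum.cong) (auto simp: off inner_commute)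
  finally show ?thesis by simp
qed

section \<open>Bounds for the gradient on compact sets and gaps between supporting planes\<close>

lemma mat_1_in: "mat 1 \<in> \<Gamma>"
proof -
  have "(mat 1 :: real^'n^'n) \<in> pos_def_mats" by (simp add: pos_def_mats_def mat_sym)
  then show ?thesis using pos_sub by blast
qed

lemma G_lower_bound:
  assumes "compact S" "S \<subseteq> \<Gamma>"
  obtains g where "g > 0" "\<And>s \<xi>. s \<in> S \<Longrightarrow> norm \<xi> = 1 \<Longrightarrow> g \<le> \<xi> \<bullet> (G s *v \<xi>)"
proof (cases "S = {}")
  case True
  then show ?thesis using that[of 1] by simp
next
  case False
  let ?K = "S \<times> sphere (0 :: real^'n) 1"
  have "compact ?K" using assms(1) by (intro compact_Times) simp_all
  moreover have "axis undefined 1 \<in> sphere (0 :: real^'n) 1" by simp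
  then have "?K \<noteq> {}" using False by blast
  moreover have "continuous_on ?K (\<lambda>z. snd z \<bullet> (G (fst z) *v snd z))"
    by (intro continuous_intros bounded_bilinear.continuous_on[OF bounded_bilinear_matrix_vector]
        continuous_on_compose2[OF continuous_on_G]) (use assms(2) in auto)
  ultimately obtain z where z: "z \<in> ?K" "\<forall>y\<in>?K. snd z \<bullet> (G (fst z) *v snd z) \<le> snd y \<bullet> (G (fst y) *v snd y)"
    using continuous_attains_inf by blast
  show ?thesis
  proof
    show "snd z \<bullet> (G (fst z) *v snd z) > 0" using z(1) assms(2) by (intro G_pos) auto
    show "snd z \<bullet> (G (fst z) *v snd z) \<le> \<xi> \<bullet> (G s *v \<xi>)" if "s \<in> S" "norm \<xi> = 1" for s \<xi>
      using z(2)[rule_format, of "(s, \<xi>)"] that by simp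
  qed
qed

lemma G_upper_bound:
  assumes "compact S" "S \<subseteq> \<Gamma>"
  obtains g where "g > 0" "\<And>s \<xi>. s \<in> S \<Longrightarrow> norm \<xi> = 1 \<Longrightarrow> \<xi> \<bullet> (G s *v \<xi>) \<le> g"
proof -
  have "compact (G ` S)" using continuous_on_subset[OF continuous_on_G assms(2)] assms(1) by (rule compact_continuous_image)
  then obtain g where g: "g > 0" "\<forall>x\<in>G ` S. norm x \<le> g" using compact_imp_bounded bounded_pos by metis
  show ?thesis
  proof
    show "\<xi> \<bullet> (G s *v \<xi>) \<le> g" if "s \<in> S" "norm \<xi> = 1" for s \<xi>
      using norm_cauchy_schwarz[of \<xi> "G s *v \<xi>"] norm_matrix_vector_le[of "G s" \<xi>] g(2) that by fastforce
  qed (rule g(1))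
qed

text \<open>The supporting plane of \<open>F\<close> at the identity bounds a weighted trace from below.\<close>

lemma eigenvalue_lower_bound:
  obtains C where "C > 0" "\<And>r e l L i. r \<in> \<Gamma> \<Longrightarrow> c \<le> F r \<Longrightarrow> frame e \<Longrightarrow> (\<And>j. r *v e j = l j *\<^sub>R e j) \<Longrightarrow>
    0 \<le> L \<Longrightarrow> (\<And>j. l j \<le> L) \<Longrightarrow> - (C * (1 + L)) \<le> l i"
proof -
  let ?G = "G (mat 1)"
  have I: "compact {mat 1 :: real^'n^'n}" "{mat 1} \<subseteq> \<Gamma>" using mat_1_in by simp_all
  obtain g0 where g0: "g0 > 0" "\<And>s \<xi>. s \<in> {mat 1} \<Longrightarrow> norm \<xi> = 1 \<Longrightarrow> g0 \<le> \<xi> \<bullet> (G s *v \<xi>)"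
    using G_lower_bound[OF I] by blast
  obtain g1 where g1: "g1 > 0" "\<And>s \<xi>. s \<in> {mat 1} \<Longrightarrow> norm \<xi> = 1 \<Longrightarrow> \<xi> \<bullet> (G s *v \<xi>) \<le> g1"
    using G_upper_bound[OF I] by blast
  define d where "d = \<bar>c - F (mat 1) + ?G \<bullet> mat 1\<bar>"
  define C where "C = (d + CARD('n) * g1) / g0"
  have C: "C > 0" using g0(1) g1(1) by (simp add: C_def d_def add_nonneg_pos)
  show ?thesis
  proof (rule that[OF C])
    fix r e l L i
    assume r: "r \<in> \<Gamma>" "c \<le> F r" and e: "frame e" and l: "\<And>j. r *v e j = l j *\<^sub>R e j"
      and L: "0 \<le> L" "\<And>j. l j \<le> L"
    let ?w = "\<lambda>j. e j \<bullet> (?G *v e j)"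
    have w: "g0 \<le> ?w j" "?w j \<le> g1" for j using g0(2) g1(2) frame_norm[OF e] by auto
    have "- d \<le> ?G \<bullet> r"
      using supergradient[OF mat_1_in r(1)] r(2) by (simp add: d_def inner_diff_right)
    also have "?G \<bullet> r = (\<Sum>j\<in>UNIV. l j * ?w j)"
      using frame_inner_matrix[OF e, of ?G r] by (simp add: l inner_commute)
    \<comment> \<open>The other eigenvalues contribute at most \<open>L * g1\<close> each, so a very
      negative \<open>l i\<close> would push the weighted trace below \<open>- d\<close>.\<close>
    also have "\<dots> = l i * ?w i + (\<Sum>j\<in>UNIV - {i}. l j * ?w j)"
      by (simp add: sum.remove[of UNIV i])
    also have "(\<Sum>j\<in>UNIV - {i}. l j * ?w j) \<le> (\<Sum>j\<in>UNIV - {i}. L * g1)"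
    proof (rule sum_mono)
      fix j
      have "l j * ?w j \<le> L * ?w j" using L w(1)[of j] g0(1) by (intro mult_right_mono) auto
      also have "\<dots> \<le> L * g1" using L w(2)[of j] by (intro mult_left_mono) auto
      finally show "l j * ?w j \<le> L * g1" .
    qed
    also have "\<dots> \<le> (\<Sum>j\<in>(UNIV :: 'n set). L * g1)"
      by (rule sum_mono2) (use L g1(1) in auto)
    finally have *: "- d \<le> l i * ?w i + CARD('n) * (L * g1)" by simp
    show "- (C * (1 + L)) \<le> l i"
    proof (cases "l i \<ge> 0")
      case True
      then show ?thesis using C L(1) by (smt (verit) mult_nonneg_nonneg)
    next
      case False
      then have "l i * ?w i \<le> l i * g0" using w(1)[of i] by (intro mult_left_mono_neg) auto
      with * have "- (d + CARD('n) * (L * g1)) \<le> l i * g0" by simp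
      moreover have "d + CARD('n) * (L * g1) \<le> (d + CARD('n) * g1) * (1 + L)"
        using L(1) g1(1) by (simp add: algebra_simps d_def)
      ultimately have "- ((d + CARD('n) * g1) * (1 + L)) \<le> l i * g0" by linarith
      then show ?thesis using g0(1) by (simp add: C_def field_simps)
    qed
  qed
qed

lemma compact_neighbourhood:
  assumes "compact S" "S \<subseteq> \<Gamma>"
  obtains \<delta> S' where "\<delta> > 0" "compact S'" "S' \<subseteq> \<Gamma>"
    "\<And>s t. s \<in> S \<Longrightarrow> t \<in> sym_mats \<Longrightarrow> norm t \<le> \<delta> \<Longrightarrow> s + t \<in> S'"
proof -
  obtain U where U: "open U" "\<Gamma> = sym_mats \<inter> U"
    using cone unfolding open_convex_cone_def openin_open by blast
  have "S \<subseteq> U" using assms(2) U(2) by blast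
  obtain \<epsilon> where \<epsilon>: "\<epsilon> > 0" "(\<Union>x\<in>S. ball x \<epsilon>) \<subseteq> U"
    using compact_subset_open_imp_ball_epsilon_subset[OF assms(1) U(1) \<open>S \<subseteq> U\<close>] .
  define S' where "S' = {x + y |x y. x \<in> S \<and> y \<in> cball 0 (\<epsilon>/2)} \<inter> sym_mats"
  show ?thesis
  proof
    show "\<epsilon> / 2 > 0" using \<epsilon>(1) by simp
    show "compact S'" unfolding S'_def
      by (intro compact_Int_closed compact_sums assms(1) compact_cball closed_sym_mats)
    show "S' \<subseteq> \<Gamma>"
    proof
      fix z assume "z \<in> S'"
      then obtain x y where z: "z = x + y" "x \<in> S" "norm y \<le> \<epsilon>/2" "z \<in> sym_mats" unfolding S'_def by auto
      then have "z \<in> ball x \<epsilon>" using \<epsilon>(1) by (simp add: dist_norm)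
      then show "z \<in> \<Gamma>" using \<epsilon>(2) z U(2) by blast
    qed
    show "s + t \<in> S'" if "s \<in> S" "t \<in> sym_mats" "norm t \<le> \<epsilon>/2" for s t
      using that assms(2) sym unfolding S'_def by (auto intro: sym_mats_add)
  qed
qed

lemma G_quadratic_trace:
  assumes "\<And>\<xi>. norm \<xi> = 1 \<Longrightarrow> \<xi> \<bullet> (M *v \<xi>) \<le> b"
  shows "trace (M :: real^'n^'n) \<le> real CARD('n) * b"
proof -
  have "frame (\<lambda>j. axis j 1 :: real^'n)" by (simp add: frame_def inner_axis_axis)
  then have "trace M = (\<Sum>j\<in>UNIV. (axis j 1 :: real^'n) \<bullet> (M *v axis j 1))" by (rule frame_trace)
  also have "\<dots> \<le> (\<Sum>j\<in>(UNIV :: 'n set). b)" by (intro sum_mono assms) simp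
  finally show ?thesis by simp
qed

text \<open>The supporting planes at \<open>r\<close> and at \<open>s \<plusminus> \<delta> \<xi> \<xi>\<^sup>t\<close> compare the gradient at \<open>r\<close> with the gradients near \<open>S\<close>, up
  to the gap at \<open>s\<close> divided by \<open>\<delta>\<close>.\<close>

lemma gap_dichotomy:
  assumes S: "compact S" "S \<subseteq> \<Gamma>"
  obtains \<epsilon> where "\<epsilon> > 0" "\<And>r s. r \<in> \<Gamma> \<Longrightarrow> s \<in> S \<Longrightarrow>
    \<epsilon> * (1 + trace (G r)) \<le> F r + G r \<bullet> (s - r) - F s \<or>
    trace (G r) \<le> 1 / \<epsilon> \<and> (\<forall>\<xi>. norm \<xi> = 1 \<longrightarrow> \<epsilon> \<le> \<xi> \<bullet> (G r *v \<xi>))"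
proof -
  obtain \<delta> S' where \<delta>: "\<delta> > 0" "compact S'" "S' \<subseteq> \<Gamma>"
    "\<And>s t. s \<in> S \<Longrightarrow> t \<in> sym_mats \<Longrightarrow> norm t \<le> \<delta> \<Longrightarrow> s + t \<in> S'"
    using compact_neighbourhood[OF S] by blast
  obtain g0 where g0: "g0 > 0" "\<And>s \<xi>. s \<in> S' \<Longrightarrow> norm \<xi> = 1 \<Longrightarrow> g0 \<le> \<xi> \<bullet> (G s *v \<xi>)"
    using G_lower_bound[OF \<delta>(2,3)] by blast
  obtain g1 where g1: "g1 > 0" "\<And>s \<xi>. s \<in> S' \<Longrightarrow> norm \<xi> = 1 \<Longrightarrow> \<xi> \<bullet> (G s *v \<xi>) \<le> g1"
    using G_upper_bound[OF \<delta>(2,3)] by blast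
  define n where "n = real CARD('n)"
  have n: "n \<ge> 1" by (simp add: n_def Suc_le_eq)
  define T1 where "T1 = 2 * n * g1 + 1"
  have T1: "T1 > 1" using n g1(1) by (simp add: T1_def)
  \<comment> \<open>The first entry lets half of \<open>1 + T\<close> be absorbed, which yields
    \<open>T \<le> T1\<close>; the second then keeps \<open>gap / \<delta>\<close> below
    \<open>g0 / 2\<close>; the third is the remaining ellipticity, the last the trace bound.\<close>
  define \<epsilon> where "\<epsilon> = min (\<delta> / (2 * n)) (min (g0 * \<delta> / (2 * (1 + T1))) (min (g0 / 2) (1 / T1)))"
  have \<epsilon>: "\<epsilon> > 0" "\<epsilon> \<le> \<delta> / (2 * n)" "\<epsilon> \<le> g0 * \<delta> / (2 * (1 + T1))" "\<epsilon> \<le> g0 / 2" "\<epsilon> \<le> 1 / T1"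
    subgoal using \<delta>(1) g0(1) T1 n by (simp add: \<epsilon>_def)
    unfolding \<epsilon>_def by (intro min.cobounded1 min.coboundedI2 min.cobounded2)+
  show ?thesis
  proof (rule that[OF \<epsilon>(1)])
    fix r s assume r: "r \<in> \<Gamma>" and s: "s \<in> S"
    define T where "T = trace (G r)"
    define gap where "gap = F r + G r \<bullet> (s - r) - F s"
    \<comment> \<open>Sum of two supporting planes: the one at \<open>r\<close> evaluated at
      \<open>s + t\<close>, and the one at \<open>s + t\<close> evaluated at
      \<open>s\<close>.\<close>
    have step: "G (s + t) \<bullet> t - gap \<le> G r \<bullet> t" if "t \<in> sym_mats" "norm t \<le> \<delta>" for t
    proof -
      have st: "s + t \<in> \<Gamma>" using \<delta>(3,4) s that by blast
      show ?thesis using supergradient[OF r st] supergradient[OF st, of s] s S(2)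
        by (auto simp: gap_def inner_diff_right inner_add_right)
    qed
    have low: "g0 - gap / \<delta> \<le> \<xi> \<bullet> (G r *v \<xi>)" if "norm \<xi> = 1" for \<xi>
    proof -
      let ?t = "\<delta> *\<^sub>R outer \<xi>"
      have t: "?t \<in> sym_mats" "norm ?t \<le> \<delta>" using that \<delta>(1) by (simp_all add: outer_sym sym_mats_scale norm_outer)
      have "\<delta> * g0 \<le> \<delta> * (\<xi> \<bullet> (G (s + ?t) *v \<xi>))"
        using g0(2)[OF \<delta>(4)[OF s t] that] \<delta>(1) by simp
      then have "\<delta> * g0 - gap \<le> \<delta> * (\<xi> \<bullet> (G r *v \<xi>))" using step[OF t] by (simp add: inner_outer)
      then show ?thesis using \<delta>(1) by (simp add: field_simps)
    qed
    have up: "\<xi> \<bullet> (G r *v \<xi>) \<le> g1 + gap / \<delta>" if "norm \<xi> = 1" for \<xi>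
    proof -
      let ?t = "(- \<delta>) *\<^sub>R outer \<xi>"
      have t: "?t \<in> sym_mats" "norm ?t \<le> \<delta>" using that \<delta>(1) by (simp_all only: outer_sym sym_mats_scale) (simp add: norm_outer)
      have "\<delta> * (\<xi> \<bullet> (G (s + ?t) *v \<xi>)) \<le> \<delta> * g1"
        using g1(2)[OF \<delta>(4)[OF s t] that] \<delta>(1) by simp
      then have "\<delta> * (\<xi> \<bullet> (G r *v \<xi>)) \<le> \<delta> * g1 + gap" using step[OF t] by (simp add: inner_outer)
      then show ?thesis using \<delta>(1) by (simp add: field_simps)
    qed
    show "\<epsilon> * (1 + trace (G r)) \<le> F r + G r \<bullet> (s - r) - F s \<or>
      trace (G r) \<le> 1 / \<epsilon> \<and> (\<forall>\<xi>. norm \<xi> = 1 \<longrightarrow> \<epsilon> \<le> \<xi> \<bullet> (G r *v \<xi>))"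
      unfolding T_def[symmetric] gap_def[symmetric]
    proof (rule disj_imp[THEN iffD2, OF impI])
      assume "\<not> \<epsilon> * (1 + T) \<le> gap"
      then have gap: "gap < \<epsilon> * (1 + T)" by simp
      have Tn: "T \<le> n * (g1 + gap / \<delta>)" unfolding T_def n_def by (rule G_quadratic_trace) (rule up)
      have T0: "0 \<le> T"
      proof -
        have "frame (\<lambda>j. axis j 1 :: real^'n)" by (simp add: frame_def inner_axis_axis)
        from frame_trace[OF this] show ?thesis unfolding T_def
          using G_pos[OF r] by (simp add: sum_nonneg less_imp_le axis_eq_0_iff)
      qed
      have "n * (gap / \<delta>) \<le> n * ((\<epsilon> * (1 + T)) / \<delta>)"
        using gap \<delta>(1) n by (intro mult_left_mono divide_right_mono) auto
      also have "\<dots> = (\<epsilon> * n / \<delta>) * (1 + T)" by simp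
      also have "\<dots> \<le> (1 / 2) * (1 + T)"
        using \<epsilon>(2) \<delta>(1) n T0 by (intro mult_right_mono) (auto simp: field_simps)
      finally have TT: "T \<le> T1" using Tn by (simp add: T1_def distrib_left)
      have "T1 \<le> 1 / \<epsilon>" using \<epsilon>(1,5) T1 by (simp add: field_simps)
      moreover have "\<epsilon> \<le> \<xi> \<bullet> (G r *v \<xi>)" if "norm \<xi> = 1" for \<xi>
      proof -
        have "gap \<le> \<epsilon> * (1 + T1)" using gap TT \<epsilon>(1) by (smt (verit) mult_left_mono)
        also have "\<dots> \<le> g0 * \<delta> / 2" using \<epsilon>(3) T1 by (simp add: field_simps)
        finally have "gap / \<delta> \<le> g0 / 2" using \<delta>(1) by (simp add: field_simps)
        then show ?thesis using low[OF that] \<epsilon>(4) by linarith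
      qed
      ultimately show "T \<le> 1 / \<epsilon> \<and> (\<forall>\<xi>. norm \<xi> = 1 \<longrightarrow> \<epsilon> \<le> \<xi> \<bullet> (G r *v \<xi>))" using TT by auto
    qed
  qed
qed

text \<open>The shift \<open>\<delta>\<close> of \<open>s\<close> into the interior of the cone produces the multiple of the trace.\<close>

lemma gap_trace:
  assumes S: "compact S" "S \<subseteq> \<Gamma>"
  obtains \<delta> m where "\<delta> > 0" "\<And>r s. r \<in> \<Gamma> \<Longrightarrow> s \<in> S \<Longrightarrow> \<delta> * trace (G r) + m - F r \<le> G r \<bullet> (s - r)"
proof -
  obtain \<delta> S' where \<delta>: "\<delta> > 0" "compact S'" "S' \<subseteq> \<Gamma>"
    "\<And>s t. s \<in> S \<Longrightarrow> t \<in> sym_mats \<Longrightarrow> norm t \<le> \<delta> \<Longrightarrow> s + t \<in> S'"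
    using compact_neighbourhood[OF S] by blast
  have "compact (F ` S')" using continuous_on_subset[OF continuous_on_F \<delta>(3)] \<delta>(2) by (rule compact_continuous_image)
  then obtain b where b: "\<forall>x\<in>F ` S'. norm x \<le> b" using compact_imp_bounded bounded_pos by metis
  define \<eta> where "\<eta> = \<delta> / (norm (mat 1 :: real^'n^'n) + 1)"
  have pos: "norm (mat 1 :: real^'n^'n) + 1 > 0" by (simp add: add_nonneg_pos)
  have \<eta>: "\<eta> > 0" using \<delta>(1) pos by (simp add: \<eta>_def)
  show ?thesis
  proof (rule that[OF \<eta>, of "- b"])
    fix r s assume r: "r \<in> \<Gamma>" and s: "s \<in> S"
    let ?t = "(- \<eta>) *\<^sub>R (mat 1 :: real^'n^'n)"
    have "?t \<in> sym_mats" by (rule sym_mats_scale[OF mat_sym])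
    moreover have "norm ?t \<le> \<delta>" using \<delta>(1) pos by (simp add: \<eta>_def field_simps)
    ultimately have st: "s + ?t \<in> S'" using \<delta>(4) s by blast
    then have "\<bar>F (s + ?t)\<bar> \<le> b" using b by (metis imageI real_norm_def)
    then have "- b \<le> F r + G r \<bullet> (s + ?t - r)" using supergradient[OF r, of "s + ?t"] st \<delta>(3) by auto
    then show "\<eta> * trace (G r) + - b - F r \<le> G r \<bullet> (s - r)"
      by (simp add: trace_eq_inner inner_diff_right inner_add_right)
  qed
qed

end

section \<open>Jets of the solution\<close>

lemma jet2_vec:
  fixes f :: "real \<Rightarrow> ('a::euclidean_space)^'n"
  assumes "\<And>i. jet2 (\<lambda>t. f t $ i) (a $ i) (b $ i)"
  shows "jet2 f a b"
proof -
  define L :: "'n \<Rightarrow> 'a \<Rightarrow> 'a^'n" where "L i x = (\<chi> k. if k = i then x else 0)" for i x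
  have L: "bounded_linear (L i)" for i
    by (rule linear_conv_bounded_linear[THEN iffD1], rule linearI) (auto simp: L_def vec_eq_iff)
  have repr: "(\<Sum>i\<in>UNIV. L i (z $ i)) = z" for z
    by (simp add: L_def vec_eq_iff)
  have "jet2 (\<lambda>t. \<Sum>i\<in>UNIV. L i (f t $ i)) (\<Sum>i\<in>UNIV. L i (a $ i)) (\<Sum>i\<in>UNIV. L i (b $ i))"
    by (rule jet2_sum) (simp_all add: jet2_linear[OF L assms])
  then show ?thesis by (simp add: repr)
qed

text \<open>The argument at which \<open>A\<close> and \<open>B\<close> are evaluated along
  \<open>u\<close>; \<open>point1\<close> and \<open>point2\<close> are its first and second
  derivatives along a line with velocity \<open>v\<close>.\<close>

definition point :: "(real^'n \<Rightarrow> real) \<Rightarrow> real^'n \<Rightarrow> (real^'n) \<times> real \<times> (real^'n)"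
  where "point u x = (x, u x, grad u x)"

definition point1 :: "(real^'n \<Rightarrow> real) \<Rightarrow> real^'n \<Rightarrow> real^'n \<Rightarrow> (real^'n) \<times> real \<times> (real^'n)"
  where "point1 u x v = (v, dir_deriv u v x, hess u x *v v)"

definition third :: "(real^'n \<Rightarrow> real) \<Rightarrow> real^'n \<Rightarrow> real^'n \<Rightarrow> real^'n^'n"
  where "third u x v = (\<chi> i j. dir_deriv (dir_deriv (dir_deriv u (axis i 1)) (axis j 1)) v x)"

definition fourth :: "(real^'n \<Rightarrow> real) \<Rightarrow> real^'n \<Rightarrow> real^'n \<Rightarrow> real^'n^'n"
  where "fourth u x v = (\<chi> i j. dir_deriv (dir_deriv (dir_deriv (dir_deriv u (axis i 1)) (axis j 1)) v) v x)"

definition point2 :: "(real^'n \<Rightarrow> real) \<Rightarrow> real^'n \<Rightarrow> real^'n \<Rightarrow> (real^'n) \<times> real \<times> (real^'n)"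
  where "point2 u x v = (0, dir_deriv (dir_deriv u v) v x, third u x v *v v)"

lemma linear_axis_expand:
  fixes L :: "real^'n \<Rightarrow> 'b::real_vector"
  assumes "linear L"
  shows "L v = (\<Sum>i\<in>UNIV. v $ i *\<^sub>R L (axis i 1))"
proof -
  have "(\<Sum>i\<in>UNIV. v $ i *\<^sub>R axis i 1) = v"
    using basis_expansion[of v] by (simp add: scalar_mult_eq_scaleR)
  moreover have "L (\<Sum>i\<in>UNIV. v $ i *\<^sub>R axis i 1) = (\<Sum>i\<in>UNIV. v $ i *\<^sub>R L (axis i 1))"
    using assms by (simp add: linear_sum linear_scale)
  ultimately show ?thesis by simp
qed

lemma bilinear_axis_expand:
  fixes b :: "real^'n \<Rightarrow> real^'n \<Rightarrow> real"
  assumes "\<And>w. linear (\<lambda>v. b v w)" "\<And>v. linear (b v)"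
  shows "x \<bullet> ((\<chi> i j. b (axis i 1) (axis j 1)) *v y) = b x y"
proof -
  have "b x y = (\<Sum>i\<in>UNIV. x $ i * b (axis i 1) y)"
    using linear_axis_expand[OF assms(1)[of y], of x] by simp
  also have "\<dots> = (\<Sum>i\<in>UNIV. x $ i * (\<Sum>j\<in>UNIV. y $ j * b (axis i 1) (axis j 1)))"
  proof (rule sum.cong[OF refl])
    fix i
    show "x $ i * b (axis i 1) y = x $ i * (\<Sum>j\<in>UNIV. y $ j * b (axis i 1) (axis j 1))"
      using linear_axis_expand[OF assms(2)[of "axis i 1"], of y] by simp
  qed
  finally show ?thesis
    by (simp add: inner_vec_def matrix_vector_mult_def mult.commute)
qed

section \<open>Symmetry of higher derivatives and jets along lines\<close>

locale smooth_function =
  fixes \<Omega> :: "(real^'n) set" and u :: "real^'n \<Rightarrow> real"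
  assumes \<Omega>: "open \<Omega>" and u: "Ck_on 2 \<Omega> u"
begin

lemma u_diff: "x \<in> \<Omega> \<Longrightarrow> u differentiable (at x)"
  using Ck_on_SucD[OF \<Omega>, of 1 u] u by (simp add: numeral_2_eq_2)

lemma inner_grad: "x \<in> \<Omega> \<Longrightarrow> q \<bullet> grad u x = dir_deriv u q x"
  using linear_axis_expand[OF linear_dir_deriv[OF u_diff], of x q] by (simp add: grad_def inner_vec_def)

lemma inner_hess: "x \<in> \<Omega> \<Longrightarrow> \<xi> \<bullet> (hess u x *v \<eta>) = dir_deriv (dir_deriv u \<xi>) \<eta> x"
  unfolding hess_def
  using bilinear_axis_expand[of "\<lambda>v w. dir_deriv (dir_deriv u v) w x" \<xi> \<eta>]
    linear_dir_deriv_dir_deriv[OF \<Omega> _ u] linear_dir_deriv2[OF \<Omega> _ u] by blast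

lemma hess_symmetric: "x \<in> \<Omega> \<Longrightarrow> \<xi> \<bullet> (hess u x *v \<eta>) = \<eta> \<bullet> (hess u x *v \<xi>)"
  using dir_deriv_commute[OF \<Omega> _ u] by (simp add: inner_hess)

lemma jet2_u: "x \<in> \<Omega> \<Longrightarrow> jet2 (\<lambda>t. u (x + t *\<^sub>R v)) (v \<bullet> grad u x) (v \<bullet> (hess u x *v v))"
  using jet2_along_line[OF \<Omega> u] by (simp add: inner_grad inner_hess)

end

locale smooth_function4 =
  fixes \<Omega> :: "(real^'n) set" and u :: "real^'n \<Rightarrow> real"
  assumes \<Omega>4: "open \<Omega>" and u4: "Ck_on 4 \<Omega> u"
begin

sublocale smooth_function \<Omega> u
  using \<Omega>4 u4 Ck_on_le[of 4 \<Omega> u 2] by unfold_locales simp_all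

lemma C3: "Ck_on 3 \<Omega> (dir_deriv u a)"
  and C2: "Ck_on 2 \<Omega> (dir_deriv (dir_deriv u a) b)"
  using u4 by (simp_all add: eval_nat_numeral)

lemma C2': "Ck_on 2 \<Omega> (dir_deriv u a)"
  by (rule Ck_on_le[OF C3]) simp

lemma d2_commute: "x \<in> \<Omega> \<Longrightarrow> dir_deriv (dir_deriv u a) b x = dir_deriv (dir_deriv u b) a x"
  by (rule dir_deriv_commute[OF \<Omega> _ u])

lemma d3_commute: "x \<in> \<Omega> \<Longrightarrow> dir_deriv (dir_deriv (dir_deriv u a) b) c x = dir_deriv (dir_deriv (dir_deriv u b) a) c x"
  by (rule dir_deriv_cong[OF \<Omega>]) (simp_all add: d2_commute)

lemma d3_commute': "x \<in> \<Omega> \<Longrightarrow> dir_deriv (dir_deriv (dir_deriv u a) b) c x = dir_deriv (dir_deriv (dir_deriv u a) c) b x"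
  by (rule dir_deriv_commute[OF \<Omega> _ C2'])

text \<open>Every step swaps two adjacent derivatives, applied to a function that is still twice
  continuously differentiable. It lets derivatives of \<open>M[u]\<close> along \<open>e j\<close>
  and along \<open>e m\<close> be exchanged.\<close>

lemma d4_commute:
  assumes "x \<in> \<Omega>"
  shows "dir_deriv (dir_deriv (dir_deriv (dir_deriv u a) a) b) b x = dir_deriv (dir_deriv (dir_deriv (dir_deriv u b) b) a) a x"
proof -
  have "dir_deriv (dir_deriv (dir_deriv (dir_deriv u a) a) b) b x = dir_deriv (dir_deriv (dir_deriv (dir_deriv u b) a) a) b x"
  proof (rule dir_deriv_cong[OF \<Omega> assms])
    fix y assume y: "y \<in> \<Omega>"
    have "dir_deriv (dir_deriv (dir_deriv u a) a) b y = dir_deriv (dir_deriv (dir_deriv u a) b) a y"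
      by (rule d3_commute'[OF y])
    also have "\<dots> = dir_deriv (dir_deriv (dir_deriv u b) a) a y" by (rule d3_commute[OF y])
    finally show "dir_deriv (dir_deriv (dir_deriv u a) a) b y = dir_deriv (dir_deriv (dir_deriv u b) a) a y" .
  qed
  also have "\<dots> = dir_deriv (dir_deriv (dir_deriv (dir_deriv u b) a) b) a x"
    by (rule dir_deriv_commute[OF \<Omega> assms C2])
  also have "\<dots> = dir_deriv (dir_deriv (dir_deriv (dir_deriv u b) b) a) a x"
    by (rule dir_deriv_cong[OF \<Omega> assms]) (rule d3_commute')
  finally show ?thesis .
qed

lemma inner_third:
  assumes x: "x \<in> \<Omega>"
  shows "\<xi> \<bullet> (third u x v *v \<eta>) = dir_deriv (dir_deriv (dir_deriv u \<xi>) \<eta>) v x"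
  unfolding third_def
proof (rule bilinear_axis_expand[of "\<lambda>a b. dir_deriv (dir_deriv (dir_deriv u a) b) v x"])
  show lin: "linear (\<lambda>b. dir_deriv (dir_deriv (dir_deriv u a) b) v x)" for a
    by (rule linear_dir_deriv_dir_deriv[OF \<Omega> x C2'])
  show "linear (\<lambda>a. dir_deriv (dir_deriv (dir_deriv u a) b) v x)" for b
    using lin[of b] by (simp add: d3_commute[OF x, of _ b])
qed

lemma inner_fourth:
  assumes x: "x \<in> \<Omega>"
  shows "\<xi> \<bullet> (fourth u x v *v \<eta>) = dir_deriv (dir_deriv (dir_deriv (dir_deriv u \<xi>) \<eta>) v) v x"
  unfolding fourth_def
proof (rule bilinear_axis_expand[of "\<lambda>a b. dir_deriv (dir_deriv (dir_deriv (dir_deriv u a) b) v) v x"])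
  have eq: "dir_deriv (dir_deriv (dir_deriv (dir_deriv u a) b) v) v x = dir_deriv (dir_deriv (dir_deriv (dir_deriv u a) v) b) v x" for a b
    by (rule dir_deriv_cong[OF \<Omega> x]) (rule d3_commute')
  show lin: "linear (\<lambda>b. dir_deriv (dir_deriv (dir_deriv (dir_deriv u a) b) v) v x)" for a
    unfolding eq by (rule linear_dir_deriv_dir_deriv[OF \<Omega> x C2])
  have "dir_deriv (dir_deriv (dir_deriv (dir_deriv u a) b) v) v x = dir_deriv (dir_deriv (dir_deriv (dir_deriv u b) a) v) v x" for a b
    by (rule dir_deriv_cong[OF \<Omega> x]) (rule d3_commute)
  then show "linear (\<lambda>a. dir_deriv (dir_deriv (dir_deriv (dir_deriv u a) b) v) v x)" for b
    using lin[of b] by simp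
qed

lemma jet2_grad:
  assumes x: "x \<in> \<Omega>"
  shows "jet2 (\<lambda>t. grad u (x + t *\<^sub>R v)) (hess u x *v v) (third u x v *v v)"
proof (rule jet2_vec)
  fix i
  have "(hess u x *v v) $ i = dir_deriv (dir_deriv u (axis i 1)) v x"
    using inner_hess[OF x, of "axis i 1" v] by (simp add: inner_axis')
  moreover have "(third u x v *v v) $ i = dir_deriv (dir_deriv (dir_deriv u (axis i 1)) v) v x"
    using inner_third[OF x, of "axis i 1" v v] by (simp add: inner_axis')
  ultimately show "jet2 (\<lambda>t. grad u (x + t *\<^sub>R v) $ i) ((hess u x *v v) $ i) ((third u x v *v v) $ i)"
    using jet2_along_line[OF \<Omega> C2' x, of "axis i 1" v] by (simp add: grad_def)
qed

lemma jet2_hess: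
  assumes x: "x \<in> \<Omega>"
  shows "jet2 (\<lambda>t. hess u (x + t *\<^sub>R v)) (third u x v) (fourth u x v)"
proof (rule jet2_vec, rule jet2_vec)
  show "jet2 (\<lambda>t. hess u (x + t *\<^sub>R v) $ i $ j) (third u x v $ i $ j) (fourth u x v $ i $ j)" for i j
    using jet2_along_line[OF \<Omega> C2 x, of "axis i 1" "axis j 1" v] by (simp add: hess_def third_def fourth_def)
qed

lemma jet2_point:
  assumes x: "x \<in> \<Omega>"
  shows "jet2 (\<lambda>t. point u (x + t *\<^sub>R v)) (point1 u x v) (point2 u x v)"
  unfolding point_def point1_def point2_def
  by (intro jet2_Pair jet2_line jet2_along_line[OF \<Omega> u x] jet2_grad[OF x])

lemma jet2_compose_point:
  fixes g :: "(real^'n) \<times> real \<times> (real^'n) \<Rightarrow> 'b::real_normed_vector"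
  assumes x: "x \<in> \<Omega>" and g: "Ck_on 2 (\<Omega> \<times> UNIV \<times> UNIV) g"
  shows "jet2 (\<lambda>t. g (point u (x + t *\<^sub>R v))) (dir_deriv g (point1 u x v) (point u x))
    (dir_deriv (dir_deriv g (point1 u x v)) (point1 u x v) (point u x) + dir_deriv g (point2 u x v) (point u x))"
proof (rule jet2_compose[OF _ g jet2_point[OF x]])
  show "open (\<Omega> \<times> (UNIV :: real set) \<times> (UNIV :: (real^'n) set))" using \<Omega> by (intro open_Times) simp_all
  show "point u x \<in> \<Omega> \<times> UNIV \<times> UNIV" using x by (simp add: point_def)
qed simp

end

text \<open>Rotations in the plane of the unit vector \<open>e\<close> and \<open>\<zeta> \<bottom> e\<close>, parametrised rationally so that \<open>\<zeta> = 0\<close> needs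
  no special treatment; the speed is \<open>\<zeta>\<close>.\<close>

definition rot :: "real^'n \<Rightarrow> real^'n \<Rightarrow> real \<Rightarrow> real^'n \<Rightarrow> real^'n"
  where "rot e \<zeta> t x = (let d = 1 + (\<zeta> \<bullet> \<zeta>) * t\<^sup>2 / 4; a = - (t\<^sup>2 / (2 * d)); b = t / d in
    x + (a * (\<zeta> \<bullet> \<zeta>) * (x \<bullet> e) - b * (x \<bullet> \<zeta>)) *\<^sub>R e + (a * (x \<bullet> \<zeta>) + b * (x \<bullet> e)) *\<^sub>R \<zeta>)"

lemma rot_inner:
  assumes "norm e = 1" "e \<bullet> \<zeta> = 0"
  shows "rot e \<zeta> t x \<bullet> rot e \<zeta> t y = x \<bullet> y"
proof -
  define w where "w = \<zeta> \<bullet> \<zeta>"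
  define d where "d = 1 + w * t\<^sup>2 / 4"
  define a where "a = - (t\<^sup>2 / (2 * d))"
  define b where "b = t / d"
  have d: "d > 0" unfolding d_def w_def by (simp add: add_pos_nonneg)
  have ee: "e \<bullet> e = 1" "\<zeta> \<bullet> e = 0" using assms by (simp_all add: norm_eq_1 inner_commute)
  \<comment> \<open>If \<open>tan (\<theta> / 2) = |\<zeta>| t / 2\<close>, then
    \<open>1 + a * w\<close> and \<open>|\<zeta>| b\<close> are the cosine and sine of \<theta>. Up
    to the factor \<open>w\<close> this is their Pythagorean identity, stated without that factor so
    that it also covers \<open>w = 0\<close>.\<close>
  have key: "2 * a + b\<^sup>2 + a\<^sup>2 * w = 0"
  proof -
    have bd: "b * d = t" using d by (simp add: b_def)
    have a: "a = - (t * b / 2)" using d by (simp add: a_def b_def power2_eq_square)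
    have "2 * a + b\<^sup>2 + a\<^sup>2 * w = b * (b * d - t)"
      by (simp add: a d_def algebra_simps power2_eq_square)
    then show ?thesis using bd by simp
  qed
  define p where "p x = a * w * (x \<bullet> e) - b * (x \<bullet> \<zeta>)" for x
  define q where "q x = a * (x \<bullet> \<zeta>) + b * (x \<bullet> e)" for x
  have r: "rot e \<zeta> t x = x + p x *\<^sub>R e + q x *\<^sub>R \<zeta>" for x
    by (simp add: rot_def Let_def p_def q_def a_def b_def d_def w_def)
  have "rot e \<zeta> t x \<bullet> rot e \<zeta> t y - x \<bullet> y =
      p y * (x \<bullet> e) + q y * (x \<bullet> \<zeta>) + p x * (y \<bullet> e) + p x * p y + q x * (y \<bullet> \<zeta>) + q x * q y * w"
  proof -
    have "e \<bullet> y = y \<bullet> e" "\<zeta> \<bullet> y = y \<bullet> \<zeta>" "e \<bullet> \<zeta> = 0" "\<zeta> \<bullet> \<zeta> = w"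
      using assms(2) by (simp_all add: inner_commute w_def)
    with ee show ?thesis unfolding r by (simp add: inner_add_left inner_add_right) (simp add: algebra_simps)
  qed
  also have "\<dots> = (2 * a + b\<^sup>2 + a\<^sup>2 * w) * (w * (x \<bullet> e) * (y \<bullet> e) + (x \<bullet> \<zeta>) * (y \<bullet> \<zeta>))"
    by (simp add: p_def q_def algebra_simps power2_eq_square)
  finally show ?thesis using key by simp
qed

lemma rot_frame:
  assumes "frame e" "e i \<bullet> \<zeta> = 0"
  shows "frame (\<lambda>j. rot (e i) \<zeta> t (e j))"
  using assms rot_inner[OF frame_norm[OF assms(1)] assms(2)] by (simp add: frame_def)

lemma rot_0: "rot e \<zeta> 0 x = x"
  by (simp add: rot_def)

text \<open>For a unit vector \<open>e\<close> orthogonal to \<zeta> the second derivative is the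
  square of the infinitesimal rotation: to second order the rational curve agrees with the
  exponential.\<close>

lemma jet2_rot:
  "jet2 (\<lambda>t. rot e \<zeta> t x) ((x \<bullet> e) *\<^sub>R \<zeta> - (x \<bullet> \<zeta>) *\<^sub>R e) (- ((\<zeta> \<bullet> \<zeta>) * (x \<bullet> e)) *\<^sub>R e - (x \<bullet> \<zeta>) *\<^sub>R \<zeta>)"
proof -
  define w where "w = (\<zeta> \<bullet> \<zeta>) / 4"
  have w: "w \<ge> 0" by (simp add: w_def)
  have d0: "1 + w * t\<^sup>2 \<noteq> 0" for t :: real using mult_nonneg_nonneg[OF w zero_le_power2[of t]] by linarith
  have d1: "1 + t * (t * w) \<noteq> 0" for t :: real using d0[of t] by (simp add: power2_eq_square mult_ac)
  have b: "jet2 (\<lambda>t. t / (1 + w * t\<^sup>2)) 1 0"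
    unfolding jet2_real_iff
  proof (intro exI conjI)
    show "\<forall>\<^sub>F t in nhds 0. ((\<lambda>t. t / (1 + w * t\<^sup>2)) has_real_derivative (1 - w * t\<^sup>2) / (1 + w * t\<^sup>2)\<^sup>2) (at t)"
      by (rule always_eventually) (auto intro!: derivative_eq_intros simp: d0 d1 power2_eq_square field_simps)
    show "((\<lambda>t. (1 - w * t\<^sup>2) / (1 + w * t\<^sup>2)\<^sup>2) has_real_derivative 0) (at 0)"
      by (auto intro!: derivative_eq_intros)
  qed simp
  have id: "jet2 (\<lambda>t::real. t) 1 0" using jet2_line[of 0 "1::real"] by simp
  have a: "jet2 (\<lambda>t. - (t\<^sup>2 / (2 * (1 + w * t\<^sup>2)))) 0 (- 1)"
  proof -
    have "jet2 (\<lambda>t. (- 1 / 2) * (t * (t / (1 + w * t\<^sup>2)))) 0 (- 1)"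
      using jet2_linear[OF bounded_linear_mult_right[of "- 1 / 2"] jet2_mult[OF id b]] by simp
    then show ?thesis by (simp add: power2_eq_square)
  qed
  have L: "bounded_linear (\<lambda>c. (c * k) *\<^sub>R z)" for k and z :: "real^'n"
    by (intro bounded_linear_scaleR_const bounded_linear_mult_left)
  have J: "jet2 (\<lambda>t. x + ((- (t\<^sup>2 / (2 * (1 + w * t\<^sup>2)))) * ((\<zeta> \<bullet> \<zeta>) * (x \<bullet> e))) *\<^sub>R e - ((t / (1 + w * t\<^sup>2)) * (x \<bullet> \<zeta>)) *\<^sub>R e
      + (((- (t\<^sup>2 / (2 * (1 + w * t\<^sup>2)))) * (x \<bullet> \<zeta>)) *\<^sub>R \<zeta> + ((t / (1 + w * t\<^sup>2)) * (x \<bullet> e)) *\<^sub>R \<zeta>))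
    (0 + (0 * ((\<zeta> \<bullet> \<zeta>) * (x \<bullet> e))) *\<^sub>R e - (1 * (x \<bullet> \<zeta>)) *\<^sub>R e + ((0 * (x \<bullet> \<zeta>)) *\<^sub>R \<zeta> + (1 * (x \<bullet> e)) *\<^sub>R \<zeta>))
    (0 + (- 1 * ((\<zeta> \<bullet> \<zeta>) * (x \<bullet> e))) *\<^sub>R e - (0 * (x \<bullet> \<zeta>)) *\<^sub>R e + ((- 1 * (x \<bullet> \<zeta>)) *\<^sub>R \<zeta> + (0 * (x \<bullet> e)) *\<^sub>R \<zeta>))"
    by (intro jet2_add jet2_diff jet2_const jet2_linear[OF L a] jet2_linear[OF L b])
  have eq: "x + ((- (t\<^sup>2 / (2 * (1 + w * t\<^sup>2)))) * ((\<zeta> \<bullet> \<zeta>) * (x \<bullet> e))) *\<^sub>R e - ((t / (1 + w * t\<^sup>2)) * (x \<bullet> \<zeta>)) *\<^sub>R e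
      + (((- (t\<^sup>2 / (2 * (1 + w * t\<^sup>2)))) * (x \<bullet> \<zeta>)) *\<^sub>R \<zeta> + ((t / (1 + w * t\<^sup>2)) * (x \<bullet> e)) *\<^sub>R \<zeta>) = rot e \<zeta> t x" for t
    by (simp add: rot_def Let_def w_def algebra_simps)
  have v1: "0 + (0 * ((\<zeta> \<bullet> \<zeta>) * (x \<bullet> e))) *\<^sub>R e - (1 * (x \<bullet> \<zeta>)) *\<^sub>R e + ((0 * (x \<bullet> \<zeta>)) *\<^sub>R \<zeta> + (1 * (x \<bullet> e)) *\<^sub>R \<zeta>) =
    (x \<bullet> e) *\<^sub>R \<zeta> - (x \<bullet> \<zeta>) *\<^sub>R e" by simp
  have v2: "0 + (- 1 * ((\<zeta> \<bullet> \<zeta>) * (x \<bullet> e))) *\<^sub>R e - (0 * (x \<bullet> \<zeta>)) *\<^sub>R e + ((- 1 * (x \<bullet> \<zeta>)) *\<^sub>R \<zeta> + (0 * (x \<bullet> e)) *\<^sub>R \<zeta>) =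
    - ((\<zeta> \<bullet> \<zeta>) * (x \<bullet> e)) *\<^sub>R e - (x \<bullet> \<zeta>) *\<^sub>R \<zeta>" by simp
  show ?thesis using J unfolding eq v1 v2 .
qed

section \<open>The differential inequality at an interior maximum\<close>

text \<open>The gradient in the \<open>p\<close> slot: for the derivative of a coefficient at a
  point it is the vector of its \<open>p\<close> derivatives.\<close>

definition pvec :: "((real^'n) \<times> real \<times> (real^'n) \<Rightarrow> real) \<Rightarrow> real^'n"
  where "pvec g = (\<chi> i. g (0, 0, axis i 1))"

lemma inner_pvec:
  assumes "linear g"
  shows "pvec g \<bullet> q = g (0, 0, q)"
proof -
  have "linear (\<lambda>q. g (0, 0, q))"
    using linear_compose[OF _ assms, of "\<lambda>q. (0, 0, q)"] by (simp add: o_def linear_iff)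
  from linear_axis_expand[OF this, of q] show ?thesis
    by (simp add: pvec_def inner_vec_def mult.commute)
qed

lemma norm_pvec_le:
  assumes "linear g" "\<And>v. \<bar>g v\<bar> \<le> N * norm v" "N \<ge> 0"
  shows "norm (pvec g) \<le> N"
proof (cases "pvec g = 0")
  case False
  have "norm (pvec g) * norm (pvec g) = g (0, 0, pvec g)"
    using inner_pvec[OF assms(1), of "pvec g"] by (simp add: dot_square_norm power2_eq_square)
  also have "\<dots> \<le> N * norm (pvec g)" using assms(2)[of "(0, 0, pvec g)"] by (simp add: norm_Pair)
  finally show ?thesis using False by simp
qed (use assms in simp)

lemma frame_quadratic_le:
  assumes "frame e"
  shows "\<bar>e i \<bullet> (M *v e j)\<bar> \<le> norm (M :: real^'n^'n)"
  using Cauchy_Schwarz_ineq2[of "e i" "M *v e j"] norm_matrix_vector_le[of M "e j"] frame_norm[OF assms] by simp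

lemma norm_triple_le: "norm (a, b, c) \<le> norm a + (norm b + norm c)"
  using norm_Pair_le[of a "(b, c)"] norm_Pair_le[of b c] by linarith

section \<open>The equation at a point, differentiated along an eigenframe of the solution\<close>

locale interior_point = concave_operator \<Gamma> F + smooth_function4 \<Omega> u
  for \<Gamma> :: "(real^'n^'n) set" and F :: "real^'n^'n \<Rightarrow> real" and \<Omega> :: "(real^'n) set" and u :: "real^'n \<Rightarrow> real" +
  fixes A :: "real^'n \<Rightarrow> real \<Rightarrow> real^'n \<Rightarrow> real^'n^'n" and B :: "real^'n \<Rightarrow> real \<Rightarrow> real^'n \<Rightarrow> real"
    and x0 :: "real^'n" and e :: "'n \<Rightarrow> real^'n" and l :: "'n \<Rightarrow> real" and m :: 'n and N :: real
  assumes A2: "Ck_on 2 (\<Omega> \<times> UNIV \<times> UNIV) (\<lambda>(x, z, p). A x z p)"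
    and B2: "Ck_on 2 (\<Omega> \<times> UNIV \<times> UNIV) (\<lambda>(x, z, p). B x z p)"
    and x0: "x0 \<in> \<Omega>" and sol: "admissible_solution \<Omega> \<Gamma> F A B u"
    and e: "frame e" and l: "\<And>j. aug_hess A u x0 *v e j = l j *\<^sub>R e j"
    and N: "N \<ge> 1" and lm: "l m \<ge> 1" and l_le: "\<And>j. \<bar>l j\<bar> \<le> N * l m"
    and A0: "norm (A x0 (u x0) (grad u x0)) \<le> N" and gradN: "norm (grad u x0) \<le> N"
    and A1N: "\<And>v. norm (dir_deriv (\<lambda>(x, z, p). A x z p) v (point u x0)) \<le> N * norm v"
    and A2N: "\<And>v w. norm (dir_deriv (dir_deriv (\<lambda>(x, z, p). A x z p) v) w (point u x0)) \<le> N * norm v * norm w"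
    and B1N: "\<And>v. \<bar>dir_deriv (\<lambda>(x, z, p). B x z p) v (point u x0)\<bar> \<le> N * norm v"
    and B2N: "\<And>v w. \<bar>dir_deriv (dir_deriv (\<lambda>(x, z, p). B x z p) v) w (point u x0)\<bar> \<le> N * norm v * norm w"
    and regA: "\<And>\<xi> \<eta>. \<xi> \<bullet> \<eta> = 0 \<Longrightarrow>
      0 \<le> \<xi> \<bullet> (dir_deriv (dir_deriv (\<lambda>(x, z, p). A x z p) (0, 0, \<eta>)) (0, 0, \<eta>) (point u x0) *v \<xi>)"
    and convB: "\<And>\<eta>. 0 \<le> dir_deriv (dir_deriv (\<lambda>(x, z, p). B x z p) (0, 0, \<eta>)) (0, 0, \<eta>) (point u x0)"
begin

abbreviation "r0 \<equiv> aug_hess A u x0"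
abbreviation "dA v \<equiv> dir_deriv (\<lambda>(x, z, p). A x z p) v (point u x0)"
abbreviation "ddA v w \<equiv> dir_deriv (dir_deriv (\<lambda>(x, z, p). A x z p) v) w (point u x0)"
abbreviation "dB v \<equiv> dir_deriv (\<lambda>(x, z, p). B x z p) v (point u x0)"
abbreviation "ddB v w \<equiv> dir_deriv (dir_deriv (\<lambda>(x, z, p). B x z p) v) w (point u x0)"
abbreviation "y1 v \<equiv> point1 u x0 v"
abbreviation "y2 v \<equiv> point2 u x0 v"

text \<open>These are the eigenvalues of the gradient of \<open>F\<close> at \<open>r0\<close>, by
  \<open>Gf\<close>. In what follows \<open>s\<close> is the good term, errors without squares of
  eigenvalues are measured by \<open>1 + T\<close>, and \<open>W1\<close>, \<open>W2\<close>,
  \<open>b2\<close> are derivatives of \<open>M[u]\<close> and of the right-hand side along a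
  line.\<close>

definition f :: "'n \<Rightarrow> real" where "f j = e j \<bullet> (G r0 *v e j)"
definition T :: real where "T = (\<Sum>j\<in>UNIV. f j)"
definition s :: real where "s = (\<Sum>j\<in>UNIV. f j * (l j)\<^sup>2)"
definition W1 :: "real^'n \<Rightarrow> real^'n^'n" where "W1 v = third u x0 v - dA (y1 v)"
definition W2 :: "real^'n \<Rightarrow> real^'n^'n" where "W2 v = fourth u x0 v - (ddA (y1 v) (y1 v) + dA (y2 v))"
definition b2 :: "real^'n \<Rightarrow> real" where "b2 v = ddB (y1 v) (y1 v) + dB (y2 v)"
definition \<alpha> :: "'n \<Rightarrow> (real^'n) \<times> real \<times> (real^'n) \<Rightarrow> real" where "\<alpha> j v = e j \<bullet> (dA v *v e j)"

lemma r0: "r0 \<in> \<Gamma>"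
  using sol x0 by (simp add: admissible_solution_def)

lemma openY: "open (\<Omega> \<times> (UNIV :: real set) \<times> (UNIV :: (real^'n) set))"
  using \<Omega> by (intro open_Times) simp_all

lemma y0Y: "point u x0 \<in> \<Omega> \<times> UNIV \<times> UNIV"
  using x0 by (simp add: point_def)

lemma linear_dA: "linear dA"
  using Ck_on_SucD[OF openY, of 1] A2 y0Y by (intro linear_dir_deriv) (simp add: numeral_2_eq_2)

lemma linear_dB: "linear dB"
  using Ck_on_SucD[OF openY, of 1] B2 y0Y by (intro linear_dir_deriv) (simp add: numeral_2_eq_2)

lemma linear_ddA: "linear (\<lambda>v. ddA v w)" "linear (ddA v)"
  by (rule linear_dir_deriv_dir_deriv[OF openY y0Y A2], rule linear_dir_deriv2[OF openY y0Y A2])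

lemma linear_ddB: "linear (\<lambda>v. ddB v w)" "linear (ddB v)"
  by (rule linear_dir_deriv_dir_deriv[OF openY y0Y B2], rule linear_dir_deriv2[OF openY y0Y B2])

lemma linear_quadratic_form:
  assumes "linear h"
  shows "linear (\<lambda>v. \<xi> \<bullet> (h v *v (\<eta> :: real^'n)) :: real)"
  by (rule linearI) (simp_all add: linear_add[OF assms] linear_scale[OF assms] matrix_vector_mult_add_rdistrib
      inner_add_right scaleR_matrix_vector_assoc[symmetric])

lemma linear_\<alpha>: "linear (\<alpha> j)"
  unfolding \<alpha>_def by (rule linear_quadratic_form[OF linear_dA])

lemma \<alpha>_le: "\<bar>\<alpha> j v\<bar> \<le> N * norm v"
  unfolding \<alpha>_def using frame_quadratic_le[OF e, of j "dA v" j] A1N[of v] by linarith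

lemma f_pos: "f j > 0"
  unfolding f_def using G_pos[OF r0, of "e j"] frame_norm[OF e, of j] by force

lemma T_pos: "T > 0"
  unfolding T_def by (rule sum_pos) (auto simp: f_pos)

lemma T_trace: "T = trace (G r0)"
  unfolding T_def f_def by (rule frame_trace[OF e, symmetric])

lemma s_nonneg: "s \<ge> 0"
  unfolding s_def by (intro sum_nonneg mult_nonneg_nonneg) (simp_all add: f_pos less_imp_le)

lemma f_le_s: "f j * (l j)\<^sup>2 \<le> s"
  unfolding s_def by (rule member_le_sum) (auto simp: f_pos less_imp_le)

lemma Gf: "G r0 *v e j = f j *\<^sub>R e j"
  unfolding f_def by (rule gradient_diagonal[OF e r0 l])

lemma G_inner: "G r0 \<bullet> M = (\<Sum>j\<in>UNIV. f j * (e j \<bullet> (M *v e j)))"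
  using frame_inner_matrix[OF e, of "G r0" M] by (simp add: Gf)

lemma jetW: "jet2 (\<lambda>t. aug_hess A u (x0 + t *\<^sub>R v)) (W1 v) (W2 v)"
proof -
  have "jet2 (\<lambda>t. hess u (x0 + t *\<^sub>R v) - (\<lambda>(x, z, p). A x z p) (point u (x0 + t *\<^sub>R v))) (W1 v) (W2 v)"
    unfolding W1_def W2_def by (intro jet2_diff jet2_hess x0 jet2_compose_point[OF x0 A2])
  then show ?thesis by (simp add: aug_hess_def aug_hess_wrt_def point_def)
qed

lemma jetB: "jet2 (\<lambda>t. B (x0 + t *\<^sub>R v) (u (x0 + t *\<^sub>R v)) (grad u (x0 + t *\<^sub>R v))) (dB (y1 v)) (b2 v)"
  unfolding b2_def using jet2_compose_point[OF x0 B2, of v] by (simp add: point_def)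

lemma eventually_line: "\<forall>\<^sub>F t in nhds (0::real). x0 + t *\<^sub>R v \<in> \<Omega>"
proof -
  have "((\<lambda>t::real. x0 + t *\<^sub>R v) \<longlongrightarrow> x0 + 0 *\<^sub>R v) (nhds 0)"
    by (intro tendsto_intros filterlim_ident)
  then show ?thesis by (rule topological_tendstoD) (use \<Omega> x0 in simp_all)
qed

text \<open>The supporting plane at \<open>r0\<close> lies above \<open>F\<close>; it is evaluated on the solution in a rotated frame.\<close>

lemma concavity_jet:
  assumes "e m \<bullet> \<zeta> = 0"
  defines "q \<equiv> \<lambda>j. (e j \<bullet> e m) *\<^sub>R \<zeta> - (e j \<bullet> \<zeta>) *\<^sub>R e m"
    and "q' \<equiv> \<lambda>j. - ((\<zeta> \<bullet> \<zeta>) * (e j \<bullet> e m)) *\<^sub>R e m - (e j \<bullet> \<zeta>) *\<^sub>R \<zeta>"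
  shows "(\<Sum>j\<in>UNIV. f j * (q j \<bullet> (r0 *v e j) + e j \<bullet> (W1 v *v e j + r0 *v q j))) = dB (y1 v)"
    and "b2 v \<le> (\<Sum>j\<in>UNIV. f j * (q' j \<bullet> (r0 *v e j) + 2 * (q j \<bullet> (W1 v *v e j + r0 *v q j)) +
      e j \<bullet> (W2 v *v e j + 2 *\<^sub>R (W1 v *v q j) + r0 *v q' j)))"
proof -
  let ?w = "\<lambda>t. aug_hess A u (x0 + t *\<^sub>R v)"
  let ?B = "\<lambda>t. B (x0 + t *\<^sub>R v) (u (x0 + t *\<^sub>R v)) (grad u (x0 + t *\<^sub>R v))"
  let ?q = "\<lambda>j t. rot (e m) \<zeta> t (e j)"
  have jq: "jet2 (?q j) (q j) (q' j)" for j unfolding q_def q'_def by (rule jet2_rot)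
  have jwq: "jet2 (\<lambda>t. ?w t *v ?q j t) (W1 v *v e j + r0 *v q j) (W2 v *v e j + 2 *\<^sub>R (W1 v *v q j) + r0 *v q' j)" for j
    using jet2_bilinear[OF bounded_bilinear_matrix_vector jetW jq, of v j] by (simp add: rot_0)
  have "jet2 (\<lambda>t. ?q j t \<bullet> (?w t *v ?q j t)) (q j \<bullet> (r0 *v e j) + e j \<bullet> (W1 v *v e j + r0 *v q j))
      (q' j \<bullet> (r0 *v e j) + 2 * (q j \<bullet> (W1 v *v e j + r0 *v q j)) +
      e j \<bullet> (W2 v *v e j + 2 *\<^sub>R (W1 v *v q j) + r0 *v q' j))" for j
    using jet2_inner[OF jq jwq, of j j] by (simp add: rot_0)
  from jet2_linear[OF bounded_linear_mult_right this]
  have jf: "jet2 (\<lambda>t. f j * (?q j t \<bullet> (?w t *v ?q j t))) (f j * (q j \<bullet> (r0 *v e j) + e j \<bullet> (W1 v *v e j + r0 *v q j)))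
      (f j * (q' j \<bullet> (r0 *v e j) + 2 * (q j \<bullet> (W1 v *v e j + r0 *v q j)) +
      e j \<bullet> (W2 v *v e j + 2 *\<^sub>R (W1 v *v q j) + r0 *v q' j)))" for j .
  \<comment> \<open>Up to a constant this is the supporting plane in the rotated frame minus
    \<open>F\<close> along the solution. It is smallest at 0, where the plane touches.\<close>
  let ?E = "\<lambda>t. (\<Sum>j\<in>UNIV. f j * (?q j t \<bullet> (?w t *v ?q j t))) - ?B t"
  have jE: "jet2 ?E ((\<Sum>j\<in>UNIV. f j * (q j \<bullet> (r0 *v e j) + e j \<bullet> (W1 v *v e j + r0 *v q j))) - dB (y1 v))
      ((\<Sum>j\<in>UNIV. f j * (q' j \<bullet> (r0 *v e j) + 2 * (q j \<bullet> (W1 v *v e j + r0 *v q j)) +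
      e j \<bullet> (W2 v *v e j + 2 *\<^sub>R (W1 v *v q j) + r0 *v q' j))) - b2 v)"
    by (intro jet2_diff jet2_sum jetB) (simp_all add: jf)
  have "\<forall>\<^sub>F t in nhds 0. ?E 0 \<le> ?E t"
    using eventually_line[of v]
  proof eventually_elim
    case (elim t)
    have w: "?w t \<in> \<Gamma>" "F (?w t) = ?B t" using sol elim by (simp_all add: admissible_solution_def)
    have w0: "F r0 = ?B 0" using sol x0 by (simp add: admissible_solution_def)
    have "F (?w t) \<le> F r0 - G r0 \<bullet> r0 + (\<Sum>j\<in>UNIV. f j * (?q j t \<bullet> (?w t *v ?q j t)))"
      using supergradient_rotated[OF e rot_frame[OF e assms(1)] r0 w(1), of f t] Gf by simp
    moreover have "G r0 \<bullet> r0 = (\<Sum>j\<in>UNIV. f j * (?q j 0 \<bullet> (?w 0 *v ?q j 0)))"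
      by (simp add: G_inner rot_0)
    ultimately show ?case using w(2) w0 by linarith
  qed
  from jet2_local_min[OF jE this]
  show "(\<Sum>j\<in>UNIV. f j * (q j \<bullet> (r0 *v e j) + e j \<bullet> (W1 v *v e j + r0 *v q j))) = dB (y1 v)"
    "b2 v \<le> (\<Sum>j\<in>UNIV. f j * (q' j \<bullet> (r0 *v e j) + 2 * (q j \<bullet> (W1 v *v e j + r0 *v q j)) +
      e j \<bullet> (W2 v *v e j + 2 *\<^sub>R (W1 v *v q j) + r0 *v q' j)))"
    by simp_all
qed

text \<open>The equation differentiated once, read off with the frame at rest.\<close>

lemma first_order: "(\<Sum>j\<in>UNIV. f j * (e j \<bullet> (W1 v *v e j))) = dB (y1 v)"
  using concavity_jet(1)[of 0 v] by simp

text \<open>The symmetrised mixed entry of the derivative of \<open>M[u]\<close>: a rotation in the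
  plane of \<open>e m\<close> and \<open>e i\<close> couples to exactly this quantity.\<close>

definition \<omega> :: "'n \<Rightarrow> real"
  where "\<omega> i = (e m \<bullet> (W1 (e m) *v e i) + e i \<bullet> (W1 (e m) *v e m)) / 2"

text \<open>The coefficients \<open>z\<close> of the velocity are free. Choosing
  \<open>\<omega> i / (l m - l i)\<close> would give
  \<open>2 (f m - f i) (\<omega> i)^2 / (l m - l i)\<close>, the contribution of the pairs
  containing \<open>m\<close> to the second derivative of a spectral function; left free,
  \<open>z\<close> causes no trouble at coinciding eigenvalues.\<close>

lemma second_order:
  assumes z: "z m = 0"
  shows "b2 (e m) \<le> (\<Sum>j\<in>UNIV. f j * (e j \<bullet> (W2 (e m) *v e j)))
    + (\<Sum>i\<in>UNIV. (f m - f i) * (4 * z i * \<omega> i - 2 * (z i)\<^sup>2 * (l m - l i)))"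
proof -
  note ee = e[unfolded frame_def, rule_format]
  define \<zeta> where "\<zeta> = (\<Sum>i\<in>UNIV. z i *\<^sub>R e i)"
  have ez: "e j \<bullet> \<zeta> = z j" for j
    by (simp add: \<zeta>_def inner_sum_right ee if_distrib[of "\<lambda>c. _ * c"] cong: if_cong)
  have ze: "\<zeta> \<bullet> e j = z j" for j using ez by (simp add: inner_commute)
  have em\<zeta>: "e m \<bullet> \<zeta> = 0" by (simp add: ez z)
  have zz: "\<zeta> \<bullet> \<zeta> = (\<Sum>i\<in>UNIV. (z i)\<^sup>2)"
    by (subst (2) \<zeta>_def) (simp add: inner_sum_right ze power2_eq_square)
  have r\<zeta>: "r0 *v \<zeta> = (\<Sum>i\<in>UNIV. (z i * l i) *\<^sub>R e i)"
    unfolding \<zeta>_def by (simp add: linear_sum[OF matrix_vector_mul_linear] matrix_vector_mult_scaleR l)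
  have \<zeta>r: "\<zeta> \<bullet> (r0 *v \<zeta>) = (\<Sum>i\<in>UNIV. (z i)\<^sup>2 * l i)"
    by (simp add: r\<zeta> inner_sum_right ze power2_eq_square mult_ac)
  have er: "e j \<bullet> (r0 *v \<zeta>) = z j * l j" for j
    by (simp add: r\<zeta> inner_sum_right ee if_distrib[of "\<lambda>c. _ * c"] cong: if_cong)
  let ?W = "W1 (e m)"
  have cross: "\<zeta> \<bullet> (?W *v e m) + e m \<bullet> (?W *v \<zeta>) = (\<Sum>i\<in>UNIV. 2 * z i * \<omega> i)"
  proof -
    have "\<zeta> \<bullet> (?W *v e m) = (\<Sum>i\<in>UNIV. z i * (e i \<bullet> (?W *v e m)))"
      by (simp add: \<zeta>_def inner_sum_left)
    moreover have "e m \<bullet> (?W *v \<zeta>) = (\<Sum>i\<in>UNIV. z i * (e m \<bullet> (?W *v e i)))"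
      by (simp add: \<zeta>_def linear_sum[OF matrix_vector_mul_linear] matrix_vector_mult_scaleR inner_sum_right)
    ultimately show ?thesis by (simp add: \<omega>_def sum.distrib[symmetric] algebra_simps add_divide_distrib)
  qed
  define q where "q j = (e j \<bullet> e m) *\<^sub>R \<zeta> - (e j \<bullet> \<zeta>) *\<^sub>R e m" for j
  define q' where "q' j = - ((\<zeta> \<bullet> \<zeta>) * (e j \<bullet> e m)) *\<^sub>R e m - (e j \<bullet> \<zeta>) *\<^sub>R \<zeta>" for j
  define S where "S = (\<Sum>i\<in>UNIV. 4 * z i * \<omega> i - 2 * (z i)\<^sup>2 * (l m - l i))"
  define R where "R i = 4 * z i * \<omega> i - 2 * (z i)\<^sup>2 * (l m - l i)" for i
  \<comment> \<open>The rotation moves \<open>e m\<close> with velocity \<zeta> and every other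
    \<open>e j\<close> with velocity \<open>- z j\<close> times \<open>e m\<close>. So
    \<open>f m\<close> collects all of \<open>S\<close> and each \<open>f j\<close> its own term
    with opposite sign, which produces the differences \<open>f m - f i\<close>.\<close>
  have summand: "q' j \<bullet> (r0 *v e j) + 2 * (q j \<bullet> (?W *v e j + r0 *v q j)) +
      e j \<bullet> (W2 (e m) *v e j + 2 *\<^sub>R (?W *v q j) + r0 *v q' j) = e j \<bullet> (W2 (e m) *v e j) + (if j = m then S else - R j)" for j
  proof (cases "j = m")
    case True
    have q: "q j = \<zeta>" "q' j = (- (\<zeta> \<bullet> \<zeta>)) *\<^sub>R e m" using True by (simp_all add: q_def q'_def ee ez z)
    have "q' j \<bullet> (r0 *v e j) + 2 * (q j \<bullet> (?W *v e j + r0 *v q j)) +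
      e j \<bullet> (W2 (e m) *v e j + 2 *\<^sub>R (?W *v q j) + r0 *v q' j)
      = e j \<bullet> (W2 (e m) *v e j) + 2 * (\<zeta> \<bullet> (?W *v e m) + e m \<bullet> (?W *v \<zeta>)) + 2 * (\<zeta> \<bullet> (r0 *v \<zeta>)) - 2 * (\<zeta> \<bullet> \<zeta>) * l m"
      unfolding q unfolding True
      by (simp only: matrix_vector_mult_scaleR inner_add_right inner_scaleR_right inner_scaleR_left l scaleR_scaleR ee ze z)
        (simp add: algebra_simps)
    also have "\<dots> = e j \<bullet> (W2 (e m) *v e j) + S"
      unfolding cross \<zeta>r zz S_def
      by (simp add: sum_distrib_left sum_distrib_right sum.distrib[symmetric] sum_subtractf[symmetric] algebra_simps)
    finally show ?thesis using True by simp
  next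
    case False
    have q: "q j = (- z j) *\<^sub>R e m" "q' j = (- z j) *\<^sub>R \<zeta>" using False by (simp_all add: q_def q'_def ee ez)
    have "q' j \<bullet> (r0 *v e j) + 2 * (q j \<bullet> (?W *v e j + r0 *v q j)) +
      e j \<bullet> (W2 (e m) *v e j + 2 *\<^sub>R (?W *v q j) + r0 *v q' j)
      = e j \<bullet> (W2 (e m) *v e j) - 2 * z j * (e m \<bullet> (?W *v e j) + e j \<bullet> (?W *v e m)) + 2 * (z j)\<^sup>2 * l m - 2 * (z j)\<^sup>2 * l j"
      unfolding q using False er[of j]
      by (simp only: matrix_vector_mult_scaleR inner_add_right inner_scaleR_right inner_scaleR_left l ze er scaleR_scaleR ee)
        (simp add: algebra_simps power2_eq_square)
    also have "\<dots> = e j \<bullet> (W2 (e m) *v e j) - R j"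
      by (simp add: R_def \<omega>_def field_simps)
    finally show ?thesis using False by simp
  qed
  have "b2 (e m) \<le> (\<Sum>j\<in>UNIV. f j * (e j \<bullet> (W2 (e m) *v e j) + (if j = m then S else - R j)))"
    using concavity_jet(2)[OF em\<zeta>, of "e m"] unfolding summand[unfolded q_def q'_def] .
  also have "\<dots> = (\<Sum>j\<in>UNIV. f j * (e j \<bullet> (W2 (e m) *v e j)) + ((if j = m then f m * S else 0) - f j * R j))"
    by (rule sum.cong) (auto simp: R_def z algebra_simps)
  also have "\<dots> = (\<Sum>j\<in>UNIV. f j * (e j \<bullet> (W2 (e m) *v e j))) + (f m * S - (\<Sum>j\<in>UNIV. f j * R j))"
    by (simp add: sum.distrib sum_subtractf)
  also have "f m * S - (\<Sum>j\<in>UNIV. f j * R j) = (\<Sum>i\<in>UNIV. (f m - f i) * R i)"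
    by (simp add: S_def R_def[symmetric] sum_distrib_left left_diff_distrib sum_subtractf)
  finally show ?thesis by (simp add: R_def)
qed

end

section \<open>Bounds for derivatives at the point, and the linearised operator\<close>

context interior_point
begin

lemma N_pow: "N \<le> N ^ 3" "N\<^sup>2 \<le> N ^ 3" "1 \<le> N ^ 3"
  using N power_increasing[of 1 3 N] power_increasing[of 2 3 N] power_increasing[of 0 3 N] by simp_all

lemma norm_r0: "norm (r0 *v q) \<le> N * l m * norm q"
proof (rule power2_le_imp_le)
  have "(r0 *v q) \<bullet> (r0 *v q) = (\<Sum>j\<in>UNIV. ((r0 *v q) \<bullet> e j)\<^sup>2)"
    using frame_inner[OF e, of "r0 *v q" "r0 *v q"] by (simp add: power2_eq_square)
  also have "\<dots> = (\<Sum>j\<in>UNIV. (l j)\<^sup>2 * (q \<bullet> e j)\<^sup>2)"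
    by (simp add: sym_mats_inner[OF sym[OF r0], symmetric] l power_mult_distrib)
  also have "\<dots> \<le> (\<Sum>j\<in>UNIV. (N * l m)\<^sup>2 * (q \<bullet> e j)\<^sup>2)"
  proof (intro sum_mono mult_right_mono)
    show "(l j)\<^sup>2 \<le> (N * l m)\<^sup>2" for j using l_le[of j] lm N by (simp add: abs_le_square_iff[symmetric] abs_mult)
  qed simp
  also have "\<dots> = (N * l m)\<^sup>2 * (q \<bullet> q)"
    using frame_inner[OF e, of q q] by (simp add: sum_distrib_left[symmetric] power2_eq_square)
  finally show "(norm (r0 *v q))\<^sup>2 \<le> (N * l m * norm q)\<^sup>2"
    by (simp add: power_mult_distrib power2_norm_eq_inner)
qed (use N lm in simp)

lemma hess_eq: "hess u x0 = r0 + A x0 (u x0) (grad u x0)"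
  by (simp add: aug_hess_def aug_hess_wrt_def)

lemma norm_Av: "norm (A x0 (u x0) (grad u x0) *v q) \<le> N * norm q"
  using norm_matrix_vector_le[of "A x0 (u x0) (grad u x0)" q] A0
  by (meson mult_right_mono norm_ge_zero order_trans)

lemma norm_hess_v: "norm (hess u x0 *v q) \<le> 2 * N * l m * norm q"
proof -
  have "norm (hess u x0 *v q) \<le> N * l m * norm q + N * norm q"
    unfolding hess_eq matrix_vector_mult_add_rdistrib
    using norm_triangle_ineq[of "r0 *v q"] norm_r0[of q] norm_Av[of q] by (meson add_mono order_trans)
  moreover have "N * 1 * norm q \<le> N * l m * norm q" using lm N by (intro mult_right_mono mult_left_mono) simp_all
  ultimately show ?thesis by simp
qed

lemma abs_du: "\<bar>dir_deriv u q x0\<bar> \<le> N * norm q"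
proof -
  have "\<bar>dir_deriv u q x0\<bar> \<le> norm q * norm (grad u x0)"
    using inner_grad[OF x0, of q] Cauchy_Schwarz_ineq2[of q "grad u x0"] by simp
  also have "\<dots> \<le> norm q * N" using gradN by (intro mult_left_mono) simp_all
  finally show ?thesis by (simp add: mult.commute)
qed

lemma norm_y1: "norm (y1 q) \<le> 4 * N * l m * norm q"
proof -
  have "norm (y1 q) \<le> norm q + (N * norm q + 2 * N * l m * norm q)"
    unfolding point1_def using norm_triple_le[of q "dir_deriv u q x0" "hess u x0 *v q"] abs_du[of q] norm_hess_v[of q] by simp
  moreover have "1 * 1 * norm q \<le> N * l m * norm q" "N * 1 * norm q \<le> N * l m * norm q"
    using lm N by (intro mult_right_mono mult_mono; simp)+
  ultimately show ?thesis by simp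
qed

text \<open>Sharper than \<open>norm_y1\<close> on the frame: it keeps the individual
  \<open>l j\<close>, whose square can be charged to \<open>s\<close> after multiplication by
  \<open>f j\<close>.\<close>

lemma norm_y1_e: "norm (y1 (e j)) \<le> 3 * N + \<bar>l j\<bar>"
proof -
  have ej: "norm (e j) = 1" by (rule frame_norm[OF e])
  have "norm (hess u x0 *v e j) \<le> \<bar>l j\<bar> + N"
    unfolding hess_eq matrix_vector_mult_add_rdistrib l
    using norm_triangle_ineq[of "l j *\<^sub>R e j" "A x0 (u x0) (grad u x0) *v e j"] norm_Av[of "e j"] ej by simp
  then show ?thesis
    unfolding point1_def using norm_triple_le[of "e j" "dir_deriv u (e j) x0" "hess u x0 *v e j"] abs_du[of "e j"] ej N by simp
qed

text \<open>Moves the odd direction to the outside, where the first order identities for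
  \<open>M[u]\<close> apply.\<close>

lemma third_symmetric: "q \<bullet> (third u x0 v *v v) = v \<bullet> (third u x0 q *v v)"
proof -
  have "q \<bullet> (third u x0 v *v v) = dir_deriv (dir_deriv (dir_deriv u q) v) v x0" by (rule inner_third[OF x0])
  also have "\<dots> = dir_deriv (dir_deriv (dir_deriv u v) q) v x0" by (rule d3_commute[OF x0])
  also have "\<dots> = dir_deriv (dir_deriv (dir_deriv u v) v) q x0" by (rule d3_commute'[OF x0])
  finally show ?thesis by (simp add: inner_third[OF x0])
qed

lemma quadratic_third: "e j \<bullet> (third u x0 q *v e j) = e j \<bullet> (W1 q *v e j) + \<alpha> j (y1 q)"
  by (simp add: W1_def \<alpha>_def matrix_vector_mult_diff_rdistrib inner_diff_right)

text \<open>Third derivatives of \<open>u\<close> enter only through the \<open>p\<close> slot; the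
  remaining part is of the size of the Hessian.\<close>

lemma y2_split:
  assumes "linear (g :: (real^'n) \<times> real \<times> (real^'n) \<Rightarrow> real)"
  shows "g (y2 v) = (v \<bullet> (hess u x0 *v v)) * g (0, 1, 0) + pvec g \<bullet> (third u x0 v *v v)"
proof -
  have "y2 v = (v \<bullet> (hess u x0 *v v)) *\<^sub>R (0, 1, 0) + (0, 0, third u x0 v *v v)"
    by (simp add: point2_def inner_hess[OF x0])
  then show ?thesis
    by (simp only: linear_add[OF assms] linear_scale[OF assms] inner_pvec[OF assms] real_scaleR_def)
qed

lemma abs_hess_e: "\<bar>e j \<bullet> (hess u x0 *v e j)\<bar> \<le> \<bar>l j\<bar> + N"
  using frame_quadratic_le[OF e, of j "A x0 (u x0) (grad u x0)" j] A0 frame_norm[OF e, of j]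
  by (simp add: hess_eq matrix_vector_mult_add_rdistrib inner_add_right l norm_eq_1)

text \<open>The linearised operator, applied to a function with first and second derivatives \<open>h1\<close>, \<open>h2\<close> along lines.\<close>

definition Lop :: "(real^'n \<Rightarrow> real) \<Rightarrow> (real^'n \<Rightarrow> real) \<Rightarrow> real"
  where "Lop h1 h2 = (\<Sum>j\<in>UNIV. f j * h2 (e j)) - (\<Sum>j\<in>UNIV. f j * h1 (pvec (\<alpha> j))) - h1 (pvec dB)"

end

section \<open>Consequences of an interior maximum for a general exponent\<close>

locale interior_max = interior_point \<Gamma> F \<Omega> u A B x0 e l m N
  for \<Gamma> :: "(real^'n^'n) set" and F \<Omega> u A B x0 e l m N +
  fixes \<phi> :: "real^'n \<Rightarrow> real" and p1 p2 :: "real^'n \<Rightarrow> real"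
  assumes j\<phi>: "\<And>q. jet2 (\<lambda>t. \<phi> (x0 + t *\<^sub>R q)) (p1 q) (p2 q)"
    and max: "\<And>x. x \<in> \<Omega> \<Longrightarrow> (e m \<bullet> (aug_hess A u x *v e m)) * exp (\<phi> x) \<le> l m * exp (\<phi> x0)"
begin

text \<open>With the direction \<open>e m\<close> frozen the maximised function is smooth even if
  the top eigenvalue is multiple. The first condition, inserted into the second, turns the mixed
  term into a square and yields \<open>(p1 q)^2 - p2 q\<close>.\<close>

lemma max_first: "e m \<bullet> (W1 q *v e m) = - (l m * p1 q)"
  and max_second: "e m \<bullet> (W2 q *v e m) \<le> l m * ((p1 q)\<^sup>2 - p2 q)"
proof -
  have mm: "e m \<bullet> e m = 1" using e by (simp add: frame_def)
  have L: "bounded_linear (\<lambda>M :: real^'n^'n. e m \<bullet> (M *v e m))"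
    by (rule bounded_linear_compose[OF bounded_linear_inner_right bounded_bilinear.bounded_linear_left[OF bounded_bilinear_matrix_vector]])
  have "jet2 (\<lambda>t. (e m \<bullet> (aug_hess A u (x0 + t *\<^sub>R q) *v e m)) * exp (\<phi> (x0 + t *\<^sub>R q)))
    ((e m \<bullet> (W1 q *v e m)) * exp (\<phi> x0) + l m * (p1 q * exp (\<phi> x0)))
    ((e m \<bullet> (W2 q *v e m)) * exp (\<phi> x0) + 2 * ((e m \<bullet> (W1 q *v e m)) * (p1 q * exp (\<phi> x0))) + l m * ((p2 q + (p1 q)\<^sup>2) * exp (\<phi> x0)))"
    using jet2_mult[OF jet2_linear[OF L jetW] jet2_exp[OF j\<phi>], of q q] by (simp add: l mm)
  moreover have "\<forall>\<^sub>F t in nhds 0. (e m \<bullet> (aug_hess A u (x0 + t *\<^sub>R q) *v e m)) * exp (\<phi> (x0 + t *\<^sub>R q))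
      \<le> (e m \<bullet> (aug_hess A u (x0 + 0 *\<^sub>R q) *v e m)) * exp (\<phi> (x0 + 0 *\<^sub>R q))"
    using eventually_line[of q] by eventually_elim (use max in \<open>simp add: l mm\<close>)
  ultimately have 1: "(e m \<bullet> (W1 q *v e m)) * exp (\<phi> x0) + l m * (p1 q * exp (\<phi> x0)) = 0"
    and 2: "(e m \<bullet> (W2 q *v e m)) * exp (\<phi> x0) + 2 * ((e m \<bullet> (W1 q *v e m)) * (p1 q * exp (\<phi> x0))) + l m * ((p2 q + (p1 q)\<^sup>2) * exp (\<phi> x0)) \<le> 0"
    using jet2_local_max by blast+
  have "exp (\<phi> x0) * ((e m \<bullet> (W1 q *v e m)) + l m * p1 q) = 0" using 1 by (simp add: algebra_simps)
  then have "(e m \<bullet> (W1 q *v e m)) + l m * p1 q = 0" by simp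
  then show W: "e m \<bullet> (W1 q *v e m) = - (l m * p1 q)" by linarith
  have "exp (\<phi> x0) * ((e m \<bullet> (W2 q *v e m)) - l m * ((p1 q)\<^sup>2 - p2 q)) \<le> 0"
    using 2 unfolding W by (simp add: algebra_simps power2_eq_square)
  then have "(e m \<bullet> (W2 q *v e m)) - l m * ((p1 q)\<^sup>2 - p2 q) \<le> 0" by (simp add: mult_le_0_iff)
  then show "e m \<bullet> (W2 q *v e m) \<le> l m * ((p1 q)\<^sup>2 - p2 q)" by simp
qed

text \<open>Common to \<open>B\<close> and the entries of \<open>A\<close>. In
  \<open>y1 (e m)\<close> the large part is \<open>l m\<close> times the pure \<open>p\<close>
  direction \<open>e m\<close>, which meets the structural bound \<open>c\<close>; the third
  derivatives are eliminated by \<open>max_first\<close>. The constant is \<open>15 + 2 + 4\<close>: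
  quadratic remainder, \<open>z\<close> derivative, and derivative of \<open>A\<close> in
  \<open>max_first\<close>.\<close>

lemma second_derivative_lower:
  assumes g: "linear g" "\<And>v. \<bar>g v\<bar> \<le> N * norm v"
    and Q: "\<And>w. linear (\<lambda>v. Q v w)" "\<And>v. linear (Q v)" "\<And>v w. \<bar>Q v w\<bar> \<le> N * norm v * norm w"
    and c: "c \<le> Q (0, 0, e m) (0, 0, e m)"
  shows "(l m)\<^sup>2 * c - 21 * N ^ 3 * l m - l m * p1 (pvec g) \<le> Q (y1 (e m)) (y1 (e m)) + (g (y2 (e m)) :: real)"
proof -
  have em: "norm (e m) = 1" by (rule frame_norm[OF e])
  define \<rho> where "\<rho> = (e m, dir_deriv u (e m) x0, A x0 (u x0) (grad u x0) *v e m)"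
  define \<epsilon> :: "(real^'n) \<times> real \<times> (real^'n)" where "\<epsilon> = (0, 0, e m)"
  have y: "y1 (e m) = l m *\<^sub>R \<epsilon> + \<rho>"
    by (simp add: point1_def \<rho>_def \<epsilon>_def hess_eq matrix_vector_mult_add_rdistrib l)
  have n\<epsilon>: "norm \<epsilon> = 1" by (simp add: \<epsilon>_def norm_Pair em)
  have n\<rho>: "norm \<rho> \<le> 3 * N"
    unfolding \<rho>_def using norm_triple_le[of "e m" "dir_deriv u (e m) x0" "A x0 (u x0) (grad u x0) *v e m"]
      abs_du[of "e m"] norm_Av[of "e m"] em N by simp
  have NN: "N * (3 * N) \<le> 3 * N ^ 3" "N * (3 * N) * (3 * N) = 9 * N ^ 3"
    using N_pow(2) by (simp_all add: power2_eq_square power3_eq_cube)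
  have N\<rho>: "N * norm \<rho> \<le> N * (3 * N)" using n\<rho> N by (intro mult_left_mono) simp_all
  have "\<bar>Q \<epsilon> \<rho>\<bar> \<le> N * (3 * N)" using Q(3)[of \<epsilon> \<rho>] N\<rho> unfolding n\<epsilon> by simp
  moreover have "\<bar>Q \<rho> \<epsilon>\<bar> \<le> N * (3 * N)" using Q(3)[of \<rho> \<epsilon>] N\<rho> unfolding n\<epsilon> by simp
  ultimately have 1: "- (6 * N ^ 3) \<le> Q \<epsilon> \<rho> + Q \<rho> \<epsilon>" using NN(1) by linarith
  have "\<bar>Q \<rho> \<rho>\<bar> \<le> N * (3 * N) * (3 * N)"
    by (rule order_trans[OF Q(3)]) (intro mult_mono n\<rho>; use N in simp)
  then have 2: "- (9 * N ^ 3) \<le> Q \<rho> \<rho>" using NN(2) by linarith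
  have "Q (y1 (e m)) (y1 (e m)) = (l m)\<^sup>2 * Q \<epsilon> \<epsilon> + l m * (Q \<epsilon> \<rho> + Q \<rho> \<epsilon>) + Q \<rho> \<rho>"
    unfolding y by (simp add: linear_add[OF Q(1)] linear_add[OF Q(2)] linear_scale[OF Q(1)] linear_scale[OF Q(2)]
        algebra_simps power2_eq_square)
  moreover have "(l m)\<^sup>2 * c \<le> (l m)\<^sup>2 * Q \<epsilon> \<epsilon>" using c unfolding \<epsilon>_def by (intro mult_left_mono) simp_all
  moreover have "l m * - (6 * N ^ 3) \<le> l m * (Q \<epsilon> \<rho> + Q \<rho> \<epsilon>)" using 1 lm by (intro mult_left_mono) simp_all
  moreover have "9 * N ^ 3 * 1 \<le> 9 * N ^ 3 * l m" using lm N by (intro mult_left_mono) simp_all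
  ultimately have q: "(l m)\<^sup>2 * c - 15 * N ^ 3 * l m \<le> Q (y1 (e m)) (y1 (e m))"
    using 2 by (simp add: algebra_simps)
  have "\<bar>(e m \<bullet> (hess u x0 *v e m)) * g (0, 1, 0)\<bar> \<le> (\<bar>l m\<bar> + N) * N"
    unfolding abs_mult using abs_hess_e[of m] g(2)[of "(0, 1, 0)"] N by (intro mult_mono) (simp_all add: norm_Pair)
  also have "\<dots> \<le> 2 * N ^ 3 * l m"
  proof -
    have "l m * N \<le> l m * N ^ 3" using lm N_pow by (intro mult_left_mono) simp_all
    moreover have "1 * N\<^sup>2 \<le> l m * N ^ 3" using lm N_pow N by (intro mult_mono) simp_all
    moreover have "(\<bar>l m\<bar> + N) * N = l m * N + 1 * N\<^sup>2" "2 * N ^ 3 * l m = l m * N ^ 3 + l m * N ^ 3"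
      using lm by (simp_all add: algebra_simps power2_eq_square)
    ultimately show ?thesis by linarith
  qed
  finally have z: "- (2 * N ^ 3 * l m) \<le> (e m \<bullet> (hess u x0 *v e m)) * g (0, 1, 0)" by linarith
  have nP: "norm (pvec g) \<le> N" using norm_pvec_le[OF g] N by simp
  have "pvec g \<bullet> (third u x0 (e m) *v e m) = - (l m * p1 (pvec g)) + \<alpha> m (y1 (pvec g))"
    unfolding third_symmetric[of "pvec g" "e m"] quadratic_third max_first ..
  moreover have "\<bar>\<alpha> m (y1 (pvec g))\<bar> \<le> 4 * N ^ 3 * l m"
  proof -
    have "\<bar>\<alpha> m (y1 (pvec g))\<bar> \<le> N * (4 * N * l m * norm (pvec g))"
      by (rule order_trans[OF \<alpha>_le]) (intro mult_left_mono norm_y1; use N in simp)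
    also have "\<dots> \<le> N * (4 * N * l m * N)" using nP N lm by (intro mult_left_mono) simp_all
    finally show ?thesis by (simp add: power3_eq_cube mult_ac)
  qed
  ultimately have p: "- (l m * p1 (pvec g)) - 4 * N ^ 3 * l m \<le> pvec g \<bullet> (third u x0 (e m) *v e m)" by linarith
  show ?thesis using q z p unfolding y2_split[OF g(1)] by linarith
qed

definition D\<alpha> :: "'n \<Rightarrow> real"
  where "D\<alpha> j = e j \<bullet> (ddA (y1 (e m)) (y1 (e m)) *v e j) + \<alpha> j (y2 (e m))"

text \<open>Regularity applies to the orthogonal pair \<open>e j\<close>, \<open>e m\<close>. For
  \<open>j = m\<close> it says nothing, and the loss \<open>N (l m)^2\<close> is later paid by
  \<open>f m * (l m)^2 \<le> s\<close>.\<close>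

lemma D\<alpha>_lower:
  "- ((if j = m then N else 0) * (l m)\<^sup>2) - 21 * N ^ 3 * l m - l m * p1 (pvec (\<alpha> j)) \<le> D\<alpha> j"
proof -
  have bd: "\<bar>e j \<bullet> (ddA v w *v e j)\<bar> \<le> N * norm v * norm w" for v w
    using frame_quadratic_le[OF e, of j "ddA v w" j] A2N[of v w] by linarith
  have "(if j = m then - N else 0) \<le> e j \<bullet> (ddA (0, 0, e m) (0, 0, e m) *v e j)"
  proof (cases "j = m")
    case True
    have "\<bar>e j \<bullet> (ddA (0, 0, e m) (0, 0, e m) *v e j)\<bar> \<le> N"
      using bd[of "(0, 0, e m)" "(0, 0, e m)"] frame_norm[OF e, of m] by (simp add: norm_Pair)
    then show ?thesis using True by simp
  next
    case False
    then show ?thesis using regA[of "e j" "e m"] e by (simp add: frame_def)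
  qed
  from second_derivative_lower[OF linear_\<alpha>[of j] \<alpha>_le linear_quadratic_form[OF linear_ddA(1)] linear_quadratic_form[OF linear_ddA(2)] bd this]
  show ?thesis unfolding D\<alpha>_def by (simp add: mult.commute if_distrib[of "\<lambda>c. _ * c"] split: if_splits)
qed

lemma b2_lower: "- (21 * N ^ 3 * l m) - l m * p1 (pvec dB) \<le> b2 (e m)"
  using second_derivative_lower[OF linear_dB B1N linear_ddB B2N convB] unfolding b2_def by simp

lemma fourth_commute: "e m \<bullet> (fourth u x0 (e j) *v e m) = e j \<bullet> (fourth u x0 (e m) *v e j)"
  unfolding inner_fourth[OF x0] by (rule d4_commute[OF x0])

text \<open>The fourth derivatives of \<open>u\<close> cancel by symmetry, so exchanging the two
  directions costs only second derivatives of \<open>A\<close> along the solution.\<close>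

lemma W2_commute:
  "e m \<bullet> (W2 (e j) *v e m) = e j \<bullet> (W2 (e m) *v e j) + D\<alpha> j - (e m \<bullet> (ddA (y1 (e j)) (y1 (e j)) *v e m) + \<alpha> m (y2 (e j)))"
  unfolding W2_def D\<alpha>_def \<alpha>_def matrix_vector_mult_diff_rdistrib matrix_vector_mult_add_rdistrib inner_diff_right inner_add_right
    fourth_commute by simp

text \<open>Third derivatives are not bounded individually, but their trace against the gradient of
  \<open>F\<close> is, by the differentiated equation.\<close>

lemma sum_third: "\<bar>\<Sum>j\<in>UNIV. f j * (e j \<bullet> (third u x0 q *v e j))\<bar> \<le> 4 * N\<^sup>2 * l m * norm q * (1 + T)"
proof -
  have y: "N * norm (y1 q) \<le> 4 * N\<^sup>2 * l m * norm q"
    using mult_left_mono[OF norm_y1[of q], of N] N by (simp add: power2_eq_square mult_ac)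
  have "(\<Sum>j\<in>UNIV. f j * (e j \<bullet> (third u x0 q *v e j))) = dB (y1 q) + (\<Sum>j\<in>UNIV. f j * \<alpha> j (y1 q))"
    unfolding quadratic_third by (simp add: distrib_left sum.distrib first_order)
  moreover have "\<bar>dB (y1 q)\<bar> \<le> 4 * N\<^sup>2 * l m * norm q" using B1N[of "y1 q"] y by linarith
  moreover have "\<bar>\<Sum>j\<in>UNIV. f j * \<alpha> j (y1 q)\<bar> \<le> (\<Sum>j\<in>UNIV. f j * (4 * N\<^sup>2 * l m * norm q))"
  proof (rule order_trans[OF sum_abs sum_mono])
    show "\<bar>f j * \<alpha> j (y1 q)\<bar> \<le> f j * (4 * N\<^sup>2 * l m * norm q)" for j
      using \<alpha>_le[of j "y1 q"] y f_pos[of j] by (simp add: abs_mult)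
  qed
  moreover have "(\<Sum>j\<in>UNIV. f j * (4 * N\<^sup>2 * l m * norm q)) = T * (4 * N\<^sup>2 * l m * norm q)"
    by (simp add: T_def sum_distrib_right)
  ultimately show ?thesis by (simp add: algebra_simps)
qed

text \<open>The contribution of the rotation, with the sign that makes it a gain for suitable
  \<open>z\<close>.\<close>

definition Q :: "('n \<Rightarrow> real) \<Rightarrow> real"
  where "Q z = (\<Sum>i\<in>UNIV. (f i - f m) * (4 * z i * \<omega> i - 2 * (z i)\<^sup>2 * (l m - l i)))"

text \<open>Weighting \<open>max_second\<close> by \<open>f\<close> and exchanging directions
  produces the equation differentiated twice along \<open>e m\<close>, to which
  \<open>second_order\<close> applies. Errors are multiples of \<open>l m * (1 + T)\<close>, or of
  \<open>s\<close> when they carry the square of an eigenvalue.\<close>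

lemma Lop_le:
  assumes z: "z m = 0"
  shows "l m * Lop p1 p2 \<le> l m * (\<Sum>j\<in>UNIV. f j * (p1 (e j))\<^sup>2) - Q z + 45 * N ^ 3 * l m * (1 + T) + 4 * N * s"
proof -
  define c where "c = N ^ 3 * l m"
  have c: "c \<ge> 1" unfolding c_def using mult_mono[OF N_pow(3) lm] N by simp
  have cN: "N ^ 3 \<le> c" unfolding c_def using N lm mult_left_mono[of 1 "l m" "N^3"] by simp
  have up: "e m \<bullet> (ddA (y1 (e j)) (y1 (e j)) *v e m) + (e j \<bullet> (hess u x0 *v e j)) * \<alpha> m (0, 1, 0) \<le> 3 * N * (l j)\<^sup>2 + 20 * c" for j
  proof -
    have "e m \<bullet> (ddA (y1 (e j)) (y1 (e j)) *v e m) \<le> N * norm (y1 (e j)) * norm (y1 (e j))"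
      using frame_quadratic_le[OF e, of m "ddA (y1 (e j)) (y1 (e j))" m] A2N[of "y1 (e j)" "y1 (e j)"] by linarith
    also have "\<dots> \<le> N * (3 * N + \<bar>l j\<bar>) * (3 * N + \<bar>l j\<bar>)"
      using norm_y1_e[of j] N by (intro mult_mono) simp_all
    also have "\<dots> \<le> N * (18 * N\<^sup>2 + 2 * (l j)\<^sup>2)"
    proof -
      have "0 \<le> (3 * N - \<bar>l j\<bar>)\<^sup>2" by simp
      then have "(3 * N + \<bar>l j\<bar>) * (3 * N + \<bar>l j\<bar>) \<le> 18 * N\<^sup>2 + 2 * (l j)\<^sup>2"
        by (simp add: power2_eq_square algebra_simps)
      then show ?thesis using N by (simp add: mult.assoc)
    qed
    finally have 1: "e m \<bullet> (ddA (y1 (e j)) (y1 (e j)) *v e m) \<le> 18 * N ^ 3 + 2 * N * (l j)\<^sup>2"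
      by (simp add: algebra_simps power2_eq_square power3_eq_cube)
    have "\<bar>(e j \<bullet> (hess u x0 *v e j)) * \<alpha> m (0, 1, 0)\<bar> \<le> (\<bar>l j\<bar> + N) * N"
      unfolding abs_mult using abs_hess_e[of j] \<alpha>_le[of m "(0, 1, 0)"] N by (intro mult_mono) (simp_all add: norm_Pair)
    \<comment> \<open>The bracket equals \<open>(l j)^2 + N\<close>; the surplus \<open>N\<close>
      that comes from \<open>\<bar>l j\<bar> \<le> (l j)^2 + 1\<close> is paid by
      \<open>N ^ 3\<close>.\<close>
    also have "\<dots> \<le> ((l j)\<^sup>2 + 1 + (N - 1) + N - N) * N + N ^ 3"
    proof -
      have "0 \<le> (\<bar>l j\<bar> - 1)\<^sup>2" by simp
      then have "2 * \<bar>l j\<bar> \<le> (l j)\<^sup>2 + 1" by (simp add: power2_diff)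
      moreover have "0 \<le> \<bar>l j\<bar>" by simp
      ultimately have "\<bar>l j\<bar> \<le> (l j)\<^sup>2 + 1" by linarith
      then have "(\<bar>l j\<bar> + N) * N \<le> ((l j)\<^sup>2 + 1 + N) * N" using N by (intro mult_right_mono) simp_all
      moreover have "N \<le> N ^ 3" by (rule N_pow)
      ultimately show ?thesis by (simp add: algebra_simps)
    qed
    finally have "(e j \<bullet> (hess u x0 *v e j)) * \<alpha> m (0, 1, 0) \<le> N * (l j)\<^sup>2 + N\<^sup>2 + N ^ 3"
      by (simp add: algebra_simps power2_eq_square)
    with 1 N_pow(2) cN show ?thesis by linarith
  qed
  have nP: "norm (pvec (\<alpha> m)) \<le> N" using norm_pvec_le[OF linear_\<alpha> \<alpha>_le] N by simp
  have t: "(\<Sum>j\<in>UNIV. f j * (e j \<bullet> (third u x0 (pvec (\<alpha> m)) *v e j))) \<le> 4 * c * (1 + T)"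
  proof -
    have "4 * N\<^sup>2 * l m * norm (pvec (\<alpha> m)) * (1 + T) \<le> 4 * N\<^sup>2 * l m * N * (1 + T)"
      using nP N lm T_pos by (intro mult_right_mono mult_left_mono) simp_all
    then show ?thesis using sum_third[of "pvec (\<alpha> m)"] by (simp add: c_def power2_eq_square power3_eq_cube mult_ac)
  qed
  have "(\<Sum>j\<in>UNIV. f j * (e m \<bullet> (W2 (e j) *v e m))) \<le> (\<Sum>j\<in>UNIV. f j * (l m * ((p1 (e j))\<^sup>2 - p2 (e j))))"
    by (intro sum_mono mult_left_mono max_second) (simp add: f_pos less_imp_le)
  also have "\<dots> = l m * (\<Sum>j\<in>UNIV. f j * (p1 (e j))\<^sup>2) - l m * (\<Sum>j\<in>UNIV. f j * p2 (e j))"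
    by (simp add: sum_distrib_left sum_subtractf[symmetric] algebra_simps)
  finally have 1: "(\<Sum>j\<in>UNIV. f j * (e m \<bullet> (W2 (e j) *v e m))) \<le>
    l m * (\<Sum>j\<in>UNIV. f j * (p1 (e j))\<^sup>2) - l m * (\<Sum>j\<in>UNIV. f j * p2 (e j))" .
  have "(\<Sum>j\<in>UNIV. f j * (e j \<bullet> (W2 (e m) *v e j)) + f j * (- ((if j = m then N else 0) * (l m)\<^sup>2) - 21 * c - l m * p1 (pvec (\<alpha> j)))
      - f j * (3 * N * (l j)\<^sup>2 + 20 * c) - f j * (e j \<bullet> (third u x0 (pvec (\<alpha> m)) *v e j)))
    \<le> (\<Sum>j\<in>UNIV. f j * (e m \<bullet> (W2 (e j) *v e m)))"
  proof (rule sum_mono)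
    fix j
    have D: "- ((if j = m then N else 0) * (l m)\<^sup>2) - 21 * c - l m * p1 (pvec (\<alpha> j)) \<le> D\<alpha> j"
      using D\<alpha>_lower[of j] by (simp add: c_def mult.assoc)
    have "e j \<bullet> (W2 (e m) *v e j) + (- ((if j = m then N else 0) * (l m)\<^sup>2) - 21 * c - l m * p1 (pvec (\<alpha> j)))
      - (3 * N * (l j)\<^sup>2 + 20 * c) - e j \<bullet> (third u x0 (pvec (\<alpha> m)) *v e j) \<le> e m \<bullet> (W2 (e j) *v e m)"
      unfolding W2_commute[of j] y2_split[OF linear_\<alpha>] third_symmetric[of "pvec (\<alpha> m)" "e j"]
      using D up[of j] by linarith
    from mult_left_mono[OF this less_imp_le[OF f_pos]]
    show "f j * (e j \<bullet> (W2 (e m) *v e j)) + f j * (- ((if j = m then N else 0) * (l m)\<^sup>2) - 21 * c - l m * p1 (pvec (\<alpha> j)))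
      - f j * (3 * N * (l j)\<^sup>2 + 20 * c) - f j * (e j \<bullet> (third u x0 (pvec (\<alpha> m)) *v e j)) \<le> f j * (e m \<bullet> (W2 (e j) *v e m))"
      by (simp only: right_diff_distrib distrib_left)
  qed
  moreover have "(\<Sum>j\<in>UNIV. f j * (- ((if j = m then N else 0) * (l m)\<^sup>2) - 21 * c - l m * p1 (pvec (\<alpha> j)))) =
    - (N * (f m * (l m)\<^sup>2)) - 21 * c * T - l m * (\<Sum>j\<in>UNIV. f j * p1 (pvec (\<alpha> j)))"
  proof -
    have "(\<Sum>j\<in>UNIV. f j * (- ((if j = m then N else 0) * (l m)\<^sup>2) - 21 * c - l m * p1 (pvec (\<alpha> j)))) =
      (\<Sum>j\<in>UNIV. (if j = m then - (N * (f m * (l m)\<^sup>2)) else 0) - 21 * c * f j - l m * (f j * p1 (pvec (\<alpha> j))))"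
      by (rule sum.cong) (auto simp: algebra_simps)
    then show ?thesis by (simp add: sum_subtractf T_def sum_distrib_left)
  qed
  moreover have "(\<Sum>j\<in>UNIV. f j * (3 * N * (l j)\<^sup>2 + 20 * c)) = 3 * N * s + 20 * c * T"
    by (simp add: s_def T_def sum_distrib_left sum.distrib[symmetric] algebra_simps)
  ultimately have 2: "(\<Sum>j\<in>UNIV. f j * (e j \<bullet> (W2 (e m) *v e j))) + (- (N * (f m * (l m)\<^sup>2)) - 21 * c * T - l m * (\<Sum>j\<in>UNIV. f j * p1 (pvec (\<alpha> j))))
      - (3 * N * s + 20 * c * T) - 4 * c * (1 + T) \<le> (\<Sum>j\<in>UNIV. f j * (e m \<bullet> (W2 (e j) *v e m)))"
    using t by (simp only: sum.distrib sum_subtractf)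
  have 3: "b2 (e m) + Q z \<le> (\<Sum>j\<in>UNIV. f j * (e j \<bullet> (W2 (e m) *v e j)))"
  proof -
    have "Q z = - (\<Sum>i\<in>UNIV. (f m - f i) * (4 * z i * \<omega> i - 2 * (z i)\<^sup>2 * (l m - l i)))"
      unfolding Q_def by (simp add: sum_negf[symmetric] algebra_simps)
    then show ?thesis using second_order[of z, OF z] by linarith
  qed
  have 4: "N * (f m * (l m)\<^sup>2) \<le> N * s" using f_le_s[of m] N by simp
  have 5: "- (21 * c) - l m * p1 (pvec dB) \<le> b2 (e m)" using b2_lower by (simp add: c_def mult.assoc)
  have "l m * Lop p1 p2 = l m * (\<Sum>j\<in>UNIV. f j * p2 (e j)) - l m * (\<Sum>j\<in>UNIV. f j * p1 (pvec (\<alpha> j))) - l m * p1 (pvec dB)"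
    by (simp add: Lop_def right_diff_distrib)
  \<comment> \<open>The coefficient of \<open>c * T\<close> is \<open>21 + 20 + 4\<close> from
    \<open>D\<alpha>_lower\<close>, \<open>up\<close> and \<open>t\<close>; that of \<open>c\<close>
    is \<open>21 + 4\<close> from \<open>b2_lower\<close> and \<open>t\<close>. The multiple of
    \<open>s\<close> is \<open>3 N\<close> from \<open>up\<close> plus \<open>N\<close> for the
    index \<open>m\<close>.\<close>
  also have "\<dots> \<le> l m * (\<Sum>j\<in>UNIV. f j * (p1 (e j))\<^sup>2) - Q z + (25 * c + 45 * c * T) + 4 * N * s"
    using 1 2 3 4 5 by (simp add: algebra_simps)
  also have "25 * c + 45 * c * T \<le> 45 * N ^ 3 * l m * (1 + T)"
    using c T_pos by (simp add: c_def algebra_simps)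
  finally show ?thesis by simp
qed

text \<open>For \<open>i\<close> with \<open>\<lambda>\<^sub>i \<ge> - \<lambda>\<^sub>m / 4\<close> the rotation absorbs the square of the gradient; otherwise \<open>\<lambda>\<^sub>i\<^sup>2\<close> is comparable
  to \<open>\<lambda>\<^sub>m\<^sup>2\<close>.\<close>

lemma Lop_le':
  "l m * Lop p1 p2 \<le> l m * (f m * (\<Sum>j\<in>UNIV. (p1 (e j))\<^sup>2) + (\<Sum>j\<in>UNIV. if l j < - l m / 4 then f j * (p1 (e j))\<^sup>2 else 0)
    + 192 * N ^ 4 * T + 45 * N ^ 3 * (1 + T)) + 4 * N * s"
proof -
  \<comment> \<open>Exactly the indices covered neither by \<open>f i \<le> f m\<close> nor by
    \<open>l i < - l m / 4\<close>. On them \<open>z i\<close> has denominator \<open>l m\<close>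
    instead of \<open>l m - l i\<close>, which is safe and loses only a factor.\<close>
  define J where "J = {i. i \<noteq> m \<and> f m \<le> f i \<and> - l m / 4 \<le> l i}"
  define z where "z i = (if i \<in> J then \<omega> i / l m else 0)" for i
  have zm: "z m = 0" by (simp add: z_def J_def)
  have l0: "l m > 0" using lm by simp
  have N4: "N ^ 4 \<ge> 0" using N by simp
  have summand: "l m * (f j * (p1 (e j))\<^sup>2) - (f j - f m) * (4 * z j * \<omega> j - 2 * (z j)\<^sup>2 * (l m - l j)) \<le>
    l m * (f m * (p1 (e j))\<^sup>2 + (if l j < - l m / 4 then f j * (p1 (e j))\<^sup>2 else 0) + 192 * N ^ 4 * f j)" for j
  proof (cases "j \<in> J")
    case False
    then have z0: "z j = 0" by (simp add: z_def)
    have "f j * (p1 (e j))\<^sup>2 \<le> f m * (p1 (e j))\<^sup>2 + (if l j < - l m / 4 then f j * (p1 (e j))\<^sup>2 else 0) + 192 * N ^ 4 * f j"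
    proof (cases "f j \<le> f m")
      case True
      then have "f j * (p1 (e j))\<^sup>2 \<le> f m * (p1 (e j))\<^sup>2" by (intro mult_right_mono) simp_all
      moreover have "0 \<le> (if l j < - l m / 4 then f j * (p1 (e j))\<^sup>2 else 0)" using f_pos[of j] by simp
      moreover have "0 \<le> 192 * N ^ 4 * f j" using f_pos[of j] N4 by simp
      ultimately show ?thesis by linarith
    next
      case 2: False
      then have "j \<noteq> m" by auto
      then have "l j < - l m / 4" using False 2 by (auto simp: J_def)
      then show ?thesis using f_pos[of j] f_pos[of m] N4 by simp
    qed
    then show ?thesis using l0 by (simp add: z0)
  next
    case True
    then have J: "j \<noteq> m" "f m \<le> f j" "- l m / 4 \<le> l j" by (auto simp: J_def)
    \<comment> \<open>The error in replacing \<open>\<omega> j\<close> by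
      \<open>- l m * p1 (e j)\<close>, measured in units of \<open>l m\<close>. Symmetry of third
      derivatives and \<open>max_first\<close> leave only first derivatives of \<open>A\<close>,
      whence \<open>\<bar>b\<bar> \<le> 8 N^2\<close>.\<close>
    define b where "b = \<omega> j / l m + p1 (e j)"
    have "e m \<bullet> (W1 (e m) *v e j) = e m \<bullet> (third u x0 (e m) *v e j) - e m \<bullet> (dA (y1 (e m)) *v e j)"
      "e j \<bullet> (W1 (e m) *v e m) = e j \<bullet> (third u x0 (e m) *v e m) - e j \<bullet> (dA (y1 (e m)) *v e m)"
      by (simp_all add: W1_def matrix_vector_mult_diff_rdistrib inner_diff_right)
    moreover have "e j \<bullet> (third u x0 (e m) *v e m) = e m \<bullet> (third u x0 (e j) *v e m)" by (rule third_symmetric)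
    moreover have "e m \<bullet> (third u x0 (e m) *v e j) = e j \<bullet> (third u x0 (e m) *v e m)"
      unfolding inner_third[OF x0] by (rule d3_commute[OF x0])
    moreover have "e m \<bullet> (third u x0 (e j) *v e m) = - (l m * p1 (e j)) + \<alpha> m (y1 (e j))"
      unfolding quadratic_third max_first ..
    ultimately have "\<omega> j + l m * p1 (e j) = \<alpha> m (y1 (e j)) - (e m \<bullet> (dA (y1 (e m)) *v e j) + e j \<bullet> (dA (y1 (e m)) *v e m)) / 2"
      unfolding \<omega>_def by (simp add: field_simps)
    moreover have "\<bar>e i \<bullet> (dA (y1 (e k)) *v e i')\<bar> \<le> 4 * N\<^sup>2 * l m" for i i' k
    proof -
      have "\<bar>e i \<bullet> (dA (y1 (e k)) *v e i')\<bar> \<le> N * norm (y1 (e k))"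
        using frame_quadratic_le[OF e, of i "dA (y1 (e k))" i'] A1N[of "y1 (e k)"] by linarith
      also have "\<dots> \<le> N * (4 * N * l m * 1)" using norm_y1[of "e k"] frame_norm[OF e, of k] N by (intro mult_left_mono) simp_all
      finally show ?thesis by (simp add: power2_eq_square mult_ac)
    qed
    note bd = this
    have "\<bar>\<alpha> m (y1 (e j))\<bar> \<le> 4 * N\<^sup>2 * l m" unfolding \<alpha>_def by (rule bd)
    moreover have "\<bar>x - (a + b) / 2\<bar> \<le> 2 * C" if "\<bar>x\<bar> \<le> C" "\<bar>a\<bar> \<le> C" "\<bar>b\<bar> \<le> C" for x a b C :: real
      using that by (simp add: abs_le_iff field_simps)
    ultimately have "\<bar>\<omega> j + l m * p1 (e j)\<bar> \<le> 2 * (4 * N\<^sup>2 * l m)"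
      using bd[of m m j] bd[of j m m] by metis
    then have "\<bar>\<omega> j + l m * p1 (e j)\<bar> \<le> 8 * N\<^sup>2 * l m" by simp
    moreover have "b = (\<omega> j + l m * p1 (e j)) / l m" using l0 by (simp add: b_def add_divide_distrib)
    ultimately have "\<bar>b\<bar> \<le> 8 * N\<^sup>2" using l0 by (simp add: divide_le_eq)
    then have "b\<^sup>2 \<le> (8 * N\<^sup>2)\<^sup>2" using power_mono[of "\<bar>b\<bar>" "8 * N\<^sup>2" 2] by simp
    then have b: "b\<^sup>2 \<le> 64 * N ^ 4" by (simp add: power_mult_distrib)
    define \<nu> where "\<nu> = \<omega> j / l m"
    have \<nu>: "z j = \<nu>" "\<omega> j = \<nu> * l m" using True l0 by (simp_all add: z_def \<nu>_def)
    \<comment> \<open>The threshold \<open>- l m / 4\<close> leaves the coefficient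
      \<open>4 - 5/2 = 3/2\<close> of the squared speed. Being larger than 1, it covers all of
      \<open>(p1 (e j))^2\<close> up to \<open>3 b^2 \<le> 192 N^4\<close>.\<close>
    have "0 \<le> (p1 (e j) - 3 * b)\<^sup>2" by simp
    then have "(p1 (e j))\<^sup>2 - 3 * b\<^sup>2 \<le> (3 / 2) * (b - p1 (e j))\<^sup>2"
      by (simp add: power2_eq_square algebra_simps)
    then have p: "(p1 (e j))\<^sup>2 - 192 * N ^ 4 \<le> (3 / 2) * \<nu>\<^sup>2" using b by (simp add: b_def \<nu>_def)
    have "l m * ((3 / 2) * \<nu>\<^sup>2) = 4 * \<nu> * (\<nu> * l m) - 2 * \<nu>\<^sup>2 * (l m + l m / 4)"
      by (simp add: power2_eq_square algebra_simps)
    also have "\<dots> \<le> 4 * \<nu> * (\<nu> * l m) - 2 * \<nu>\<^sup>2 * (l m - l j)"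
    proof -
      have "2 * \<nu>\<^sup>2 * (l m - l j) \<le> 2 * \<nu>\<^sup>2 * (l m + l m / 4)" using J(3) by (intro mult_left_mono) simp_all
      then show ?thesis by linarith
    qed
    finally have "l m * ((p1 (e j))\<^sup>2 - 192 * N ^ 4) \<le> 4 * z j * \<omega> j - 2 * (z j)\<^sup>2 * (l m - l j)"
      unfolding \<nu> using mult_left_mono[OF p, of "l m"] l0 by linarith
    then have "(f j - f m) * (l m * ((p1 (e j))\<^sup>2 - 192 * N ^ 4)) \<le> (f j - f m) * (4 * z j * \<omega> j - 2 * (z j)\<^sup>2 * (l m - l j))"
      using J(2) by (intro mult_left_mono) simp_all
    moreover have "l m * (f j * (p1 (e j))\<^sup>2) - (f j - f m) * (l m * ((p1 (e j))\<^sup>2 - 192 * N ^ 4))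
       = l m * (f m * (p1 (e j))\<^sup>2 + 192 * N ^ 4 * f j - 192 * N ^ 4 * f m)"
      by (simp add: algebra_simps)
    moreover have "\<dots> \<le> l m * (f m * (p1 (e j))\<^sup>2 + (if l j < - l m / 4 then f j * (p1 (e j))\<^sup>2 else 0) + 192 * N ^ 4 * f j)"
      using l0 f_pos[of m] N4 J(3) by (intro mult_left_mono) simp_all
    ultimately show ?thesis by linarith
  qed
  have "l m * (\<Sum>j\<in>UNIV. f j * (p1 (e j))\<^sup>2) - Q z =
    (\<Sum>j\<in>UNIV. l m * (f j * (p1 (e j))\<^sup>2) - (f j - f m) * (4 * z j * \<omega> j - 2 * (z j)\<^sup>2 * (l m - l j)))"
    by (simp add: Q_def sum_distrib_left sum_subtractf)
  also have "\<dots> \<le> (\<Sum>j\<in>UNIV. l m * (f m * (p1 (e j))\<^sup>2 + (if l j < - l m / 4 then f j * (p1 (e j))\<^sup>2 else 0) + 192 * N ^ 4 * f j))"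
    by (rule sum_mono) (rule summand)
  also have "\<dots> = l m * (f m * (\<Sum>j\<in>UNIV. (p1 (e j))\<^sup>2) + (\<Sum>j\<in>UNIV. if l j < - l m / 4 then f j * (p1 (e j))\<^sup>2 else 0) + 192 * N ^ 4 * T)"
    by (simp add: T_def sum_distrib_left sum.distrib[symmetric])
  finally show ?thesis using Lop_le[of z, OF zm] by (simp add: algebra_simps)
qed

end

section \<open>The linearised operator on half the squared gradient\<close>

lemma norm_add_power2_ge: "(norm (a + b :: 'a::real_inner))\<^sup>2 \<ge> (norm a)\<^sup>2 / 2 - (norm b)\<^sup>2"
proof -
  have "0 \<le> (a + 2 *\<^sub>R b) \<bullet> (a + 2 *\<^sub>R b)" by simp
  then show ?thesis
    unfolding power2_norm_eq_inner by (simp add: inner_add_left inner_add_right inner_commute[of b a])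
qed

context interior_point
begin

lemma Lop_combine: "Lop (\<lambda>q. a * h1 q + b * k1 q) (\<lambda>q. a * h2 q + b * k2 q) = a * Lop h1 h2 + b * Lop k1 k2"
  unfolding Lop_def by (simp add: distrib_left sum.distrib sum_distrib_left right_diff_distrib mult.left_commute)

definition hg1 :: "real^'n \<Rightarrow> real" where "hg1 q = grad u x0 \<bullet> (hess u x0 *v q)"
definition hg2 :: "real^'n \<Rightarrow> real"
  where "hg2 q = (norm (hess u x0 *v q))\<^sup>2 + grad u x0 \<bullet> (third u x0 q *v q)"

lemma jet2_half_grad_square: "jet2 (\<lambda>t. (grad u (x0 + t *\<^sub>R q) \<bullet> grad u (x0 + t *\<^sub>R q)) / 2) (hg1 q) (hg2 q)"
proof -
  have "jet2 (\<lambda>t. (1 / 2) * (grad u (x0 + t *\<^sub>R q) \<bullet> grad u (x0 + t *\<^sub>R q)))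
    ((1 / 2) * (2 * hg1 q)) ((1 / 2) * (2 * hg2 q))"
    using jet2_linear[OF bounded_linear_mult_right[of "1 / 2 :: real"] jet2_inner[OF jet2_grad jet2_grad, OF x0 x0, of q q]]
    by (simp add: hg1_def hg2_def inner_commute power2_norm_eq_inner algebra_simps)
  then show ?thesis by simp
qed

lemma abs_hg1: "\<bar>hg1 (e j)\<bar> \<le> N * (\<bar>l j\<bar> + N)"
proof -
  have "norm (hess u x0 *v e j) \<le> \<bar>l j\<bar> + N"
    unfolding hess_eq matrix_vector_mult_add_rdistrib l
    using norm_triangle_ineq[of "l j *\<^sub>R e j" "A x0 (u x0) (grad u x0) *v e j"] norm_Av[of "e j"] frame_norm[OF e, of j] by simp
  then show ?thesis unfolding hg1_def
    using Cauchy_Schwarz_ineq2[of "grad u x0" "hess u x0 *v e j"] gradN N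
    by (meson mult_mono norm_ge_zero order_trans zero_le_one)
qed

text \<open>The third derivatives contracted with the gradient are the equation differentiated along
  the gradient. Its Hessian slot is cancelled by the first order terms of \<open>Lop\<close>,
  leaving the bounded vector \<open>w\<close>; the squared Hessian terms supply
  \<open>s / 2\<close>.\<close>

lemma Lop_half_grad_square: "s / 2 - 3 * N ^ 3 * (1 + T) \<le> Lop hg1 hg2"
proof -
  let ?g = "grad u x0"
  let ?h = "hess u x0 *v ?g"
  define w where "w = (?g, dir_deriv u ?g x0, 0 :: real^'n)"
  have y: "y1 ?g = w + (0, 0, ?h)" by (simp add: w_def point1_def)
  have hg: "hg1 q = q \<bullet> ?h" for q unfolding hg1_def by (rule hess_symmetric[OF x0])
  have "(\<Sum>j\<in>UNIV. f j * (?g \<bullet> (third u x0 (e j) *v e j))) = dB (y1 ?g) + (\<Sum>j\<in>UNIV. f j * \<alpha> j (y1 ?g))"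
    unfolding third_symmetric[of ?g] quadratic_third by (simp add: distrib_left sum.distrib first_order)
  then have "Lop hg1 hg2 = (\<Sum>j\<in>UNIV. f j * (norm (hess u x0 *v e j))\<^sup>2) + dB w + (\<Sum>j\<in>UNIV. f j * \<alpha> j w)"
    unfolding Lop_def hg inner_pvec[OF linear_\<alpha>] inner_pvec[OF linear_dB] y linear_add[OF linear_dB] linear_add[OF linear_\<alpha>]
    by (simp add: hg2_def distrib_left sum.distrib)
  moreover have nw: "norm w \<le> 2 * N\<^sup>2"
  proof -
    have "norm w \<le> norm ?g + N * norm ?g"
      unfolding w_def using norm_triple_le[of ?g "dir_deriv u ?g x0" "0 :: real^'n"] abs_du[of ?g] by simp
    also have "\<dots> \<le> N + N * N" using gradN N by (intro add_mono mult_left_mono) simp_all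
    also have "\<dots> \<le> 2 * N\<^sup>2" using N by (simp add: power2_eq_square)
    finally show ?thesis .
  qed
  then have Nw: "N * norm w \<le> 2 * N ^ 3"
    using mult_left_mono[OF nw, of N] N by (simp add: power2_eq_square power3_eq_cube)
  moreover have "- (2 * N ^ 3) \<le> dB w" using B1N[of w] Nw by linarith
  moreover have "(\<Sum>j\<in>UNIV. f j * - (2 * N ^ 3)) \<le> (\<Sum>j\<in>UNIV. f j * \<alpha> j w)"
  proof (intro sum_mono mult_left_mono)
    show "- (2 * N ^ 3) \<le> \<alpha> j w" for j using \<alpha>_le[of j w] Nw by linarith
  qed (simp add: f_pos less_imp_le)
  moreover have "(\<Sum>j\<in>UNIV. f j * ((l j)\<^sup>2 / 2 - N ^ 3)) \<le> (\<Sum>j\<in>UNIV. f j * (norm (hess u x0 *v e j))\<^sup>2)"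
  proof (intro sum_mono mult_left_mono)
    fix j
    have "norm (A x0 (u x0) (grad u x0) *v e j) \<le> N" using norm_Av[of "e j"] frame_norm[OF e, of j] by simp
    then have "(norm (A x0 (u x0) (grad u x0) *v e j))\<^sup>2 \<le> N\<^sup>2" by (rule power_mono) simp
    then show "(l j)\<^sup>2 / 2 - N ^ 3 \<le> (norm (hess u x0 *v e j))\<^sup>2"
      using norm_add_power2_ge[of "l j *\<^sub>R e j" "A x0 (u x0) (grad u x0) *v e j"] frame_norm[OF e, of j] N_pow(2)
      unfolding hess_eq matrix_vector_mult_add_rdistrib l by simp
  qed (simp add: f_pos less_imp_le)
  moreover have "(\<Sum>j\<in>UNIV. f j * ((l j)\<^sup>2 / 2 - N ^ 3)) = s / 2 - N ^ 3 * T"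
    by (simp add: s_def T_def right_diff_distrib sum_subtractf sum_divide_distrib sum_distrib_left mult.commute)
  moreover have "(\<Sum>j\<in>UNIV. f j * - (2 * N ^ 3)) = - (2 * N ^ 3 * T)"
    unfolding T_def by (simp add: sum_distrib_left sum_negf mult_ac)
  moreover have "N ^ 3 \<ge> 0" using N by simp
  moreover have "3 * N ^ 3 * (1 + T) = 3 * N ^ 3 + 3 * (N ^ 3 * T)" "2 * N ^ 3 * T = 2 * (N ^ 3 * T)"
    by (simp_all add: algebra_simps)
  ultimately show ?thesis by linarith
qed

end

text \<open>The factor \<open>\<tau>\<close> lets half of the gain from \<open>\<tau> |Du|\<^sup>2 / 2\<close> pay for the square of its gradient; the exponent absorbs
  \<open>3 N\<^sup>2 |D\<^sub>jv|\<close> by Young's inequality at the cost of \<open>\<epsilon> / 2\<close>; and \<open>\<kappa>\<close> beats the accumulated error \<open>240 N\<^sup>4 (1 + T)\<close>.\<close>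

definition test_tau :: "real \<Rightarrow> real \<Rightarrow> real" where "test_tau n N = 1 / (24 * n * N ^ 4)"
definition test_exponent :: "real \<Rightarrow> real \<Rightarrow> real" where "test_exponent N \<epsilon> = 9 * N ^ 4 / (2 * \<epsilon>)"
definition test_kappa :: "real \<Rightarrow> real \<Rightarrow> real"
  where "test_kappa N \<epsilon> = 482 * N ^ 4 * exp (2 * test_exponent N \<epsilon> * N) / (test_exponent N \<epsilon> * \<epsilon>)"

definition test_function :: "real \<Rightarrow> real \<Rightarrow> real \<Rightarrow> (real^'n \<Rightarrow> real) \<Rightarrow> (real^'n \<Rightarrow> real) \<Rightarrow> real^'n \<Rightarrow> real"
  where "test_function n N \<epsilon> u v x = test_tau n N * ((grad u x \<bullet> grad u x) / 2) +
    test_kappa N \<epsilon> * exp (test_exponent N \<epsilon> * (v x - u x))"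

text \<open>Two thresholds for \<open>\<tau> * l m\<close>, added: the first subdues the terms
  proportional to \<open>s / (l m)^2\<close>, the second contradicts the uniformly elliptic
  alternative.\<close>

definition max_bound :: "real \<Rightarrow> real \<Rightarrow> real \<Rightarrow> real"
  where "max_bound n N \<epsilon> = (let k = test_exponent N \<epsilon>; \<kappa> = test_kappa N \<epsilon>; E = k * exp (2 * k * N);
    M = 3 * N ^ 4 + 3 * (\<kappa> * (E * (2 * N)))\<^sup>2 in
    (8 * ((n + 16) * M + 4 * N) + 8 * ((240 * N ^ 4 + \<kappa> * E * (6 * N ^ 3)) * (1 + 1 / \<epsilon>)) / \<epsilon>) / test_tau n N)"

section \<open>The barrier \<open>ubar - u\<close> and the bound for the top eigenvalue\<close>

locale interior_test = interior_point \<Gamma> F \<Omega> u A B x0 e l m N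
  for \<Gamma> :: "(real^'n^'n) set" and F \<Omega> u A B x0 e l m N +
  fixes ubar :: "real^'n \<Rightarrow> real" and \<epsilon> n P :: real
  assumes n_def: "n = real CARD('n)" and ubar: "Ck_on 2 \<Omega> ubar" and diff_le: "\<bar>ubar x0 - u x0\<bar> \<le> 2 * N" and P: "P \<le> N" "norm (grad u x0) \<le> P" "norm (grad ubar x0) \<le> P"
    and \<epsilon>: "\<epsilon> > 0"
    and A2N': "\<And>p v w. norm p \<le> P \<Longrightarrow>
      norm (dir_deriv (dir_deriv (\<lambda>(x, z, p). A x z p) v) w (x0, u x0, p)) \<le> N * norm v * norm w"
    and regA': "\<And>p \<xi> \<eta>. \<xi> \<bullet> \<eta> = 0 \<Longrightarrow>
      0 \<le> \<xi> \<bullet> (dir_deriv (dir_deriv (\<lambda>(x, z, p). A x z p) (0, 0, \<eta>)) (0, 0, \<eta>) (x0, u x0, p) *v \<xi>)"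
    and convB': "convex_on UNIV (B x0 (u x0))"
    and max: "\<And>x. x \<in> \<Omega> \<Longrightarrow> (e m \<bullet> (aug_hess A u x *v e m)) * exp (test_function n N \<epsilon> u ubar x)
      \<le> l m * exp (test_function n N \<epsilon> u ubar x0)"
begin

sublocale V: smooth_function \<Omega> ubar
  using \<Omega> ubar by unfold_locales

definition d :: "real^'n" where "d = grad ubar x0 - grad u x0"
text \<open>The linearised operator on \<open>ubar - u\<close> without the second order remainders
  of \<open>A\<close> and \<open>B\<close>. The pointwise argument needs a lower bound for it,
  supplemented by ellipticity when that bound is only 0.\<close>

definition gap :: real
  where "gap = G r0 \<bullet> (aug_hess_wrt A u ubar x0 - r0) - (B x0 (u x0) (grad ubar x0) - B x0 (u x0) (grad u x0))"
definition v1 :: "real^'n \<Rightarrow> real" where "v1 q = q \<bullet> d"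
definition v2 :: "real^'n \<Rightarrow> real" where "v2 q = q \<bullet> ((hess ubar x0 - hess u x0) *v q)"

lemma norm_d: "norm d \<le> 2 * N"
  unfolding d_def using norm_triangle_ineq4[of "grad ubar x0" "grad u x0"] P by linarith

lemma jet2_v: "jet2 (\<lambda>t. ubar (x0 + t *\<^sub>R q) - u (x0 + t *\<^sub>R q)) (v1 q) (v2 q)"
  unfolding v1_def v2_def d_def inner_diff_right matrix_vector_mult_diff_rdistrib
  by (intro jet2_diff V.jet2_u jet2_u x0)

text \<open>Regularity controls the second order remainder of \<open>A\<^sub>j\<^sub>j\<close> by the component of \<open>d\<close> along \<open>e\<^sub>j\<close>.\<close>

lemma A_remainder:
  "- (3 * N\<^sup>2 * \<bar>e j \<bullet> d\<bar>) \<le> e j \<bullet> (A x0 (u x0) (grad ubar x0) *v e j) - e j \<bullet> (A x0 (u x0) (grad u x0) *v e j) - \<alpha> j (0, 0, d)"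
proof -
  let ?A = "\<lambda>(x, z, p). A x z p"
  define Y :: "((real^'n) \<times> real \<times> (real^'n)) set" where "Y = \<Omega> \<times> UNIV \<times> UNIV"
  have Y: "open Y" "Ck_on (Suc (Suc 0)) Y ?A" using openY A2 by (simp_all only: Y_def numeral_2_eq_2)
  define y where "y t = point u x0 + t *\<^sub>R (0, 0, d)" for t :: real
  have yt: "y t = (x0, u x0, grad u x0 + t *\<^sub>R d)" for t by (simp add: y_def point_def)
  have yY: "y t \<in> Y" for t using x0 by (simp add: yt Y_def)
  have d1: "(?A has_derivative (\<lambda>v. dir_deriv ?A v y)) (at y)" if "y \<in> Y" for y
    using Ck_on_SucD[OF Y that] by (rule dir_deriv_has_derivative)
  have d2: "(dir_deriv ?A v has_derivative (\<lambda>w. dir_deriv (dir_deriv ?A v) w y)) (at y)" if "y \<in> Y" for y v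
    using Ck_on_SucD[OF Y(1) Ck_on_dir_deriv[OF Y(2)] that] by (rule dir_deriv_has_derivative)
  have L: "bounded_linear (\<lambda>M :: real^'n^'n. e j \<bullet> (M *v e j))"
    by (rule bounded_linear_compose[OF bounded_linear_inner_right bounded_bilinear.bounded_linear_left[OF bounded_bilinear_matrix_vector]])
  define D where "D k t = (if k = 0 then e j \<bullet> (?A (y t) *v e j) else if k = 1 then e j \<bullet> (dir_deriv ?A (0, 0, d) (y t) *v e j)
    else e j \<bullet> (dir_deriv (dir_deriv ?A (0, 0, d)) (0, 0, d) (y t) *v e j))" for k :: nat and t
  have lin: "(h has_derivative h') (at (y t)) \<Longrightarrow> DERIV (\<lambda>t. e j \<bullet> (h (y t) *v e j)) t :> e j \<bullet> (h' (0, 0, d) *v e j)"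
    for h :: "(real^'n) \<times> real \<times> (real^'n) \<Rightarrow> real^'n^'n" and h' t
  proof -
    assume h: "(h has_derivative h') (at (y t))"
    have "((\<lambda>t. h (y t)) has_derivative (\<lambda>a. a *\<^sub>R h' (0, 0, d))) (at t)"
      unfolding y_def by (rule has_derivative_along_line) (use h in \<open>simp add: y_def\<close>)
    from bounded_linear.has_derivative[OF L this]
    have "((\<lambda>t. e j \<bullet> (h (y t) *v e j)) has_derivative (\<lambda>a. e j \<bullet> ((a *\<^sub>R h' (0, 0, d)) *v e j))) (at t)" .
    then show ?thesis
      by (simp add: has_field_derivative_def scaleR_matrix_vector_assoc[symmetric] mult_commute_abs)
  qed
  have "\<exists>t>0. t < 1 \<and> D 0 1 = (\<Sum>k<2. D k 0 / fact k * 1 ^ k) + D 2 t / fact 2 * 1 ^ 2"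
  proof (rule Maclaurin)
    show "\<forall>k t. k < 2 \<and> 0 \<le> t \<and> t \<le> 1 \<longrightarrow> DERIV (D k) t :> D (Suc k) t"
    proof (intro allI impI)
      fix k :: nat and t :: real assume "k < 2 \<and> 0 \<le> t \<and> t \<le> 1"
      then consider "k = 0" | "k = 1" by linarith
      then show "DERIV (D k) t :> D (Suc k) t"
        by cases (simp_all add: D_def[abs_def] lin[OF d1[OF yY]] lin[OF d2[OF yY]])
    qed
  qed simp_all
  then obtain t where t: "0 < t" "t < 1" and eq: "D 0 1 = D 0 0 + D 1 0 + D 2 t / 2"
    by (auto simp: eval_nat_numeral)
  \<comment> \<open>The intermediate gradient lies on the segment from \<open>grad u x0\<close> to
    \<open>grad ubar x0\<close>, hence in the ball of radius \<open>P\<close>, where the second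
    derivatives of \<open>A\<close> are controlled.\<close>
  define p where "p = grad u x0 + t *\<^sub>R d"
  have "p = (1 - t) *\<^sub>R grad u x0 + t *\<^sub>R grad ubar x0" by (simp add: p_def d_def algebra_simps)
  then have "norm p \<le> (1 - t) * norm (grad u x0) + t * norm (grad ubar x0)"
    using norm_triangle_ineq[of "(1 - t) *\<^sub>R grad u x0" "t *\<^sub>R grad ubar x0"] t by simp
  also have "\<dots> \<le> (1 - t) * P + t * P" using t P by (intro add_mono mult_left_mono) simp_all
  finally have p: "norm p \<le> P" by (simp add: algebra_simps)
  let ?Q = "\<lambda>v w. e j \<bullet> (dir_deriv (dir_deriv ?A v) w (x0, u x0, p) *v e j)"
  have yp: "(x0, u x0, p) \<in> \<Omega> \<times> UNIV \<times> UNIV" using x0 by simp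
  have Q1: "linear (\<lambda>v. ?Q v w)" for w by (rule linear_quadratic_form[OF linear_dir_deriv_dir_deriv[OF openY yp A2]])
  have Q2: "linear (?Q v)" for v by (rule linear_quadratic_form[OF linear_dir_deriv2[OF openY yp A2]])
  have Qb: "\<bar>?Q v w\<bar> \<le> N * norm v * norm w" for v w
    using frame_quadratic_le[OF e, of j "dir_deriv (dir_deriv ?A v) w (x0, u x0, p)" j] A2N'[OF p, of v w] by linarith
  \<comment> \<open>Regularity concerns only the part \<open>b\<close> of \<open>d\<close>
    orthogonal to \<open>e j\<close>. Every other term contains a factor \<open>a\<close> multiplied
    by at most \<open>6 N^2\<close>, and Taylor's formula halves this.\<close>
  define a where "a = e j \<bullet> d"
  define b where "b = d - a *\<^sub>R e j"
  have ej: "e j \<bullet> e j = 1" using e by (simp add: frame_def)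
  have eb: "e j \<bullet> b = 0" by (simp add: b_def inner_diff_right ej a_def)
  have dd: "(0, 0, d) = a *\<^sub>R (0, 0, e j) + (0, 0, b)" by (simp add: b_def)
  have "norm b \<le> norm d"
  proof (rule power2_le_imp_le)
    have "(norm d)\<^sup>2 = (norm b)\<^sup>2 + a\<^sup>2"
      unfolding power2_norm_eq_inner using eb
      by (subst (1 2) b_def) (simp add: inner_diff_left inner_diff_right ej a_def inner_commute power2_eq_square algebra_simps)
    then show "(norm b)\<^sup>2 \<le> (norm d)\<^sup>2" by simp
  qed simp
  then have nb: "norm b \<le> 2 * N" using norm_d by linarith
  have "\<bar>a\<bar> \<le> norm d" unfolding a_def using Cauchy_Schwarz_ineq2[of "e j" d] frame_norm[OF e, of j] by simp
  then have na: "\<bar>a\<bar> \<le> 2 * N" using norm_d by linarith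
  have n1: "norm (0 :: real^'n, 0 :: real, e j) = 1" using frame_norm[OF e, of j] by (simp add: norm_Pair)
  have n2: "norm (0 :: real^'n, 0 :: real, b) = norm b" by (simp add: norm_Pair)
  have "?Q (0, 0, d) (0, 0, d) = a * (a * ?Q (0, 0, e j) (0, 0, e j) + ?Q (0, 0, e j) (0, 0, b) + ?Q (0, 0, b) (0, 0, e j)) + ?Q (0, 0, b) (0, 0, b)"
    unfolding dd linear_add[OF Q1] linear_add[OF Q2] linear_scale[OF Q1] linear_scale[OF Q2] by (simp add: algebra_simps)
  moreover have "0 \<le> ?Q (0, 0, b) (0, 0, b)" by (rule regA'[OF eb])
  moreover have "\<bar>a * (a * ?Q (0, 0, e j) (0, 0, e j) + ?Q (0, 0, e j) (0, 0, b) + ?Q (0, 0, b) (0, 0, e j))\<bar> \<le> \<bar>a\<bar> * (6 * N\<^sup>2)"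
    unfolding abs_mult
  proof (intro mult_left_mono)
    have "\<bar>a * ?Q (0, 0, e j) (0, 0, e j)\<bar> \<le> 2 * N * N"
      unfolding abs_mult using na Qb[of "(0, 0, e j)" "(0, 0, e j)"] N n1 by (intro mult_mono) simp_all
    moreover have "\<bar>?Q (0, 0, e j) (0, 0, b)\<bar> \<le> N * (2 * N)"
      using Qb[of "(0, 0, e j)" "(0, 0, b)"] mult_left_mono[OF nb, of N] N unfolding n1 n2 by linarith
    moreover have "\<bar>?Q (0, 0, b) (0, 0, e j)\<bar> \<le> N * (2 * N)"
      using Qb[of "(0, 0, b)" "(0, 0, e j)"] mult_left_mono[OF nb, of N] N unfolding n1 n2 by linarith
    ultimately show "\<bar>a * ?Q (0, 0, e j) (0, 0, e j) + ?Q (0, 0, e j) (0, 0, b) + ?Q (0, 0, b) (0, 0, e j)\<bar> \<le> 6 * N\<^sup>2"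
      by (simp add: power2_eq_square)
  qed simp
  ultimately have "- (\<bar>a\<bar> * (6 * N\<^sup>2)) \<le> ?Q (0, 0, d) (0, 0, d)" by linarith
  moreover have "D 2 t = ?Q (0, 0, d) (0, 0, d)" by (simp add: D_def yt p_def)
  moreover have "D 0 1 = e j \<bullet> (A x0 (u x0) (grad ubar x0) *v e j)" by (simp add: D_def yt d_def)
  moreover have "D 0 0 = e j \<bullet> (A x0 (u x0) (grad u x0) *v e j)" by (simp add: D_def yt)
  moreover have "D 1 0 = \<alpha> j (0, 0, d)" by (simp add: D_def y_def \<alpha>_def zero_prod_def[symmetric])
  ultimately have "- (\<bar>a\<bar> * (6 * N\<^sup>2)) \<le> 2 * (e j \<bullet> (A x0 (u x0) (grad ubar x0) *v e j) - e j \<bullet> (A x0 (u x0) (grad u x0) *v e j) - \<alpha> j (0, 0, d))"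
    using eq by (simp add: field_simps)
  then show ?thesis unfolding a_def by (simp add: algebra_simps)
qed

text \<open>The tangent of a convex function lies below its graph.\<close>

lemma B_remainder: "dB (0, 0, d) \<le> B x0 (u x0) (grad ubar x0) - B x0 (u x0) (grad u x0)"
proof -
  let ?B = "\<lambda>(x, z, p). B x z p"
  have at0: "point u x0 = point u x0 + 0 *\<^sub>R (0, 0, d)" by (simp add: zero_prod_def[symmetric])
  have "?B differentiable (at (point u x0))"
    using Ck_on_SucD[OF openY _ y0Y] B2 unfolding numeral_2_eq_2 by blast
  from dir_deriv_has_derivative[OF this]
  have "(?B has_derivative dB) (at (point u x0 + 0 *\<^sub>R (0, 0, d)))" by (subst at0[symmetric])
  from has_derivative_along_line[OF this]
  have "((\<lambda>t. ?B (point u x0 + t *\<^sub>R (0, 0, d))) has_real_derivative dB (0, 0, d)) (at 0)"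
    by (simp add: has_field_derivative_def mult_commute_abs)
  then have "((\<lambda>t. - B x0 (u x0) (grad u x0 + t *\<^sub>R d)) has_real_derivative - dB (0, 0, d)) (at 0)"
    using DERIV_minus by (fastforce simp: point_def)
  moreover have "(1 - t) * - B x0 (u x0) (grad u x0 + 0 *\<^sub>R d) + t * - B x0 (u x0) (grad ubar x0) \<le> - B x0 (u x0) (grad u x0 + t *\<^sub>R d)"
    if "0 < t" "t < 1" for t
  proof -
    have "B x0 (u x0) ((1 - t) *\<^sub>R grad u x0 + t *\<^sub>R grad ubar x0) \<le> (1 - t) * B x0 (u x0) (grad u x0) + t * B x0 (u x0) (grad ubar x0)"
      using convex_onD[OF convB', of t "grad u x0" "grad ubar x0"] that by simp
    moreover have "(1 - t) *\<^sub>R grad u x0 + t *\<^sub>R grad ubar x0 = grad u x0 + t *\<^sub>R d" by (simp add: d_def algebra_simps)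
    ultimately show ?thesis by simp
  qed
  ultimately have "- B x0 (u x0) (grad ubar x0) - - B x0 (u x0) (grad u x0 + 0 *\<^sub>R d) \<le> - dB (0, 0, d)"
    by (rule right_derivative_ge_chord)
  then show ?thesis by simp
qed

text \<open>Both remainders are needed on one side only, which regularity and convexity provide; the
  price is linear in the components of \<open>d\<close>.\<close>

lemma Lop_v: "gap - 3 * N\<^sup>2 * (\<Sum>j\<in>UNIV. f j * \<bar>v1 (e j)\<bar>) \<le> Lop v1 v2"
proof -
  let ?a = "\<lambda>j. e j \<bullet> (A x0 (u x0) (grad ubar x0) *v e j) - e j \<bullet> (A x0 (u x0) (grad u x0) *v e j)"
  have "v2 (e j) = e j \<bullet> ((aug_hess_wrt A u ubar x0 - r0) *v e j) + ?a j" for j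
    unfolding v2_def hess_eq aug_hess_wrt_def
    by (simp add: matrix_vector_mult_diff_rdistrib matrix_vector_mult_add_rdistrib inner_diff_right inner_add_right)
  then have "(\<Sum>j\<in>UNIV. f j * v2 (e j)) = G r0 \<bullet> (aug_hess_wrt A u ubar x0 - r0) + (\<Sum>j\<in>UNIV. f j * ?a j)"
    unfolding G_inner by (simp add: distrib_left sum.distrib)
  moreover have "v1 (pvec (\<alpha> j)) = \<alpha> j (0, 0, d)" for j unfolding v1_def by (rule inner_pvec[OF linear_\<alpha>])
  moreover have "v1 (pvec dB) = dB (0, 0, d)" unfolding v1_def by (rule inner_pvec[OF linear_dB])
  ultimately have "Lop v1 v2 = G r0 \<bullet> (aug_hess_wrt A u ubar x0 - r0) + (\<Sum>j\<in>UNIV. f j * (?a j - \<alpha> j (0, 0, d))) - dB (0, 0, d)"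
    unfolding Lop_def by (simp add: right_diff_distrib sum_subtractf)
  moreover have "(\<Sum>j\<in>UNIV. f j * - (3 * N\<^sup>2 * \<bar>v1 (e j)\<bar>)) \<le> (\<Sum>j\<in>UNIV. f j * (?a j - \<alpha> j (0, 0, d)))"
    unfolding v1_def by (intro sum_mono mult_left_mono A_remainder) (simp add: f_pos less_imp_le)
  moreover have "(\<Sum>j\<in>UNIV. f j * - (3 * N\<^sup>2 * \<bar>v1 (e j)\<bar>)) = - (3 * N\<^sup>2 * (\<Sum>j\<in>UNIV. f j * \<bar>v1 (e j)\<bar>))"
    by (simp add: sum_distrib_left sum_negf mult_ac)
  ultimately show ?thesis using B_remainder unfolding gap_def by linarith
qed

abbreviation "k \<equiv> test_exponent N \<epsilon>"
abbreviation "\<kappa> \<equiv> test_kappa N \<epsilon>"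
abbreviation "\<tau> \<equiv> test_tau n N"
definition \<eta> :: real where "\<eta> = exp (k * (ubar x0 - u x0))"
definition E :: real where "E = k * exp (2 * k * N)"
definition \<eta>1 :: "real^'n \<Rightarrow> real" where "\<eta>1 q = k * v1 q * \<eta>"
definition \<eta>2 :: "real^'n \<Rightarrow> real" where "\<eta>2 q = (k * v2 q + (k * v1 q)\<^sup>2) * \<eta>"

lemma constants: "k > 0" "\<kappa> > 0" "\<tau> > 0" "\<tau> \<le> 1" "E > 0"
proof -
  have n: "n \<ge> 1" by (simp add: n_def Suc_le_eq)
  have N4: "N ^ 4 \<ge> 1" using N by simp
  show k: "k > 0" using N \<epsilon> by (simp add: test_exponent_def)
  show "\<kappa> > 0" using N \<epsilon> k by (simp add: test_kappa_def)
  show "\<tau> > 0" using N n by (simp add: test_tau_def)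
  have "1 \<le> 24 * n * N ^ 4"
    using mult_mono[of 1 "24 * n" 1 "N ^ 4"] N4 n by simp
  then show "\<tau> \<le> 1" by (simp add: test_tau_def)
  show "E > 0" using k by (simp add: E_def)
qed

lemma \<eta>_bounds: "exp (- (2 * k * N)) \<le> \<eta>" "k * \<eta> \<le> E" "\<eta> > 0"
proof -
  have "\<bar>k * (ubar x0 - u x0)\<bar> \<le> 2 * k * N"
    using mult_left_mono[OF diff_le, of k] constants(1) by (simp add: abs_mult)
  then show "exp (- (2 * k * N)) \<le> \<eta>" "k * \<eta> \<le> E" "\<eta> > 0"
    using constants(1) by (simp_all add: \<eta>_def E_def abs_le_iff)
qed

lemma jet2_\<eta>: "jet2 (\<lambda>t. exp (k * (ubar (x0 + t *\<^sub>R q) - u (x0 + t *\<^sub>R q)))) (\<eta>1 q) (\<eta>2 q)"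
  using jet2_exp[OF jet2_linear[OF bounded_linear_mult_right[of k] jet2_v]] by (simp add: \<eta>1_def \<eta>2_def \<eta>_def)

text \<open>The exponential adds a multiple of the squared derivatives of \<open>ubar - u\<close>,
  the term that can absorb the linear loss in \<open>Lop_v\<close>.\<close>

lemma Lop_\<eta>: "Lop \<eta>1 \<eta>2 = k * \<eta> * (Lop v1 v2 + k * (\<Sum>j\<in>UNIV. f j * (v1 (e j))\<^sup>2))"
  unfolding Lop_def \<eta>1_def \<eta>2_def
  by (simp add: algebra_simps power2_eq_square sum.distrib sum_distrib_left)

text \<open>The number 241 exceeds by one the total 240 of the competing errors in
  \<open>eigenvalue_bound\<close>.\<close>

lemma Lop_\<eta>_alt1:
  assumes "\<epsilon> * (1 + T) \<le> gap"
  shows "241 * N ^ 4 * (1 + T) \<le> \<kappa> * Lop \<eta>1 \<eta>2"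
proof -
  have young: "- (\<epsilon> / 2) \<le> k * x\<^sup>2 - 3 * N\<^sup>2 * \<bar>x\<bar>" for x
  proof -
    have "0 \<le> k * (\<bar>x\<bar> - 3 * N\<^sup>2 / (2 * k))\<^sup>2" using constants(1) by simp
    also have "\<dots> = k * x\<^sup>2 - 3 * N\<^sup>2 * \<bar>x\<bar> + 9 * N ^ 4 / (4 * k)"
      using constants(1) by (simp add: power2_diff power_divide power_mult_distrib field_simps power2_eq_square power4_eq_xxxx)
    also have "9 * N ^ 4 / (4 * k) = \<epsilon> / 2" using N \<epsilon> by (simp add: test_exponent_def field_simps)
    finally show ?thesis by simp
  qed
  have "(\<Sum>j\<in>UNIV. f j * - (\<epsilon> / 2)) \<le> (\<Sum>j\<in>UNIV. f j * (k * (v1 (e j))\<^sup>2 - 3 * N\<^sup>2 * \<bar>v1 (e j)\<bar>))"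
    by (intro sum_mono mult_left_mono young) (simp add: f_pos less_imp_le)
  also have "\<dots> = k * (\<Sum>j\<in>UNIV. f j * (v1 (e j))\<^sup>2) - 3 * N\<^sup>2 * (\<Sum>j\<in>UNIV. f j * \<bar>v1 (e j)\<bar>)"
    by (simp add: right_diff_distrib sum_subtractf sum_distrib_left mult_ac)
  also have "(\<Sum>j\<in>UNIV. f j * - (\<epsilon> / 2)) = - (\<epsilon> / 2) * T"
    unfolding T_def sum_distrib_left by (simp add: mult.commute)
  finally have "\<epsilon> / 2 * (1 + T) \<le> Lop v1 v2 + k * (\<Sum>j\<in>UNIV. f j * (v1 (e j))\<^sup>2)"
    using Lop_v assms \<epsilon> by (simp add: algebra_simps)
  moreover have "k * exp (- (2 * k * N)) \<le> k * \<eta>" using \<eta>_bounds(1) constants(1) by simp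
  ultimately have "k * exp (- (2 * k * N)) * (\<epsilon> / 2 * (1 + T)) \<le> Lop \<eta>1 \<eta>2"
    unfolding Lop_\<eta> using constants(1) \<eta>_bounds(3) \<epsilon> T_pos by (intro mult_mono) simp_all
  then have "\<kappa> * (k * exp (- (2 * k * N)) * (\<epsilon> / 2 * (1 + T))) \<le> \<kappa> * Lop \<eta>1 \<eta>2"
    using constants(2) by simp
  moreover have "\<kappa> * (k * exp (- (2 * k * N)) * (\<epsilon> / 2 * (1 + T))) = 241 * N ^ 4 * (1 + T)"
  proof -
    have "\<kappa> * (k * exp (- (2 * k * N)) * (\<epsilon> / 2 * (1 + T))) =
      241 * N ^ 4 * (exp (2 * k * N) * exp (- (2 * k * N))) * ((k * \<epsilon>) / (k * \<epsilon>)) * (1 + T)"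
      by (simp add: test_kappa_def)
    moreover have "exp (2 * k * N) * exp (- (2 * k * N)) = 1" by (simp add: exp_minus)
    moreover have "(k * \<epsilon>) / (k * \<epsilon>) = 1" using constants(1) \<epsilon> by simp
    ultimately show ?thesis by simp
  qed
  ultimately show ?thesis by linarith
qed

text \<open>Without strict positivity the linear loss is estimated crudely by a multiple of
  \<open>T\<close>, which is bounded in the alternative where this is used.\<close>

lemma Lop_\<eta>_alt2:
  assumes "0 \<le> gap"
  shows "- (\<kappa> * E * (6 * N ^ 3) * T) \<le> \<kappa> * Lop \<eta>1 \<eta>2"
proof -
  have "\<bar>v1 (e j)\<bar> \<le> 2 * N" for j
    unfolding v1_def using Cauchy_Schwarz_ineq2[of "e j" d] frame_norm[OF e, of j] norm_d by simp
  then have "(\<Sum>j\<in>UNIV. f j * \<bar>v1 (e j)\<bar>) \<le> (\<Sum>j\<in>UNIV. f j * (2 * N))"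
    by (intro sum_mono mult_left_mono) (simp_all add: f_pos less_imp_le)
  then have "3 * N\<^sup>2 * (\<Sum>j\<in>UNIV. f j * \<bar>v1 (e j)\<bar>) \<le> 3 * N\<^sup>2 * (T * (2 * N))"
    by (intro mult_left_mono) (simp_all add: T_def sum_distrib_right)
  moreover have "0 \<le> k * (\<Sum>j\<in>UNIV. f j * (v1 (e j))\<^sup>2)"
    using constants(1) by (intro mult_nonneg_nonneg sum_nonneg) (simp_all add: f_pos less_imp_le)
  ultimately have "- (6 * N ^ 3 * T) \<le> Lop v1 v2 + k * (\<Sum>j\<in>UNIV. f j * (v1 (e j))\<^sup>2)"
    using Lop_v assms by (simp add: power2_eq_square power3_eq_cube algebra_simps)
  then have "k * \<eta> * - (6 * N ^ 3 * T) \<le> Lop \<eta>1 \<eta>2"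
    unfolding Lop_\<eta> using constants(1) \<eta>_bounds(3) by (intro mult_left_mono) simp_all
  moreover have "k * \<eta> * (6 * N ^ 3 * T) \<le> E * (6 * N ^ 3 * T)"
    using \<eta>_bounds(2) N T_pos by (intro mult_right_mono) simp_all
  ultimately have "- (E * (6 * N ^ 3 * T)) \<le> Lop \<eta>1 \<eta>2" by simp
  from mult_left_mono[OF this less_imp_le[OF constants(2)]] show ?thesis by (simp add: mult_ac)
qed

definition M :: real where "M = 3 * N ^ 4 + 3 * (\<kappa> * (E * (2 * N)))\<^sup>2"

definition p1 :: "real^'n \<Rightarrow> real" where "p1 q = \<tau> * hg1 q + \<kappa> * \<eta>1 q"
definition p2 :: "real^'n \<Rightarrow> real" where "p2 q = \<tau> * hg2 q + \<kappa> * \<eta>2 q"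

text \<open>Only one part grows with \<open>l j\<close>, and it carries \<open>\<tau>^2\<close>, one
  power more than the gain \<open>\<tau> * s / 2\<close>; hence a small \<open>\<tau>\<close> makes
  it harmless.\<close>

lemma p1_square: "(p1 (e j))\<^sup>2 \<le> 3 * \<tau>\<^sup>2 * N\<^sup>2 * (l j)\<^sup>2 + M"
proof -
  define a where "a = \<tau> * (N * \<bar>l j\<bar>)"
  define b where "b = \<tau> * N\<^sup>2"
  define c where "c = \<kappa> * (E * (2 * N))"
  have "\<bar>\<tau> * hg1 (e j)\<bar> \<le> a + b"
    unfolding abs_mult a_def b_def using mult_left_mono[OF abs_hg1[of j], of \<tau>] constants(3)
    by (simp add: algebra_simps power2_eq_square)
  moreover have "\<bar>\<kappa> * \<eta>1 (e j)\<bar> \<le> c"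
  proof -
    have "\<bar>v1 (e j)\<bar> \<le> 2 * N"
      unfolding v1_def using Cauchy_Schwarz_ineq2[of "e j" d] frame_norm[OF e, of j] norm_d by simp
    then have "(k * \<eta>) * \<bar>v1 (e j)\<bar> \<le> E * (2 * N)"
      using \<eta>_bounds constants N by (intro mult_mono) simp_all
    from mult_left_mono[OF this less_imp_le[OF constants(2)]] show ?thesis
      using constants \<eta>_bounds(3) by (simp add: c_def \<eta>1_def abs_mult mult_ac)
  qed
  ultimately have "\<bar>p1 (e j)\<bar> \<le> a + b + c" unfolding p1_def by linarith
  then have "(p1 (e j))\<^sup>2 \<le> (a + b + c)\<^sup>2" using power_mono[of "\<bar>p1 (e j)\<bar>" "a + b + c" 2] by simp
  also have "\<dots> \<le> 3 * a\<^sup>2 + 3 * b\<^sup>2 + 3 * c\<^sup>2"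
  proof -
    have "0 \<le> (a - b)\<^sup>2 + (b - c)\<^sup>2 + (a - c)\<^sup>2" by simp
    then show ?thesis by (simp add: power2_eq_square algebra_simps)
  qed
  also have "a\<^sup>2 = \<tau>\<^sup>2 * N\<^sup>2 * (l j)\<^sup>2" by (simp add: a_def power_mult_distrib)
  also have "b\<^sup>2 \<le> N ^ 4"
    using mult_right_mono[of "\<tau>\<^sup>2" 1 "N ^ 4"] constants(3,4) by (simp add: b_def power_mult_distrib power_le_one)
  finally show ?thesis by (simp add: M_def c_def)
qed

text \<open>If \<open>l m\<close> exceeded \<open>max_bound\<close>, the terms quadratic in
  \<open>p1\<close> would be absorbed by half of the gain plus a further quarter, leaving
  \<open>\<tau> * s / 8\<close>. A strictly positive barrier then outweighs the remaining errors;
  under uniform ellipticity \<open>s\<close> controls \<open>l m\<close> itself.\<close>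

theorem eigenvalue_bound:
  assumes "\<epsilon> * (1 + T) \<le> gap \<or> 0 \<le> gap \<and> T \<le> 1 / \<epsilon> \<and> (\<forall>j. \<epsilon> \<le> f j)"
  shows "l m \<le> max_bound n N \<epsilon>"
proof (rule ccontr)
  define R where "R = (240 * N ^ 4 + \<kappa> * E * (6 * N ^ 3)) * (1 + 1 / \<epsilon>)"
  have n: "n \<ge> 1" by (simp add: n_def Suc_le_eq)
  have M: "M \<ge> 0" using N by (simp add: M_def)
  have R: "R \<ge> 0" using N \<epsilon> constants by (simp add: R_def)
  assume "\<not> l m \<le> max_bound n N \<epsilon>"
  then have "(8 * ((n + 16) * M + 4 * N) + 8 * R / \<epsilon>) / \<tau> < l m"
    by (simp add: max_bound_def Let_def M_def R_def E_def)
  then have big: "8 * ((n + 16) * M + 4 * N) + 8 * R / \<epsilon> < \<tau> * l m"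
    using constants(3) by (simp add: pos_divide_less_eq mult.commute)
  have big1: "8 * ((n + 16) * M + 4 * N) < \<tau> * l m" using big R \<epsilon> by (smt (verit) divide_nonneg_pos)
  have big2: "8 * R / \<epsilon> < \<tau> * l m" using big M N n by (smt (verit) mult_nonneg_nonneg)
  have l0: "l m > 0" using lm by simp
  interpret mx: interior_max \<Gamma> F \<Omega> u A B x0 e l m N "test_function n N \<epsilon> u ubar" p1 p2
  proof unfold_locales
    show "jet2 (\<lambda>t. test_function n N \<epsilon> u ubar (x0 + t *\<^sub>R q)) (p1 q) (p2 q)" for q
      unfolding test_function_def p1_def p2_def
      by (intro jet2_add jet2_linear[OF bounded_linear_mult_right] jet2_half_grad_square jet2_\<eta>)
  qed (rule max)
  \<comment> \<open>Since \<open>f m \<le> \<sigma>\<close>, errors without growth in the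
    eigenvalues become multiples of \<sigma>, while the gain is of order
    \<open>\<sigma> * (l m)^2\<close>.\<close>
  define \<sigma> where "\<sigma> = s / (l m)\<^sup>2"
  have \<sigma>: "\<sigma> \<ge> 0" using s_nonneg by (simp add: \<sigma>_def)
  have s\<sigma>: "s = \<sigma> * (l m)\<^sup>2" using l0 by (simp add: \<sigma>_def)
  have fm: "f m \<le> \<sigma>" using f_le_s[of m] l0 by (simp add: \<sigma>_def field_simps)
  have II1: "f m * (\<Sum>j\<in>UNIV. (p1 (e j))\<^sup>2) \<le> 3 * \<tau>\<^sup>2 * n * N ^ 4 * s + n * M * \<sigma>"
  proof -
    have "(\<Sum>j\<in>UNIV. (p1 (e j))\<^sup>2) \<le> (\<Sum>j\<in>(UNIV::'n set). 3 * \<tau>\<^sup>2 * N\<^sup>2 * (N * l m)\<^sup>2 + M)"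
    proof (rule sum_mono)
      fix j
      have "(l j)\<^sup>2 \<le> (N * l m)\<^sup>2" using l_le[of j] N l0 by (simp add: abs_le_square_iff[symmetric] abs_mult)
      then have "3 * \<tau>\<^sup>2 * N\<^sup>2 * (l j)\<^sup>2 \<le> 3 * \<tau>\<^sup>2 * N\<^sup>2 * (N * l m)\<^sup>2" by (intro mult_left_mono) simp_all
      then show "(p1 (e j))\<^sup>2 \<le> 3 * \<tau>\<^sup>2 * N\<^sup>2 * (N * l m)\<^sup>2 + M" using p1_square[of j] by linarith
    qed
    also have "\<dots> = 3 * \<tau>\<^sup>2 * n * N ^ 4 * (l m)\<^sup>2 + n * M"
      by (simp add: n_def[symmetric] power_mult_distrib algebra_simps power2_eq_square power4_eq_xxxx)
    finally have "f m * (\<Sum>j\<in>UNIV. (p1 (e j))\<^sup>2) \<le> \<sigma> * (3 * \<tau>\<^sup>2 * n * N ^ 4 * (l m)\<^sup>2 + n * M)"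
      using fm \<sigma> by (intro mult_mono) (simp_all add: sum_nonneg)
    then show ?thesis by (simp add: s\<sigma> algebra_simps)
  qed
  \<comment> \<open>In the sum \<open>(l m)^2 \<le> 16 (l j)^2\<close>, so the bounded part
    \<open>M\<close> of \<open>(p1 (e j))^2\<close> costs at most \<open>16 M\<close> times
    \<sigma>.\<close>
  have II2: "(\<Sum>j\<in>UNIV. if l j < - l m / 4 then f j * (p1 (e j))\<^sup>2 else 0) \<le> 3 * \<tau>\<^sup>2 * N\<^sup>2 * s + 16 * M * \<sigma>"
  proof -
    have "(\<Sum>j\<in>UNIV. if l j < - l m / 4 then f j * (p1 (e j))\<^sup>2 else 0) \<le>
      (\<Sum>j\<in>UNIV. 3 * \<tau>\<^sup>2 * N\<^sup>2 * (f j * (l j)\<^sup>2) + 16 * M / (l m)\<^sup>2 * (f j * (l j)\<^sup>2))"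
    proof (rule sum_mono)
      fix j
      have nn: "0 \<le> f j * (l j)\<^sup>2" using f_pos[of j] by simp
      show "(if l j < - l m / 4 then f j * (p1 (e j))\<^sup>2 else 0) \<le>
        3 * \<tau>\<^sup>2 * N\<^sup>2 * (f j * (l j)\<^sup>2) + 16 * M / (l m)\<^sup>2 * (f j * (l j)\<^sup>2)"
      proof (cases "l j < - l m / 4")
        case True
        then have "(l m / 4)\<^sup>2 \<le> (l j)\<^sup>2" using l0 by (simp add: abs_le_square_iff[symmetric])
        then have "1 \<le> 16 * (l j)\<^sup>2 / (l m)\<^sup>2" using l0 by (simp add: power_divide field_simps)
        then have "M * 1 \<le> M * (16 * (l j)\<^sup>2 / (l m)\<^sup>2)" using M by (intro mult_left_mono)
        then have "(p1 (e j))\<^sup>2 \<le> 3 * \<tau>\<^sup>2 * N\<^sup>2 * (l j)\<^sup>2 + M * (16 * (l j)\<^sup>2 / (l m)\<^sup>2)"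
          using p1_square[of j] by linarith
        from mult_left_mono[OF this less_imp_le[OF f_pos]] show ?thesis using True by (simp add: algebra_simps)
      next
        case False
        then show ?thesis using nn M by simp
      qed
    qed
    also have "\<dots> = 3 * \<tau>\<^sup>2 * N\<^sup>2 * s + 16 * M / (l m)\<^sup>2 * s"
      by (simp add: s_def sum.distrib sum_distrib_left)
    finally show ?thesis by (simp add: \<sigma>_def)
  qed
  have N24: "N\<^sup>2 \<le> n * N ^ 4"
  proof -
    have "1 * N\<^sup>2 \<le> n * N ^ 4" using n N power_increasing[of 2 4 N] by (intro mult_mono) simp_all
    then show ?thesis by simp
  qed
  have II3: "3 * \<tau>\<^sup>2 * N\<^sup>2 * s \<le> 3 * \<tau>\<^sup>2 * n * N ^ 4 * s"
    using mult_left_mono[OF N24, of "3 * \<tau>\<^sup>2 * s"] s_nonneg by (simp add: mult_ac)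
  \<comment> \<open>\<open>II1\<close> and \<open>II2\<close> with \<open>II3\<close> each
    contribute \<open>3 \<tau>^2 n N^4 s\<close>; together this is half of the gain
    \<open>\<tau> * s / 2\<close>.\<close>
  have tau: "6 * \<tau>\<^sup>2 * n * N ^ 4 = \<tau> / 4"
  proof -
    have t1: "\<tau> * (24 * n * N ^ 4) = 1" using n N by (simp add: test_tau_def)
    have "6 * \<tau>\<^sup>2 * n * N ^ 4 = \<tau> * (\<tau> * (24 * n * N ^ 4)) / 4" by (simp add: power2_eq_square)
    then show ?thesis by (simp only: t1)
  qed
  have "l m * (\<tau> * Lop hg1 hg2 + \<kappa> * Lop \<eta>1 \<eta>2) \<le> l m * (f m * (\<Sum>j\<in>UNIV. (p1 (e j))\<^sup>2)
    + (\<Sum>j\<in>UNIV. if l j < - l m / 4 then f j * (p1 (e j))\<^sup>2 else 0)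
    + 192 * N ^ 4 * T + 45 * N ^ 3 * (1 + T)) + 4 * N * s"
    using mx.Lop_le' unfolding p1_def[abs_def] p2_def[abs_def] Lop_combine .
  also have "4 * N * s = l m * (4 * N * \<sigma> * l m)" by (simp add: s\<sigma> power2_eq_square)
  finally have "l m * (\<tau> * Lop hg1 hg2 + \<kappa> * Lop \<eta>1 \<eta>2) \<le> l m * (f m * (\<Sum>j\<in>UNIV. (p1 (e j))\<^sup>2)
    + (\<Sum>j\<in>UNIV. if l j < - l m / 4 then f j * (p1 (e j))\<^sup>2 else 0)
    + 192 * N ^ 4 * T + 45 * N ^ 3 * (1 + T) + 4 * N * \<sigma> * l m)"
    by (simp add: distrib_left)
  then have "\<tau> * Lop hg1 hg2 + \<kappa> * Lop \<eta>1 \<eta>2 \<le> f m * (\<Sum>j\<in>UNIV. (p1 (e j))\<^sup>2)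
    + (\<Sum>j\<in>UNIV. if l j < - l m / 4 then f j * (p1 (e j))\<^sup>2 else 0)
    + 192 * N ^ 4 * T + 45 * N ^ 3 * (1 + T) + 4 * N * \<sigma> * l m"
    using l0 by simp
  moreover have "\<tau> * (s / 2) - 3 * N ^ 4 * (1 + T) \<le> \<tau> * Lop hg1 hg2"
  proof -
    have "\<tau> * (3 * N ^ 3 * (1 + T)) \<le> 1 * (3 * N ^ 4 * (1 + T))"
      using constants(3,4) N T_pos power_increasing[of 3 4 N] by (intro mult_mono) simp_all
    then show ?thesis using mult_left_mono[OF Lop_half_grad_square, of \<tau>] constants(3) by (simp add: right_diff_distrib)
  qed
  moreover have "192 * N ^ 4 * T + 45 * N ^ 3 * (1 + T) \<le> 237 * N ^ 4 * (1 + T)"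
  proof -
    have "45 * N ^ 3 * (1 + T) \<le> 45 * N ^ 4 * (1 + T)" using N T_pos power_increasing[of 3 4 N] by (intro mult_mono) simp_all
    moreover have "192 * N ^ 4 * T \<le> 192 * N ^ 4 * (1 + T)" using N by (intro mult_left_mono) simp_all
    moreover have "237 * N ^ 4 * (1 + T) = 192 * N ^ 4 * (1 + T) + 45 * N ^ 4 * (1 + T)" by (simp add: algebra_simps)
    ultimately show ?thesis by linarith
  qed
  ultimately have "\<tau> * (s / 2) + \<kappa> * Lop \<eta>1 \<eta>2 \<le> 6 * \<tau>\<^sup>2 * n * N ^ 4 * s + (n + 16) * M * \<sigma> + 4 * N * \<sigma> * l m + 240 * N ^ 4 * (1 + T)"
    using II1 II2 II3 by (simp add: algebra_simps)
  \<comment> \<open>The first threshold in \<open>max_bound\<close> makes these terms an eighth of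
    \<open>\<tau> * s\<close>, so that \<open>1/2 - 1/4 - 1/8 = 1/8\<close> survives.\<close>
  moreover have "(n + 16) * M * \<sigma> + 4 * N * \<sigma> * l m \<le> \<tau> / 8 * s"
  proof -
    have "(n + 16) * M * 1 \<le> (n + 16) * M * l m" using lm M n by (intro mult_left_mono) simp_all
    then have "(n + 16) * M + 4 * N * l m \<le> ((n + 16) * M + 4 * N) * l m" by (simp add: algebra_simps)
    also have "\<dots> \<le> (\<tau> * l m / 8) * l m" using big1 l0 by (intro mult_right_mono) simp_all
    finally have "\<sigma> * ((n + 16) * M + 4 * N * l m) \<le> \<sigma> * ((\<tau> * l m / 8) * l m)" using \<sigma> by (rule mult_left_mono)
    then show ?thesis by (simp add: s\<sigma> power2_eq_square algebra_simps)
  qed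
  ultimately have main: "\<tau> / 8 * s + \<kappa> * Lop \<eta>1 \<eta>2 \<le> 240 * N ^ 4 * (1 + T)"
    unfolding tau by (simp add: algebra_simps)
  have N4: "N ^ 4 > 0" using N by simp
  from assms show False
  proof
    assume "\<epsilon> * (1 + T) \<le> gap"
    from Lop_\<eta>_alt1[OF this] main s_nonneg constants(3) have "241 * N ^ 4 * (1 + T) \<le> 240 * N ^ 4 * (1 + T)"
      by (smt (verit) divide_nonneg_pos mult_nonneg_nonneg)
    then have "N ^ 4 * (1 + T) \<le> 0" by simp
    moreover have "N ^ 4 * (1 + T) > 0" using N4 T_pos by (intro mult_pos_pos) simp_all
    ultimately show False by linarith
  next
    assume *: "0 \<le> gap \<and> T \<le> 1 / \<epsilon> \<and> (\<forall>j. \<epsilon> \<le> f j)"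
    have "\<tau> / 8 * s \<le> 240 * N ^ 4 * (1 + T) + \<kappa> * E * (6 * N ^ 3) * T"
      using main Lop_\<eta>_alt2 * by linarith
    also have "\<dots> \<le> R"
    proof -
      have "240 * N ^ 4 * (1 + T) \<le> 240 * N ^ 4 * (1 + 1 / \<epsilon>)" using * N by (intro mult_left_mono) simp_all
      moreover have "\<kappa> * E * (6 * N ^ 3) * T \<le> \<kappa> * E * (6 * N ^ 3) * (1 + 1 / \<epsilon>)"
        using * N constants by (intro mult_left_mono) simp_all
      ultimately show ?thesis unfolding R_def distrib_right by (rule add_mono)
    qed
    finally have "\<tau> / 8 * s \<le> R" .
    \<comment> \<open>Ellipticity in the direction \<open>e m\<close> together with
      \<open>l m \<ge> 1\<close>; so a bound for \<open>s\<close> is a bound for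
      \<open>l m\<close>.\<close>
    moreover have "\<epsilon> * (l m * 1) \<le> s"
    proof -
      have "\<epsilon> * (l m * 1) \<le> f m * (l m * l m)" using * \<epsilon> lm f_pos[of m] by (intro mult_mono) simp_all
      then show ?thesis using f_le_s[of m] by (simp add: power2_eq_square)
    qed
    then have "\<tau> / 8 * (\<epsilon> * l m) \<le> \<tau> / 8 * s" using constants(3) by (intro mult_left_mono) simp_all
    ultimately have "\<tau> * l m \<le> 8 * R / \<epsilon>" using \<epsilon> by (simp add: field_simps)
    then show False using big2 by simp
  qed
qed

end

section \<open>Extension to the closure and compactness\<close>

lemma Ck_ext_extends: "Ck_ext k S f \<Longrightarrow> extends_continuously S f"
  by (cases k) simp_all

lemma Ck_ext_dir_deriv: "Ck_ext (Suc k) S f \<Longrightarrow> Ck_ext k S (dir_deriv f v)"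
  by simp

lemma extends_continuously_bounded:
  assumes "extends_continuously S f" "compact K" "K \<subseteq> closure S"
  shows "\<exists>b. \<forall>x\<in>K \<inter> S. norm (f x) \<le> b"
proof -
  from assms(1) obtain g where g: "continuous_on (closure S) g" "\<forall>x\<in>S. g x = f x"
    unfolding extends_continuously_def by (elim exE conjE)
  have "compact (g ` K)" using continuous_on_subset[OF g(1) assms(3)] assms(2) by (rule compact_continuous_image)
  from bounded_iff[THEN iffD1, OF compact_imp_bounded[OF this]]
  obtain b where b: "\<forall>y\<in>g ` K. norm y \<le> b" by (elim exE)
  have "norm (f x) \<le> b" if "x \<in> K \<inter> S" for x
  proof -
    have "norm (g x) \<le> b" using b that by blast
    then show ?thesis using g(2) that by simp
  qed
  then show ?thesis by blast
qed

lemma extends_continuously_vec: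
  assumes "\<And>i. extends_continuously S (\<lambda>x. f x $ i)"
  shows "extends_continuously S (f :: 'a::real_normed_vector \<Rightarrow> 'b::real_normed_vector ^ 'n)"
proof -
  have "\<forall>i. \<exists>g. continuous_on (closure S) g \<and> (\<forall>x\<in>S. g x = f x $ i)"
    using assms unfolding extends_continuously_def by blast
  then obtain g where g: "\<forall>i. continuous_on (closure S) (g i) \<and> (\<forall>x\<in>S. g i x = f x $ i)"
    by (rule choice[THEN exE])
  have "continuous_on (closure S) (\<lambda>x. \<chi> i. g i x)" using g by (intro continuous_on_vec_lambda) blast
  moreover have "\<forall>x\<in>S. (\<chi> i. g i x) = f x" using g by (simp add: vec_eq_iff)
  ultimately show ?thesis unfolding extends_continuously_def by (intro exI conjI)
qed

lemma extends_continuously_grad: "Ck_ext 1 \<Omega> u \<Longrightarrow> extends_continuously \<Omega> (grad u)"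
  by (rule extends_continuously_vec) (simp add: grad_def)

lemma extends_continuously_hess: "Ck_ext 2 \<Omega> u \<Longrightarrow> extends_continuously \<Omega> (hess u)"
  by (rule extends_continuously_vec, rule extends_continuously_vec) (simp add: hess_def numeral_2_eq_2)

lemma linear_bound_Basis:
  fixes L :: "'a::euclidean_space \<Rightarrow> 'b::real_normed_vector"
  assumes "linear L" "\<And>i. i \<in> Basis \<Longrightarrow> norm (L i) \<le> b"
  shows "norm (L v) \<le> real DIM('a) * b * norm v"
proof -
  have "norm (L v) = norm (\<Sum>i\<in>Basis. (v \<bullet> i) *\<^sub>R L i)"
    using linear_sum[OF assms(1), of "\<lambda>i. (v \<bullet> i) *\<^sub>R i" Basis] linear_scale[OF assms(1)]
    by (simp add: euclidean_representation)
  also have "\<dots> \<le> (\<Sum>i\<in>(Basis :: 'a set). norm v * b)"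
  proof (rule sum_norm_le)
    fix i :: 'a assume i: "i \<in> Basis"
    then show "norm ((v \<bullet> i) *\<^sub>R L i) \<le> norm v * b"
      using assms(2)[OF i] Basis_le_norm[OF i, of v] by (simp add: mult_mono)
  qed
  finally show ?thesis by (simp add: mult_ac)
qed

text \<open>The continuous extensions exist for each fixed direction separately. Linearity in the
  directions reduces a uniform bound to finitely many pairs of basis vectors.\<close>

lemma Ck_ext_derivative_bounds:
  fixes f :: "'a::euclidean_space \<Rightarrow> 'b::real_normed_vector"
  assumes S: "open S" and f: "Ck_ext 2 S f" and K: "compact K" "K \<subseteq> closure S"
  obtains b where "\<And>x v. x \<in> K \<inter> S \<Longrightarrow> norm (dir_deriv f v x) \<le> b * norm v"
    "\<And>x v w. x \<in> K \<inter> S \<Longrightarrow> norm (dir_deriv (dir_deriv f v) w x) \<le> b * norm v * norm w"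
proof -
  have f2: "Ck_ext (Suc (Suc 0)) S f" using f by (simp only: numeral_2_eq_2)
  have "\<forall>i\<in>Basis. \<exists>b. \<forall>x\<in>K \<inter> S. norm (dir_deriv f i x) \<le> b"
    using extends_continuously_bounded[OF Ck_ext_extends[OF Ck_ext_dir_deriv[OF f2]] K] by blast
  then obtain b1 where b1: "\<forall>i\<in>Basis. \<forall>x\<in>K \<inter> S. norm (dir_deriv f i x) \<le> b1 i"
    by (rule bchoice[THEN exE])
  have "\<forall>z\<in>Basis \<times> Basis. \<exists>b. \<forall>x\<in>K \<inter> S. norm (dir_deriv (dir_deriv f (fst z)) (snd z) x) \<le> b"
    using extends_continuously_bounded[OF Ck_ext_extends[OF Ck_ext_dir_deriv[OF Ck_ext_dir_deriv[OF f2]]] K] by blast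
  then obtain b2 where b2: "\<forall>z\<in>Basis \<times> Basis. \<forall>x\<in>K \<inter> S. norm (dir_deriv (dir_deriv f (fst z)) (snd z) x) \<le> b2 z"
    by (rule bchoice[THEN exE])
  define c1 where "c1 = (\<Sum>i\<in>(Basis :: 'a set). \<bar>b1 i\<bar>)"
  define c2 where "c2 = (\<Sum>z\<in>(Basis \<times> Basis :: ('a \<times> 'a) set). \<bar>b2 z\<bar>)"
  define D where "D = real DIM('a)"
  define b where "b = max (D * c1) (D * (D * c2))"
  have Ck: "Ck_on 2 S f" using f by (rule Ck_ext_imp_Ck_on)
  have 1: "norm (dir_deriv f v x) \<le> D * c1 * norm v" if x: "x \<in> K \<inter> S" for x v
  proof -
    have lin: "linear (\<lambda>v. dir_deriv f v x)"
      using Ck_on_SucD[OF S Ck[unfolded numeral_2_eq_2]] x by (intro linear_dir_deriv) blast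
    have "norm (dir_deriv f i x) \<le> c1" if i: "i \<in> Basis" for i :: 'a
    proof -
      have "norm (dir_deriv f i x) \<le> b1 i" using b1 i x by blast
      also have "\<dots> \<le> \<bar>b1 i\<bar>" by simp
      also have "\<dots> \<le> c1" unfolding c1_def using i by (intro member_le_sum) simp_all
      finally show ?thesis .
    qed
    from linear_bound_Basis[OF lin this] show ?thesis by (simp add: D_def)
  qed
  have 2: "norm (dir_deriv (dir_deriv f v) w x) \<le> D * (D * c2) * norm v * norm w" if x: "x \<in> K \<inter> S" for x v w
  proof -
    have xS: "x \<in> S" using x by blast
    have "norm (dir_deriv (dir_deriv f v) w x) \<le> D * (D * c2 * norm w) * norm v"
      unfolding D_def
    proof (rule linear_bound_Basis[OF linear_dir_deriv_dir_deriv[OF S xS Ck]])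
      fix i :: 'a assume i: "i \<in> Basis"
      show "norm (dir_deriv (dir_deriv f i) w x) \<le> real DIM('a) * c2 * norm w"
      proof (rule linear_bound_Basis[OF linear_dir_deriv2[OF S xS Ck]])
        fix j :: 'a assume j: "j \<in> Basis"
        have ij: "(i, j) \<in> Basis \<times> Basis" using i j by simp
        have "norm (dir_deriv (dir_deriv f (fst (i, j))) (snd (i, j)) x) \<le> b2 (i, j)" using b2 ij x by blast
        then have "norm (dir_deriv (dir_deriv f i) j x) \<le> \<bar>b2 (i, j)\<bar>" by simp
        also have "\<dots> \<le> c2" unfolding c2_def using ij by (intro member_le_sum) simp_all
        finally show "norm (dir_deriv (dir_deriv f i) j x) \<le> c2" .
      qed
    qed
    then show ?thesis by (simp add: mult_ac)
  qed
  show ?thesis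
  proof (rule that)
    show "norm (dir_deriv f v x) \<le> b * norm v" if "x \<in> K \<inter> S" for x v
      by (rule order_trans[OF 1[OF that]], rule mult_right_mono) (simp_all add: b_def)
    show "norm (dir_deriv (dir_deriv f v) w x) \<le> b * norm v * norm w" if "x \<in> K \<inter> S" for x v w
      by (rule order_trans[OF 2[OF that]], intro mult_right_mono) (simp_all add: b_def)
  qed
qed

lemma dir_deriv_third_argument:
  fixes g :: "(real^'n) \<times> real \<times> (real^'n) \<Rightarrow> 'b::real_normed_vector"
  assumes "g differentiable (at (x, z, p))"
  shows "dir_deriv (\<lambda>p. g (x, z, p)) v p = dir_deriv g (0, 0, v) (x, z, p)"
proof (rule dir_deriv_eq)
  have "((\<lambda>p. (x, z, p)) has_derivative (\<lambda>v. (0, 0, v))) (at p)"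
    by (intro has_derivative_Pair has_derivative_const has_derivative_ident)
  from has_derivative_compose[OF this dir_deriv_has_derivative[OF assms]]
  show "((\<lambda>p. g (x, z, p)) has_derivative (\<lambda>v. dir_deriv g (0, 0, v) (x, z, p))) (at p)" .
qed

text \<open>\<open>D2pp\<close> differentiates in \<open>p\<close> with \<open>x\<close> and
  \<open>z\<close> frozen, whereas the estimates differentiate jointly in all three arguments; the
  inclusion of the \<open>p\<close> slot translates one into the other.\<close>

lemma regular_second_derivative:
  fixes A :: "real^'n \<Rightarrow> real \<Rightarrow> real^'n \<Rightarrow> real^'n^'n"
  assumes \<Omega>: "open \<Omega>" and A: "Ck_on 2 (\<Omega> \<times> UNIV \<times> UNIV) (\<lambda>(x, z, p). A x z p)"
    and reg: "regular_on (closure \<Omega>) A" and x: "x \<in> \<Omega>" and orth: "\<xi> \<bullet> \<eta> = 0"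
  shows "0 \<le> \<xi> \<bullet> (dir_deriv (dir_deriv (\<lambda>(x, z, p). A x z p) (0, 0, \<eta>)) (0, 0, \<eta>) (x, z, p) *v \<xi>)"
proof -
  let ?A = "\<lambda>(x, z, p). A x z p"
  define Y :: "((real^'n) \<times> real \<times> (real^'n)) set" where "Y = \<Omega> \<times> UNIV \<times> UNIV"
  have Y: "open Y" unfolding Y_def using \<Omega> by (intro open_Times) simp_all
  have A2: "Ck_on (Suc (Suc 0)) Y ?A" using A unfolding Y_def numeral_2_eq_2 .
  have A2': "Ck_on 2 Y ?A" using A unfolding Y_def .
  have yY: "(x, z, p) \<in> Y" for p using x by (simp add: Y_def)
  have d1: "dir_deriv (A x z) v p = dir_deriv ?A (0, 0, v) (x, z, p)" for v p
    using dir_deriv_third_argument[OF Ck_on_SucD[OF Y A2 yY], of v p] by simp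
  have M: "D2pp A x z p k l = dir_deriv (dir_deriv ?A (0, 0, axis l 1)) (0, 0, axis k 1) (x, z, p)" for k l
  proof -
    have "dir_deriv (A x z) (axis l 1) = (\<lambda>p. dir_deriv ?A (0, 0, axis l 1) (x, z, p))" by (rule ext) (rule d1)
    then have "D2pp A x z p k l = dir_deriv (\<lambda>p. dir_deriv ?A (0, 0, axis l 1) (x, z, p)) (axis k 1) p"
      by (simp only: D2pp_def)
    also have "\<dots> = dir_deriv (dir_deriv ?A (0, 0, axis l 1)) (0, 0, axis k 1) (x, z, p)"
      by (rule dir_deriv_third_argument[OF Ck_on_SucD[OF Y Ck_on_dir_deriv[OF A2] yY]])
    finally show ?thesis .
  qed
  have inc: "linear (\<lambda>q. L (0, 0, q))" if "linear L" for L :: "(real^'n) \<times> real \<times> (real^'n) \<Rightarrow> real^'n^'n"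
    using linear_compose[OF _ that, of "\<lambda>q. (0, 0, q)"] by (simp add: o_def linear_iff)
  have "dir_deriv (dir_deriv ?A (0, 0, \<eta>)) (0, 0, \<eta>) (x, z, p) = (\<Sum>k\<in>UNIV. \<eta> $ k *\<^sub>R (\<Sum>l\<in>UNIV. \<eta> $ l *\<^sub>R D2pp A x z p k l))"
    unfolding M linear_axis_expand[OF inc[OF linear_dir_deriv_dir_deriv[OF Y yY A2']], symmetric]
    by (rule linear_axis_expand[OF inc[OF linear_dir_deriv2[OF Y yY A2']]])
  then have eq: "\<xi> \<bullet> (dir_deriv (dir_deriv ?A (0, 0, \<eta>)) (0, 0, \<eta>) (x, z, p) *v \<xi>) =
    (\<Sum>i\<in>UNIV. \<Sum>j\<in>UNIV. \<Sum>k\<in>UNIV. \<Sum>l\<in>UNIV. D2pp A x z p k l $ i $ j * \<xi> $ i * \<xi> $ j * \<eta> $ k * \<eta> $ l)"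
    by (simp add: inner_vec_def matrix_vector_mult_def sum_distrib_left sum_distrib_right mult_ac)
  have "x \<in> closure \<Omega>" using x closure_subset by blast
  from reg[unfolded regular_on_def, rule_format, OF this orth]
  show ?thesis unfolding eq .
qed

text \<open>By midpoint convexity the sum of the values at \<open>p + t \<eta>\<close> and
  \<open>p - t \<eta>\<close> is smallest at \<open>t = 0\<close>.\<close>

lemma convex_second_derivative:
  fixes B :: "real^'n \<Rightarrow> real \<Rightarrow> real^'n \<Rightarrow> real"
  assumes \<Omega>: "open \<Omega>" and B: "Ck_on 2 (\<Omega> \<times> UNIV \<times> UNIV) (\<lambda>(x, z, p). B x z p)"
    and conv: "convex_on UNIV (B x z)" and x: "x \<in> \<Omega>"
  shows "0 \<le> dir_deriv (dir_deriv (\<lambda>(x, z, p). B x z p) (0, 0, \<eta>)) (0, 0, \<eta>) (x, z, p)"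
proof -
  let ?B = "\<lambda>(x, z, p). B x z p"
  let ?dd = "\<lambda>v w. dir_deriv (dir_deriv ?B v) w (x, z, p)"
  have Y: "open (\<Omega> \<times> (UNIV :: real set) \<times> (UNIV :: (real^'n) set))" using \<Omega> by (intro open_Times) simp_all
  have yY: "(x, z, p) \<in> \<Omega> \<times> UNIV \<times> UNIV" using x by simp
  define v where "v = (0 :: real^'n, 0 :: real, \<eta>)"
  have "?dd (- v) (- v) = ?dd v v"
    using linear_neg[OF linear_dir_deriv_dir_deriv[OF Y yY B]] linear_neg[OF linear_dir_deriv2[OF Y yY B]] by simp
  then have J: "jet2 (\<lambda>t. ?B ((x, z, p) + t *\<^sub>R v) + ?B ((x, z, p) + t *\<^sub>R (- v))) (dir_deriv ?B v (x, z, p) + dir_deriv ?B (- v) (x, z, p)) (?dd v v + ?dd v v)"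
    using jet2_add[OF jet2_along_line[OF Y B yY, of v] jet2_along_line[OF Y B yY, of "- v"]] by simp
  have "?B ((x, z, p) + 0 *\<^sub>R v) + ?B ((x, z, p) + 0 *\<^sub>R (- v)) \<le> ?B ((x, z, p) + t *\<^sub>R v) + ?B ((x, z, p) + t *\<^sub>R (- v))" for t
  proof -
    have "(1 - 1 / 2) *\<^sub>R (p + t *\<^sub>R \<eta>) + (1 / 2) *\<^sub>R (p - t *\<^sub>R \<eta>) = (1 / 2) *\<^sub>R (p + p)"
      by (simp add: scaleR_right_distrib scaleR_right_diff_distrib)
    also have "\<dots> = p" by (rule scaleR_half_double)
    finally have "(1 - 1 / 2) *\<^sub>R (p + t *\<^sub>R \<eta>) + (1 / 2) *\<^sub>R (p - t *\<^sub>R \<eta>) = p" .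
    then show ?thesis using convex_onD[OF conv, of "1 / 2" "p + t *\<^sub>R \<eta>" "p - t *\<^sub>R \<eta>"] by (simp add: v_def)
  qed
  then have "\<forall>\<^sub>F t in nhds 0. ?B ((x, z, p) + 0 *\<^sub>R v) + ?B ((x, z, p) + 0 *\<^sub>R (- v)) \<le> ?B ((x, z, p) + t *\<^sub>R v) + ?B ((x, z, p) + t *\<^sub>R (- v))"
    by (intro always_eventually allI)
  from jet2_local_min(2)[OF J this] show ?thesis by (simp add: v_def)
qed

text \<open>A frontier point of an open set is a limit point of the set, so the limit defining the
  boundary value exists and is unique.\<close>

lemma bdry_value_extension:
  fixes f :: "real^'n \<Rightarrow> 'b::real_normed_vector"
  assumes "open \<Omega>" "continuous_on (closure \<Omega>) g" "\<And>x. x \<in> \<Omega> \<Longrightarrow> g x = f x" "x \<in> frontier \<Omega>"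
  shows "bdry_value \<Omega> f x = g x"
proof -
  have x: "x \<in> closure \<Omega>" "x \<notin> \<Omega>" using assms(1,4) by (auto simp: frontier_def interior_open)
  have "(g \<longlongrightarrow> g x) (at x within closure \<Omega>)" using assms(2) x(1) by (simp add: continuous_on)
  then have "(g \<longlongrightarrow> g x) (at x within \<Omega>)" by (rule tendsto_within_subset) (rule closure_subset)
  moreover have "\<forall>\<^sub>F y in at x within \<Omega>. g y = f y" unfolding eventually_at_filter by (simp add: assms(3))
  ultimately have "(f \<longlongrightarrow> g x) (at x within \<Omega>)" by (rule Lim_transform_eventually)
  moreover have "at x within \<Omega> \<noteq> bot" using x by (auto simp: trivial_limit_within closure_def)
  ultimately show ?thesis unfolding bdry_value_def by (intro tendsto_Lim)
qed

context concave_operator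
begin

text \<open>A limit point outside \<Gamma> would be a boundary point at which \<open>F\<close> has
  upper limit at least \<open>c > a0\<close>, which F3 forbids.\<close>

lemma compact_superlevel:
  assumes F3: "F3 \<Gamma> F a0" and c: "a0 < ereal c"
  shows "compact {r \<in> \<Gamma>. norm r \<le> \<rho> \<and> c \<le> F r}"
proof -
  let ?S = "{r \<in> \<Gamma>. norm r \<le> \<rho> \<and> c \<le> F r}"
  have "closed ?S"
    unfolding closed_sequential_limits
  proof (intro allI impI, elim conjE)
    fix f r assume f: "\<forall>n. f n \<in> ?S" and lim: "f \<longlonglongrightarrow> r"
    have rs: "r \<in> sym_mats"
      using closed_sym_mats f sym lim unfolding closed_sequential_limits by blast
    have nr: "norm r \<le> \<rho>" using tendsto_norm[OF lim] f by (intro LIMSEQ_le_const2) auto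
    have rG: "r \<in> \<Gamma>"
    proof (rule ccontr)
      assume nG: "r \<notin> \<Gamma>"
      let ?X = "top_of_set (sym_mats :: (real^'n^'n) set)"
      have "r \<in> ?X closure_of \<Gamma>"
      proof -
        have "r \<in> closure \<Gamma>" using f lim unfolding closure_sequential by blast
        then have "\<Gamma> \<inter> U \<noteq> {}" if "open U" "r \<in> U" for U
          using that open_Int_closure_eq_empty[of U \<Gamma>] by blast
        then show ?thesis unfolding in_closure_of openin_open using rs sym by fastforce
      qed
      moreover have "?X interior_of \<Gamma> = \<Gamma>"
        using cone unfolding open_convex_cone_def by (simp add: interior_of_openin)
      ultimately have fr: "r \<in> ?X frontier_of \<Gamma>" using nG by (simp add: frontier_of_def)
      have "ereal c \<le> Limsup (at r within \<Gamma>) (\<lambda>r. ereal (F r))"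
        unfolding Limsup_def
      proof (rule INF_greatest)
        fix P assume "P \<in> {P. eventually P (at r within \<Gamma>)}"
        then have P: "eventually P (at r within \<Gamma>)" by simp
        \<comment> \<open>The sequence stays in \<Gamma> while its limit does not, so it approaches
          \<open>r\<close> through punctured neighbourhoods and its values enter the upper
          limit.\<close>
        have "filterlim f (at r within \<Gamma>) sequentially"
          unfolding filterlim_at using lim f nG by (auto intro!: always_eventually)
        then have "\<forall>\<^sub>F n in sequentially. P (f n)" using P by (simp add: filterlim_iff)
        then obtain n where "P (f n)" by (auto simp: eventually_sequentially)
        then have "ereal (F (f n)) \<le> (SUP x\<in>Collect P. ereal (F x))" by (intro SUP_upper) simp
        moreover have "ereal c \<le> ereal (F (f n))" using f by simp
        ultimately show "ereal c \<le> (SUP x\<in>Collect P. ereal (F x))" by (rule order_trans[rotated])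
      qed
      also have "\<dots> \<le> (SUP r0 \<in> ?X frontier_of \<Gamma>. Limsup (at r0 within \<Gamma>) (\<lambda>r. ereal (F r)))"
        by (rule SUP_upper[OF fr])
      also have "\<dots> \<le> a0" using F3 by (simp add: F3_def)
      finally show False using c by simp
    qed
    have "(\<lambda>n. F (f n)) \<longlonglongrightarrow> F r"
      using continuous_on_F rG f lim unfolding continuous_on_sequentially by (auto simp: o_def)
    then have "c \<le> F r" using f by (intro LIMSEQ_le_const) auto
    then show "r \<in> ?S" using rG nr by simp
  qed
  moreover have "bounded ?S" unfolding bounded_iff by blast
  ultimately show ?thesis by (simp add: compact_eq_bounded_closed)
qed

end

section \<open>The global estimate\<close>

text \<open>A supremum of reals bounds the members only of a set that is bounded above; the
  continuous extensions to the compact closure provide this.\<close>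

lemma C1_norm_bounds:
  fixes u :: "real^'n \<Rightarrow> real"
  assumes \<Omega>: "\<Omega> \<noteq> {}" "bounded \<Omega>" and u: "continuous_on (closure \<Omega>) u" "Ck_ext 1 \<Omega> u" "C1_norm \<Omega> u \<le> K"
    and x: "x \<in> \<Omega>"
  shows "\<bar>u x\<bar> \<le> K" "norm (grad u x) \<le> K"
proof -
  have cl: "compact (closure \<Omega>)" using \<Omega>(2) by simp
  have "extends_continuously \<Omega> u" using u(1) unfolding extends_continuously_def by blast
  from extends_continuously_bounded[OF this cl] obtain a where a: "\<forall>x\<in>closure \<Omega> \<inter> \<Omega>. norm (u x) \<le> a" by blast
  from extends_continuously_bounded[OF extends_continuously_grad[OF u(2)] cl]
  obtain b where b: "\<forall>x\<in>closure \<Omega> \<inter> \<Omega>. norm (grad u x) \<le> b" by blast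
  have sub: "closure \<Omega> \<inter> \<Omega> = \<Omega>" using closure_subset by blast
  have "bdd_above ((\<lambda>x. \<bar>u x\<bar>) ` \<Omega>)" using a unfolding sub by (intro bdd_aboveI[of _ a]) auto
  then have 1: "\<bar>u x\<bar> \<le> (SUP x\<in>\<Omega>. \<bar>u x\<bar>)" using x by (intro cSUP_upper)
  have "bdd_above ((\<lambda>x. norm (grad u x)) ` \<Omega>)" using b unfolding sub by (intro bdd_aboveI[of _ b]) auto
  then have 2: "norm (grad u x) \<le> (SUP x\<in>\<Omega>. norm (grad u x))" using x by (intro cSUP_upper)
  have "0 \<le> \<bar>u x\<bar>" "0 \<le> norm (grad u x)" by simp_all
  with 1 2 u(3) show "\<bar>u x\<bar> \<le> K" "norm (grad u x) \<le> K" unfolding C1_norm_def by linarith+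
qed

lemma norm_le_on_closure:
  fixes f :: "real^'n \<Rightarrow> 'b::real_normed_vector"
  assumes "continuous_on (closure S) f" "\<And>x. x \<in> S \<Longrightarrow> norm (f x) \<le> b" "x \<in> closure S"
  shows "norm (f x) \<le> b"
  using continuous_on_closure_norm_le[OF assms(1) _ assms(3), of b] assms(2) by blast

section \<open>The data and the constants derived from them\<close>

locale estimate_data = concave_operator \<Gamma> F
  for \<Gamma> :: "(real^'n^'n) set" and F :: "real^'n^'n \<Rightarrow> real" +
  fixes \<Omega> :: "(real^'n) set" and A :: "real^'n \<Rightarrow> real \<Rightarrow> real^'n \<Rightarrow> real^'n^'n"
    and B :: "real^'n \<Rightarrow> real \<Rightarrow> real^'n \<Rightarrow> real" and ubar :: "real^'n \<Rightarrow> real" and K :: real and a0 :: ereal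
  assumes \<Omega>: "open \<Omega>" "\<Omega> \<noteq> {}" "bounded \<Omega>" and F3: "F3 \<Gamma> F a0"
    and A: "Ck_closure 2 (\<Omega> \<times> UNIV \<times> UNIV) (\<lambda>(x, z, p). A x z p)" and regular: "regular_on (closure \<Omega>) A"
    and B: "Ck_closure 2 (\<Omega> \<times> UNIV \<times> UNIV) (\<lambda>(x, z, p). B x z p)"
    and B_gt: "\<forall>x\<in>closure \<Omega>. \<forall>z p. a0 < ereal (B x z p)"
    and B_convex: "\<forall>x\<in>closure \<Omega>. \<forall>z. convex_on UNIV (B x z)"
    and ubar: "Ck_on 2 \<Omega> ubar" "Ck_closure 1 \<Omega> ubar"
begin

definition solution :: "(real^'n \<Rightarrow> real) \<Rightarrow> bool"
  where "solution u \<longleftrightarrow> Ck_on 4 \<Omega> u \<and> Ck_closure 2 \<Omega> u \<and> C1_norm \<Omega> u \<le> K \<and> admissible_solution \<Omega> \<Gamma> F A B u"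

lemma solution_bounds:
  assumes "solution u" "x \<in> \<Omega>"
  shows "\<bar>u x\<bar> \<le> K" "norm (grad u x) \<le> K"
proof -
  have "continuous_on (closure \<Omega>) u" "Ck_ext (Suc (Suc 0)) \<Omega> u" "C1_norm \<Omega> u \<le> K"
    using assms(1) unfolding solution_def Ck_closure_def numeral_2_eq_2 by blast+
  moreover from this(2) have "Ck_ext 1 \<Omega> u" by simp
  ultimately show "\<bar>u x\<bar> \<le> K" "norm (grad u x) \<le> K" using C1_norm_bounds[OF \<Omega>(2,3)] assms(2) by blast+
qed

end

text \<open>\<open>P\<close> bounds the arguments, \<open>N\<close> the coefficients and their
  derivatives there. The factor 1/2 in \<open>eigen_le\<close> gives
  \<open>\<bar>l j\<bar> \<le> N * l m\<close> once \<open>l m \<ge> 1\<close>, since then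
  \<open>1 + l m \<le> 2 * l m\<close>.\<close>

locale estimate_constants = estimate_data \<Gamma> F \<Omega> A B ubar K a0
  for \<Gamma> :: "(real^'n^'n) set" and F \<Omega> A B ubar K a0 +
  fixes P N c b nn :: real
  assumes nn: "nn = real CARD('n)" and P: "K \<le> P" "P \<le> N" "1 \<le> N"
    and ubar_le: "\<And>x. x \<in> \<Omega> \<Longrightarrow> \<bar>ubar x\<bar> \<le> P" "\<And>x. x \<in> \<Omega> \<Longrightarrow> norm (grad ubar x) \<le> P"
    and A_le: "\<And>x z p. x \<in> closure \<Omega> \<Longrightarrow> \<bar>z\<bar> \<le> P \<Longrightarrow> norm p \<le> P \<Longrightarrow> norm (A x z p) \<le> N"
    and dA_le: "\<And>x z p v. x \<in> \<Omega> \<Longrightarrow> \<bar>z\<bar> \<le> P \<Longrightarrow> norm p \<le> P \<Longrightarrow>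
      norm (dir_deriv (\<lambda>(x, z, p). A x z p) v (x, z, p)) \<le> N * norm v"
    and ddA_le: "\<And>x z p v w. x \<in> \<Omega> \<Longrightarrow> \<bar>z\<bar> \<le> P \<Longrightarrow> norm p \<le> P \<Longrightarrow>
      norm (dir_deriv (dir_deriv (\<lambda>(x, z, p). A x z p) v) w (x, z, p)) \<le> N * norm v * norm w"
    and dB_le: "\<And>x z p v. x \<in> \<Omega> \<Longrightarrow> \<bar>z\<bar> \<le> P \<Longrightarrow> norm p \<le> P \<Longrightarrow>
      \<bar>dir_deriv (\<lambda>(x, z, p). B x z p) v (x, z, p)\<bar> \<le> N * norm v"
    and ddB_le: "\<And>x z p v w. x \<in> \<Omega> \<Longrightarrow> \<bar>z\<bar> \<le> P \<Longrightarrow> norm p \<le> P \<Longrightarrow>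
      \<bar>dir_deriv (dir_deriv (\<lambda>(x, z, p). B x z p) v) w (x, z, p)\<bar> \<le> N * norm v * norm w"
    and B_le: "a0 < ereal c" "\<And>x z p. x \<in> closure \<Omega> \<Longrightarrow> \<bar>z\<bar> \<le> P \<Longrightarrow> norm p \<le> P \<Longrightarrow> c \<le> B x z p"
      "\<And>x z p. x \<in> closure \<Omega> \<Longrightarrow> \<bar>z\<bar> \<le> P \<Longrightarrow> norm p \<le> P \<Longrightarrow> \<bar>B x z p\<bar> \<le> b"
    and eigen_le: "\<And>r e l L i. r \<in> \<Gamma> \<Longrightarrow> c \<le> F r \<Longrightarrow> frame e \<Longrightarrow> (\<And>j. r *v e j = l j *\<^sub>R e j) \<Longrightarrow>
      0 \<le> L \<Longrightarrow> (\<And>j. l j \<le> L) \<Longrightarrow> - (N / 2 * (1 + L)) \<le> l i"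

lemma (in estimate_data) constants_exist:
  obtains P N c b nn where "estimate_constants \<Gamma> F \<Omega> A B ubar K a0 P N c b nn"
proof -
  let ?A = "\<lambda>(x, z, p). A x z p" and ?B = "\<lambda>(x, z, p). B x z p"
  have cl: "compact (closure \<Omega>)" using \<Omega>(3) by simp
  have sub: "closure \<Omega> \<inter> \<Omega> = \<Omega>" using closure_subset by blast
  have "extends_continuously \<Omega> ubar" using ubar(2) unfolding Ck_closure_def extends_continuously_def by blast
  from extends_continuously_bounded[OF this cl] obtain u0 where u0: "\<forall>x\<in>\<Omega>. norm (ubar x) \<le> u0" unfolding sub by blast
  have "Ck_ext 1 \<Omega> ubar" using ubar(2) unfolding Ck_closure_def by blast
  from extends_continuously_bounded[OF extends_continuously_grad[OF this] cl]
  obtain u1 where u1: "\<forall>x\<in>\<Omega>. norm (grad ubar x) \<le> u1" unfolding sub by blast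
  define P where "P = max 1 (max K (max u0 u1))"
  have P: "1 \<le> P" "K \<le> P" "u0 \<le> P" "u1 \<le> P" by (simp_all add: P_def)
  define Y :: "((real^'n) \<times> real \<times> (real^'n)) set" where "Y = \<Omega> \<times> UNIV \<times> UNIV"
  have Y: "open Y" unfolding Y_def using \<Omega>(1) by (intro open_Times) simp_all
  have clY: "closure Y = closure \<Omega> \<times> UNIV \<times> UNIV" by (simp add: Y_def closure_Times)
  define C :: "((real^'n) \<times> real \<times> (real^'n)) set" where "C = closure \<Omega> \<times> {- P..P} \<times> cball 0 P"
  have C: "compact C" unfolding C_def by (intro compact_Times cl compact_Icc compact_cball)
  have CY: "C \<subseteq> closure Y" unfolding clY C_def by blast
  have inC: "(x, z, p) \<in> C" if "x \<in> closure \<Omega>" "\<bar>z\<bar> \<le> P" "norm p \<le> P" for x z p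
    using that by (simp add: C_def abs_le_iff)
  have inCY: "(x, z, p) \<in> C \<inter> Y" if "x \<in> \<Omega>" "\<bar>z\<bar> \<le> P" "norm p \<le> P" for x z p
    using that closure_subset[of \<Omega>] by (auto simp: C_def Y_def abs_le_iff)
  have AC: "continuous_on (closure Y) ?A" "Ck_ext 2 Y ?A" and BC: "continuous_on (closure Y) ?B" "Ck_ext 2 Y ?B"
    using A B unfolding Ck_closure_def Y_def by blast+
  obtain bA where bA: "\<And>x v. x \<in> C \<inter> Y \<Longrightarrow> norm (dir_deriv ?A v x) \<le> bA * norm v"
    "\<And>x v w. x \<in> C \<inter> Y \<Longrightarrow> norm (dir_deriv (dir_deriv ?A v) w x) \<le> bA * norm v * norm w"
    using Ck_ext_derivative_bounds[OF Y AC(2) C CY] by blast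
  obtain bB where bB: "\<And>x v. x \<in> C \<inter> Y \<Longrightarrow> norm (dir_deriv ?B v x) \<le> bB * norm v"
    "\<And>x v w. x \<in> C \<inter> Y \<Longrightarrow> norm (dir_deriv (dir_deriv ?B v) w x) \<le> bB * norm v * norm w"
    using Ck_ext_derivative_bounds[OF Y BC(2) C CY] by blast
  have AC': "continuous_on C ?A" and BC': "continuous_on C ?B"
    using AC(1) BC(1) CY continuous_on_subset by blast+
  obtain a where a: "\<forall>y\<in>?A ` C. norm y \<le> a"
    using bounded_iff[THEN iffD1, OF compact_imp_bounded[OF compact_continuous_image[OF AC' C]]] by (elim exE)
  obtain b where b: "\<forall>y\<in>?B ` C. norm y \<le> b"
    using bounded_iff[THEN iffD1, OF compact_imp_bounded[OF compact_continuous_image[OF BC' C]]] by (elim exE)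
  obtain x1 where "x1 \<in> \<Omega>" using \<Omega>(2) by blast
  then have "(x1, 0, 0) \<in> C" using closure_subset P(1) by (intro inC) auto
  then have "C \<noteq> {}" by blast
  \<comment> \<open>The minimum of \<open>B\<close> over the compact set is attained, so the strict
    inequality with \<open>a0\<close> survives as one constant \<open>c\<close>.\<close>
  obtain y where y: "y \<in> C" "\<forall>y'\<in>C. ?B y \<le> ?B y'"
    using continuous_attains_inf[OF C \<open>C \<noteq> {}\<close> BC'] by blast
  define c where "c = ?B y"
  have c: "a0 < ereal c" using B_gt y(1) unfolding c_def C_def by auto
  obtain Ce where Ce: "Ce > 0" "\<And>r e l L i. r \<in> \<Gamma> \<Longrightarrow> c \<le> F r \<Longrightarrow> frame e \<Longrightarrow> (\<And>j. r *v e j = l j *\<^sub>R e j) \<Longrightarrow>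
    0 \<le> L \<Longrightarrow> (\<And>j. l j \<le> L) \<Longrightarrow> - (Ce * (1 + L)) \<le> l i"
    using eigenvalue_lower_bound[of c] by blast
  define N where "N = max P (max a (max bA (max bB (2 * Ce))))"
  have N: "P \<le> N" "a \<le> N" "bA \<le> N" "bB \<le> N" "2 * Ce \<le> N" by (simp_all add: N_def)
  have "estimate_constants \<Gamma> F \<Omega> A B ubar K a0 P N c b (real CARD('n))"
  proof (unfold_locales)
    show "K \<le> P" "P \<le> N" "a0 < ereal c" by (rule P N c)+
    show "1 \<le> N" using P(1) N(1) by linarith
    show "\<bar>ubar x\<bar> \<le> P" "norm (grad ubar x) \<le> P" if "x \<in> \<Omega>" for x
      using u0 u1 that P by (auto intro: order_trans)
    show "norm (A x z p) \<le> N" if "x \<in> closure \<Omega>" "\<bar>z\<bar> \<le> P" "norm p \<le> P" for x z p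
    proof -
      have "norm (?A (x, z, p)) \<le> a" using a inC[OF that] by blast
      then show ?thesis using N(2) by simp
    qed
    show "\<bar>B x z p\<bar> \<le> b" if "x \<in> closure \<Omega>" "\<bar>z\<bar> \<le> P" "norm p \<le> P" for x z p
    proof -
      have "norm (?B (x, z, p)) \<le> b" using b inC[OF that] by blast
      then show ?thesis by simp
    qed
    show "c \<le> B x z p" if "x \<in> closure \<Omega>" "\<bar>z\<bar> \<le> P" "norm p \<le> P" for x z p
    proof -
      have "?B y \<le> ?B (x, z, p)" using y(2) inC[OF that] by blast
      then show ?thesis by (simp add: c_def)
    qed
    fix x z and p :: "real^'n" assume xzp: "x \<in> \<Omega>" "\<bar>z\<bar> \<le> P" "norm p \<le> P"
    note q = inCY[OF xzp]
    show "norm (dir_deriv ?A v (x, z, p)) \<le> N * norm v" for v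
      by (rule order_trans[OF bA(1)[OF q]], rule mult_right_mono) (simp_all add: N)
    show "norm (dir_deriv (dir_deriv ?A v) w (x, z, p)) \<le> N * norm v * norm w" for v w
      by (rule order_trans[OF bA(2)[OF q]], intro mult_right_mono) (simp_all add: N)
    show "\<bar>dir_deriv ?B v (x, z, p)\<bar> \<le> N * norm v" for v
      using order_trans[OF bB(1)[OF q] mult_right_mono[OF N(4) norm_ge_zero], of v] by simp
    show "\<bar>dir_deriv (dir_deriv ?B v) w (x, z, p)\<bar> \<le> N * norm v * norm w" for v w
      using order_trans[OF bB(2)[OF q] mult_right_mono[OF mult_right_mono[OF N(4) norm_ge_zero] norm_ge_zero], of v w] by simp
  next
    fix r e l L i assume *: "r \<in> \<Gamma>" "c \<le> F r" "frame e" "\<And>j. r *v e j = l j *\<^sub>R e j" "0 \<le> L" "\<And>j. l j \<le> L"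
    have "- (Ce * (1 + L)) \<le> l i" using * by (rule Ce(2))
    moreover have "Ce * (1 + L) \<le> N / 2 * (1 + L)" using N(5) *(5) by (intro mult_right_mono) simp_all
    ultimately show "- (N / 2 * (1 + L)) \<le> l i" by linarith
  qed (rule refl)
  then show ?thesis by (rule that)
qed

section \<open>From the barrier alternative to the global bound\<close>

context estimate_constants
begin

text \<open>Either the linearised operator is strictly positive on \<open>ubar - u\<close>, or the equation is uniformly elliptic.\<close>

definition barrier_alternative :: "real \<Rightarrow> (real^'n \<Rightarrow> real) \<Rightarrow> real^'n \<Rightarrow> bool"
  where "barrier_alternative \<epsilon> u x \<longleftrightarrow> (let r = aug_hess A u x;
      gap = G r \<bullet> (aug_hess_wrt A u ubar x - r) - (B x (u x) (grad ubar x) - B x (u x) (grad u x)) in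
    \<epsilon> * (1 + trace (G r)) \<le> gap \<or> 0 \<le> gap \<and> trace (G r) \<le> 1 / \<epsilon> \<and> (\<forall>\<xi>. norm \<xi> = 1 \<longrightarrow> \<epsilon> \<le> \<xi> \<bullet> (G r *v \<xi>)))"

lemma Ck_on_AB: "Ck_on 2 (\<Omega> \<times> UNIV \<times> UNIV) (\<lambda>(x, z, p). A x z p)" "Ck_on 2 (\<Omega> \<times> UNIV \<times> UNIV) (\<lambda>(x, z, p). B x z p)"
  using A B unfolding Ck_closure_def by (auto intro: Ck_ext_imp_Ck_on)

lemma solution_le:
  assumes "solution u" "x \<in> \<Omega>"
  shows "\<bar>u x\<bar> \<le> P" "norm (grad u x) \<le> P"
  using solution_bounds[OF assms] P(1) by linarith+

text \<open>Beyond 1 the normalisation \<open>l m \<ge> 1\<close> holds, beyond \<open>R\<close> the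
  norm of \<open>M[u]\<close> is large enough for the barrier alternative, and the last entry is the
  bound of the pointwise argument.\<close>

lemma interior_maximum:
  assumes u: "solution u" and \<epsilon>: "\<epsilon> > 0" and x0: "x0 \<in> \<Omega>"
    and alt: "R \<le> norm (aug_hess A u x0) \<Longrightarrow> barrier_alternative \<epsilon> u x0" and \<xi>0: "norm \<xi>0 = 1"
    and max: "\<And>x \<xi>. x \<in> \<Omega> \<Longrightarrow> norm \<xi> = 1 \<Longrightarrow>
      (\<xi> \<bullet> (aug_hess A u x *v \<xi>)) * exp (test_function nn N \<epsilon> u ubar x)
      \<le> (\<xi>0 \<bullet> (aug_hess A u x0 *v \<xi>0)) * exp (test_function nn N \<epsilon> u ubar x0)"
  shows "\<xi>0 \<bullet> (aug_hess A u x0 *v \<xi>0) \<le> Max {1, R, max_bound nn N \<epsilon>}"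
proof (rule ccontr)
  assume "\<not> \<xi>0 \<bullet> (aug_hess A u x0 *v \<xi>0) \<le> Max {1, R, max_bound nn N \<epsilon>}"
  then have big: "1 < \<xi>0 \<bullet> (aug_hess A u x0 *v \<xi>0)" "R < \<xi>0 \<bullet> (aug_hess A u x0 *v \<xi>0)"
    "max_bound nn N \<epsilon> < \<xi>0 \<bullet> (aug_hess A u x0 *v \<xi>0)" by simp_all
  let ?r = "aug_hess A u x0"
  have sol: "admissible_solution \<Omega> \<Gamma> F A B u" and u4: "Ck_on 4 \<Omega> u" using u by (simp_all add: solution_def)
  have r: "?r \<in> \<Gamma>" "F ?r = B x0 (u x0) (grad u x0)" using sol x0 by (simp_all add: admissible_solution_def)
  have x0c: "x0 \<in> closure \<Omega>" using x0 closure_subset by blast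
  note ub = solution_le[OF u x0]
  obtain e l where e: "frame e" and l: "\<And>j. ?r *v e j = l j *\<^sub>R e j"
    using symmetric_matrix_eigenframe[OF sym[OF r(1)]] by blast
  have le: "e j \<bullet> (?r *v e j) = l j" for j using e by (simp add: l frame_def)
  have l_max: "l j \<le> \<xi>0 \<bullet> (?r *v \<xi>0)" for j
    using max[OF x0 frame_norm[OF e, of j]] by (simp add: le)
  \<comment> \<open>The quadratic form at the unit vector \<open>\<xi>0\<close> is a weighted mean
    of the eigenvalues and cannot exceed all of them.\<close>
  have "\<exists>m. \<xi>0 \<bullet> (?r *v \<xi>0) \<le> l m"
  proof (rule ccontr)
    assume "\<nexists>m. \<xi>0 \<bullet> (?r *v \<xi>0) \<le> l m"
    then have lt: "l j < \<xi>0 \<bullet> (?r *v \<xi>0)" for j by (meson not_le)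
    have "\<xi>0 \<bullet> (?r *v \<xi>0) = (\<Sum>j\<in>UNIV. l j * (\<xi>0 \<bullet> e j)\<^sup>2)"
      using frame_inner[OF e, of \<xi>0 "?r *v \<xi>0"] sym_mats_inner[OF sym[OF r(1)], of \<xi>0, symmetric]
      by (simp add: l power2_eq_square mult_ac)
    also have "\<dots> < (\<Sum>j\<in>UNIV. (\<xi>0 \<bullet> (?r *v \<xi>0)) * (\<xi>0 \<bullet> e j)\<^sup>2)"
    proof (rule sum_strict_mono_ex1)
      have ne: "(\<Sum>j\<in>UNIV. (\<xi>0 \<bullet> e j) * (\<xi>0 \<bullet> e j)) \<noteq> 0"
        using frame_inner[OF e, of \<xi>0 \<xi>0] \<xi>0 by (simp add: norm_eq_1)
      have "\<exists>j. \<xi>0 \<bullet> e j \<noteq> 0"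
      proof (rule ccontr)
        assume "\<nexists>j. \<xi>0 \<bullet> e j \<noteq> 0"
        then have "\<xi>0 \<bullet> e j = 0" for j by blast
        then show False using ne by simp
      qed
      then obtain j where "\<xi>0 \<bullet> e j \<noteq> 0" by blast
      then have "l j * (\<xi>0 \<bullet> e j)\<^sup>2 < (\<xi>0 \<bullet> (?r *v \<xi>0)) * (\<xi>0 \<bullet> e j)\<^sup>2"
        by (intro mult_strict_right_mono lt) simp
      then show "\<exists>j\<in>UNIV. l j * (\<xi>0 \<bullet> e j)\<^sup>2 < (\<xi>0 \<bullet> (?r *v \<xi>0)) * (\<xi>0 \<bullet> e j)\<^sup>2" by blast
      show "\<forall>j\<in>UNIV. l j * (\<xi>0 \<bullet> e j)\<^sup>2 \<le> (\<xi>0 \<bullet> (?r *v \<xi>0)) * (\<xi>0 \<bullet> e j)\<^sup>2"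
        by (intro ballI mult_right_mono less_imp_le[OF lt]) simp
    qed simp
    also have "\<dots> = (\<xi>0 \<bullet> (?r *v \<xi>0)) * (\<Sum>j\<in>UNIV. (\<xi>0 \<bullet> e j) * (\<xi>0 \<bullet> e j))"
      by (simp add: sum_distrib_left power2_eq_square)
    also have "\<dots> = \<xi>0 \<bullet> (?r *v \<xi>0)" using frame_inner[OF e, of \<xi>0 \<xi>0] \<xi>0 by (simp add: norm_eq_1)
    finally show False by simp
  qed
  then obtain m where m: "\<xi>0 \<bullet> (?r *v \<xi>0) \<le> l m" by blast
  have lm_eq: "l m = \<xi>0 \<bullet> (?r *v \<xi>0)" using m l_max[of m] by linarith
  have lm1: "l m \<ge> 1" using big(1) lm_eq by linarith
  have ll: "l j \<le> l m" for j using l_max[of j] lm_eq by simp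
  have cF: "c \<le> F ?r" unfolding r(2) using B_le(2)[OF x0c ub] .
  have l_le: "\<bar>l j\<bar> \<le> N * l m" for j
  proof -
    have "- (N / 2 * (1 + l m)) \<le> l j" using eigen_le[OF r(1) cF e l _ ll, of j] lm1 by simp
    moreover have "N / 2 * (1 + l m) \<le> N / 2 * (2 * l m)" using P(3) lm1 by (intro mult_left_mono) simp_all
    moreover have "1 * l m \<le> N * l m" using P(3) lm1 by (intro mult_right_mono) simp_all
    ultimately show ?thesis using ll[of j] by (simp add: abs_le_iff)
  qed
  interpret interior_test \<Gamma> F \<Omega> u A B x0 e l m N ubar \<epsilon> nn P
  proof (unfold_locales)
    show "open \<Omega>" "Ck_on 4 \<Omega> u" "x0 \<in> \<Omega>" "admissible_solution \<Omega> \<Gamma> F A B u" "frame e" "1 \<le> N" "1 \<le> l m" "0 < \<epsilon>" "P \<le> N"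
      "Ck_on 2 \<Omega> ubar"
      by (fact \<Omega> u4 x0 sol e P lm1 \<epsilon> ubar)+
    show "Ck_on 2 (\<Omega> \<times> UNIV \<times> UNIV) (\<lambda>(x, z, p). A x z p)" "Ck_on 2 (\<Omega> \<times> UNIV \<times> UNIV) (\<lambda>(x, z, p). B x z p)"
      by (fact Ck_on_AB)+
    show "aug_hess A u x0 *v e j = l j *\<^sub>R e j" for j by (rule l)
    show "\<bar>l j\<bar> \<le> N * l m" for j by (rule l_le)
    show "norm (A x0 (u x0) (grad u x0)) \<le> N" by (rule A_le[OF x0c ub])
    show "norm (grad u x0) \<le> P" by (rule ub)
    show "norm (grad u x0) \<le> N" using ub(2) P(2) by linarith
    show "norm (grad ubar x0) \<le> P" by (rule ubar_le[OF x0])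
    show "\<bar>ubar x0 - u x0\<bar> \<le> 2 * N" using ubar_le(1)[OF x0] ub(1) P(2) by linarith
    show "norm (dir_deriv (\<lambda>(x, z, p). A x z p) v (point u x0)) \<le> N * norm v" for v
      unfolding point_def by (rule dA_le[OF x0 ub])
    show "norm (dir_deriv (dir_deriv (\<lambda>(x, z, p). A x z p) v) w (point u x0)) \<le> N * norm v * norm w" for v w
      unfolding point_def by (rule ddA_le[OF x0 ub])
    show "\<bar>dir_deriv (\<lambda>(x, z, p). B x z p) v (point u x0)\<bar> \<le> N * norm v" for v
      unfolding point_def by (rule dB_le[OF x0 ub])
    show "\<bar>dir_deriv (dir_deriv (\<lambda>(x, z, p). B x z p) v) w (point u x0)\<bar> \<le> N * norm v * norm w" for v w
      unfolding point_def by (rule ddB_le[OF x0 ub])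
    show "0 \<le> \<xi> \<bullet> (dir_deriv (dir_deriv (\<lambda>(x, z, p). A x z p) (0, 0, \<eta>)) (0, 0, \<eta>) (point u x0) *v \<xi>)"
      if "\<xi> \<bullet> \<eta> = 0" for \<xi> \<eta>
      unfolding point_def by (rule regular_second_derivative[OF \<Omega>(1) Ck_on_AB(1) regular x0 that])
    show "0 \<le> \<xi> \<bullet> (dir_deriv (dir_deriv (\<lambda>(x, z, p). A x z p) (0, 0, \<eta>)) (0, 0, \<eta>) (x0, u x0, p) *v \<xi>)"
      if "\<xi> \<bullet> \<eta> = 0" for \<xi> \<eta> p
      by (rule regular_second_derivative[OF \<Omega>(1) Ck_on_AB(1) regular x0 that])
    show conv: "convex_on UNIV (B x0 (u x0))" using B_convex x0c by blast
    show "0 \<le> dir_deriv (dir_deriv (\<lambda>(x, z, p). B x z p) (0, 0, \<eta>)) (0, 0, \<eta>) (point u x0)" for \<eta>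
      unfolding point_def by (rule convex_second_derivative[OF \<Omega>(1) Ck_on_AB(2) conv x0])
    show "norm (dir_deriv (dir_deriv (\<lambda>(x, z, p). A x z p) v) w (x0, u x0, p)) \<le> N * norm v * norm w"
      if "norm p \<le> P" for p v w by (rule ddA_le[OF x0 ub(1) that])
    show "(e m \<bullet> (aug_hess A u x *v e m)) * exp (test_function nn N \<epsilon> u ubar x) \<le> l m * exp (test_function nn N \<epsilon> u ubar x0)"
      if "x \<in> \<Omega>" for x using max[OF that frame_norm[OF e]] unfolding lm_eq .
  qed (rule nn)
  have "\<bar>l m\<bar> \<le> norm ?r" using frame_quadratic_le[OF e, of m ?r m] by (simp add: le)
  then have "R \<le> norm ?r" using big(2) lm_eq by linarith
  from alt[OF this] have "\<epsilon> * (1 + T) \<le> gap \<or> 0 \<le> gap \<and> T \<le> 1 / \<epsilon> \<and> (\<forall>j. \<epsilon> \<le> f j)"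
    unfolding barrier_alternative_def Let_def T_trace gap_def f_def using frame_norm[OF e] by blast
  from eigenvalue_bound[OF this] big(3) lm_eq show False by linarith
qed

text \<open>The maximum exists on the compact closure: at the boundary it is controlled by the
  boundary Hessian, inside by \<open>interior_maximum\<close>. \<open>Q\<close> carries the extra
  condition of either case, and the constant is formed before \<open>u\<close> is chosen.\<close>

theorem estimate:
  assumes \<epsilon>: "\<epsilon> > 0"
    and alt: "\<And>u x. solution u \<Longrightarrow> Q u \<Longrightarrow> x \<in> \<Omega> \<Longrightarrow> R \<le> norm (aug_hess A u x) \<Longrightarrow> barrier_alternative \<epsilon> u x"
  shows "\<exists>C. \<forall>u. solution u \<and> Q u \<longrightarrow> second_deriv_bound \<Omega> u C"
proof -
  define \<tau> where "\<tau> = test_tau nn N"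
  define \<kappa> where "\<kappa> = test_kappa N \<epsilon>"
  define k where "k = test_exponent N \<epsilon>"
  have N: "N > 0" using P by linarith
  have nn1: "nn \<ge> 1" by (simp add: nn Suc_le_eq)
  have pos: "\<tau> > 0" "k > 0" "\<kappa> > 0"
  proof -
    show "\<tau> > 0" using N nn1 by (simp add: \<tau>_def test_tau_def)
    show k: "k > 0" using N \<epsilon> by (simp add: k_def test_exponent_def)
    show "\<kappa> > 0" using N \<epsilon> k by (simp add: \<kappa>_def test_kappa_def k_def)
  qed
  define \<Phi> where "\<Phi> = \<tau> * (N * N / 2) + \<kappa> * exp (k * (2 * N))"
  define \<Lambda> where "\<Lambda> = Max {1, R, max_bound nn N \<epsilon>}"
  have \<Lambda>: "\<Lambda> \<ge> 1" by (simp add: \<Lambda>_def)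
  \<comment> \<open>Each of the \<open>nn\<close> eigenvalues of \<open>M[u]\<close> is at most
    \<open>(1 + N) * (1 + L)\<close> in absolute value, where \<open>L\<close> is affine in the
    boundary supremum; the last \<open>N\<close> accounts for \<open>A\<close>.\<close>
  define C where "C = nn * ((1 + N) * (1 + exp \<Phi> * (\<Lambda> + N + 1))) + N"
  have "second_deriv_bound \<Omega> u C" if u: "solution u" and Q: "Q u" for u
  proof -
    let ?w = "aug_hess A u"
    have cl: "compact (closure \<Omega>)" using \<Omega>(3) by simp
    have uc: "continuous_on (closure \<Omega>) u" "Ck_ext 2 \<Omega> u" "Ck_ext 1 \<Omega> u"
      using u unfolding solution_def Ck_closure_def by (simp_all add: numeral_2_eq_2)
    obtain H where H: "continuous_on (closure \<Omega>) H" "\<forall>x\<in>\<Omega>. H x = hess u x"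
      using extends_continuously_hess[OF uc(2)] unfolding extends_continuously_def by blast
    obtain g where g: "continuous_on (closure \<Omega>) g" "\<forall>x\<in>\<Omega>. g x = grad u x"
      using extends_continuously_grad[OF uc(3)] unfolding extends_continuously_def by blast
    have ubc: "continuous_on (closure \<Omega>) ubar" using ubar(2) unfolding Ck_closure_def by blast
    have u_le: "\<bar>u x\<bar> \<le> P" if "x \<in> closure \<Omega>" for x
      using norm_le_on_closure[OF uc(1) _ that, of P] solution_le(1)[OF u] by simp
    have g_le: "norm (g x) \<le> P" if "x \<in> closure \<Omega>" for x
      using norm_le_on_closure[OF g(1) _ that, of P] solution_le(2)[OF u] g(2) by simp
    have ub_le: "\<bar>ubar x\<bar> \<le> P" if "x \<in> closure \<Omega>" for x
      using norm_le_on_closure[OF ubc _ that, of P] ubar_le(1) by simp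
    \<comment> \<open>Derivatives carry no information on the frontier, so the quantity to be
      maximised is built from continuous extensions and agrees with \<open>M[u]\<close>
      inside.\<close>
    define W where "W x = H x - A x (u x) (g x)" for x
    define \<phi> where "\<phi> x = \<tau> * ((g x \<bullet> g x) / 2) + \<kappa> * exp (k * (ubar x - u x))" for x
    have W: "W x = ?w x" if "x \<in> \<Omega>" for x using that H(2) g(2) by (simp add: W_def aug_hess_def aug_hess_wrt_def)
    have \<phi>: "\<phi> x = test_function nn N \<epsilon> u ubar x" if "x \<in> \<Omega>" for x
      using that g(2) by (simp add: \<phi>_def test_function_def \<tau>_def \<kappa>_def k_def)
    have A_cont: "continuous_on (closure \<Omega>) (\<lambda>x. A x (u x) (g x))"
    proof -
      have "continuous_on (closure \<Omega> \<times> UNIV \<times> UNIV) (\<lambda>(x, z, p). A x z p)"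
        using A unfolding Ck_closure_def by (simp add: closure_Times)
      moreover have "continuous_on (closure \<Omega>) (\<lambda>x. (x, u x, g x))"
        by (intro continuous_on_Pair continuous_on_id uc(1) g(1))
      ultimately have "continuous_on (closure \<Omega>) (\<lambda>x. (\<lambda>(x, z, p). A x z p) (x, u x, g x))"
        by (rule continuous_on_compose2) auto
      then show ?thesis by simp
    qed
    have Wc: "continuous_on (closure \<Omega>) W" unfolding W_def by (intro continuous_on_diff H(1) A_cont)
    have \<phi>c: "continuous_on (closure \<Omega>) \<phi>" unfolding \<phi>_def by (intro continuous_intros g(1) uc(1) ubc) simp
    have \<phi>_nonneg: "0 \<le> \<phi> x" for x using pos by (simp add: \<phi>_def)
    have \<phi>_le: "\<phi> x \<le> \<Phi>" if x: "x \<in> closure \<Omega>" for x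
    proof -
      have gN: "norm (g x) \<le> N" using g_le[OF x] P(2) by linarith
      have "g x \<bullet> g x \<le> N * N"
        using mult_mono[OF gN gN] N by (simp add: dot_square_norm power2_eq_square)
      moreover have "k * (ubar x - u x) \<le> k * (2 * N)"
        using u_le[OF x] ub_le[OF x] P(2) pos by (intro mult_left_mono) simp_all
      ultimately show ?thesis unfolding \<phi>_def \<Phi>_def using pos by (intro add_mono mult_left_mono) simp_all
    qed
    define S where "S = (SUP x\<in>frontier \<Omega>. norm (bdry_value \<Omega> (hess u) x))"
    have bv: "bdry_value \<Omega> (hess u) x = H x" if "x \<in> frontier \<Omega>" for x
      using bdry_value_extension[OF \<Omega>(1) H(1) _ that] H(2) by blast
    have frc: "frontier \<Omega> \<subseteq> closure \<Omega>" by (simp add: frontier_def)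
    have S_upper: "norm (H x) \<le> S" if "x \<in> frontier \<Omega>" for x
    proof -
      have "compact (H ` frontier \<Omega>)"
        using continuous_on_subset[OF H(1) frc] compact_frontier_bounded[OF \<Omega>(3)] by (rule compact_continuous_image)
      from bounded_iff[THEN iffD1, OF compact_imp_bounded[OF this]]
      obtain d where "\<forall>y\<in>H ` frontier \<Omega>. norm y \<le> d" by (elim exE)
      then have "bdd_above ((\<lambda>x. norm (bdry_value \<Omega> (hess u) x)) ` frontier \<Omega>)"
        by (intro bdd_aboveI[of _ d]) (auto simp: bv)
      from cSUP_upper[OF that this] show ?thesis unfolding S_def using bv[OF that] by simp
    qed
    have S: "S \<ge> 0"
    proof -
      have "\<Omega> \<noteq> UNIV" using \<Omega>(3) not_bounded_UNIV by blast
      then have "frontier \<Omega> \<noteq> {}" using frontier_not_empty[OF \<Omega>(2)] by blast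
      then obtain x where "x \<in> frontier \<Omega>" by blast
      from S_upper[OF this] norm_ge_zero[of "H x"] show ?thesis by linarith
    qed
    let ?K = "closure \<Omega> \<times> sphere (0 :: real^'n) 1"
    have Kc: "compact ?K" using cl by (intro compact_Times) simp_all
    obtain x1 where x1: "x1 \<in> \<Omega>" using \<Omega>(2) by blast
    have "(x1, axis undefined 1) \<in> ?K" using x1 closure_subset by auto
    then have K0: "?K \<noteq> {}" by blast
    have "continuous_on ?K (\<lambda>z. (snd z \<bullet> (W (fst z) *v snd z)) * exp (\<phi> (fst z)))"
      by (intro continuous_intros bounded_bilinear.continuous_on[OF bounded_bilinear_matrix_vector]
          continuous_on_compose2[OF Wc] continuous_on_compose2[OF \<phi>c]) auto
    from continuous_attains_sup[OF Kc K0 this] obtain z where z: "z \<in> ?K"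
      "\<forall>y\<in>?K. (snd y \<bullet> (W (fst y) *v snd y)) * exp (\<phi> (fst y)) \<le> (snd z \<bullet> (W (fst z) *v snd z)) * exp (\<phi> (fst z))" by blast
    obtain x0 \<xi>0 where z_eq: "z = (x0, \<xi>0)" by (cases z)
    have x0: "x0 \<in> closure \<Omega>" and \<xi>0: "norm \<xi>0 = 1" using z(1) by (simp_all add: z_eq)
    have max: "(\<xi> \<bullet> (W x *v \<xi>)) * exp (\<phi> x) \<le> (\<xi>0 \<bullet> (W x0 *v \<xi>0)) * exp (\<phi> x0)" if "x \<in> closure \<Omega>" "norm \<xi> = 1" for x \<xi>
      using z(2)[rule_format, of "(x, \<xi>)"] that by (simp add: z_eq)
    have top: "\<xi>0 \<bullet> (W x0 *v \<xi>0) \<le> \<Lambda> + N + S"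
    proof (cases "x0 \<in> \<Omega>")
      case True
      have mx: "(\<xi> \<bullet> (?w x *v \<xi>)) * exp (test_function nn N \<epsilon> u ubar x) \<le> (\<xi>0 \<bullet> (?w x0 *v \<xi>0)) * exp (test_function nn N \<epsilon> u ubar x0)"
        if "x \<in> \<Omega>" "norm \<xi> = 1" for x \<xi>
        using max[of x \<xi>] that closure_subset W \<phi> True by (auto simp: subset_iff)
      have "\<xi>0 \<bullet> (?w x0 *v \<xi>0) \<le> \<Lambda>"
        unfolding \<Lambda>_def using interior_maximum[OF u \<epsilon> True alt[OF u Q True] \<xi>0 mx] .
      then show ?thesis using W[OF True] N S by simp
    next
      case False
      then have "x0 \<in> frontier \<Omega>" using x0 \<Omega>(1) by (simp add: frontier_def interior_open)
      then have "norm (H x0) \<le> S" by (rule S_upper)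
      moreover have "norm (A x0 (u x0) (g x0)) \<le> N" by (rule A_le[OF x0 u_le[OF x0] g_le[OF x0]])
      ultimately have "norm (W x0) \<le> S + N" unfolding W_def using norm_triangle_ineq4[of "H x0" "A x0 (u x0) (g x0)"] by linarith
      moreover have "\<xi>0 \<bullet> (W x0 *v \<xi>0) \<le> norm (W x0)"
        using norm_cauchy_schwarz[of \<xi>0 "W x0 *v \<xi>0"] norm_matrix_vector_le[of "W x0" \<xi>0] \<xi>0 by simp
      ultimately show ?thesis using \<Lambda> by linarith
    qed
    define L where "L = exp \<Phi> * (\<Lambda> + N + S)"
    have L0: "\<Lambda> + N + S \<ge> 0" using \<Lambda> N S by linarith
    then have L: "L \<ge> 0" by (simp add: L_def)
    \<comment> \<open>Only positive values matter. For them the exponential factor may be inserted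
      because \<open>\<phi> \<ge> 0\<close>, and at the maximum it is removed by
      \<open>\<phi> \<le> \<Phi>\<close>.\<close>
    have quad: "\<xi> \<bullet> (?w x *v \<xi>) \<le> L" if x: "x \<in> \<Omega>" and \<xi>: "norm \<xi> = 1" for x \<xi>
    proof (cases "\<xi> \<bullet> (?w x *v \<xi>) \<le> 0")
      case True
      then show ?thesis using L by linarith
    next
      case False
      have xc: "x \<in> closure \<Omega>" using x closure_subset by blast
      have "\<xi> \<bullet> (?w x *v \<xi>) \<le> (\<xi> \<bullet> (?w x *v \<xi>)) * exp (\<phi> x)"
        using False \<phi>_nonneg[of x] mult_left_mono[of 1 "exp (\<phi> x)" "\<xi> \<bullet> (?w x *v \<xi>)"] by simp
      also have "\<dots> \<le> (\<xi>0 \<bullet> (W x0 *v \<xi>0)) * exp (\<phi> x0)" using max[OF xc \<xi>] W[OF x] by simp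
      also have "\<dots> \<le> (\<Lambda> + N + S) * exp (\<phi> x0)" using top by (intro mult_right_mono) simp_all
      also have "\<dots> \<le> (\<Lambda> + N + S) * exp \<Phi>" using \<phi>_le[OF x0] L0 by (intro mult_left_mono) simp_all
      finally show ?thesis by (simp add: L_def mult.commute)
    qed
    have hess_le: "norm (hess u x) \<le> C * (1 + S)" if x: "x \<in> \<Omega>" for x
    proof -
      have xc: "x \<in> closure \<Omega>" using x closure_subset by blast
      note ub = solution_le[OF u x]
      have r: "?w x \<in> \<Gamma>" "F (?w x) = B x (u x) (grad u x)"
        using u x by (simp_all add: solution_def admissible_solution_def)
      obtain e l where e: "frame e" and l: "\<And>j. ?w x *v e j = l j *\<^sub>R e j"
        using symmetric_matrix_eigenframe[OF sym[OF r(1)]] by blast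
      have le: "e j \<bullet> (?w x *v e j) = l j" for j using e by (simp add: l frame_def)
      have lL: "l j \<le> L" for j using quad[OF x frame_norm[OF e, of j]] by (simp add: le)
      have cF: "c \<le> F (?w x)" unfolding r(2) using B_le(2)[OF xc ub] .
      have "\<bar>l j\<bar> \<le> (1 + N) * (1 + L)" for j
      proof -
        have "- l j \<le> N / 2 * (1 + L)" using eigen_le[OF r(1) cF e l L lL, of j] by (simp add: minus_le_iff)
        also have "\<dots> \<le> (1 + N) * (1 + L)" using N L by (intro mult_right_mono) simp_all
        finally have lower: "- l j \<le> (1 + N) * (1 + L)" .
        have "l j \<le> 1 * (1 + L)" using lL[of j] by simp
        also have "\<dots> \<le> (1 + N) * (1 + L)" using N L by (intro mult_right_mono) simp_all
        finally show ?thesis using lower by (rule abs_leI)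
      qed
      then have "(\<Sum>j\<in>UNIV. \<bar>l j\<bar>) \<le> (\<Sum>j\<in>(UNIV::'n set). (1 + N) * (1 + L))" by (rule sum_mono)
      then have "norm (?w x) \<le> nn * ((1 + N) * (1 + L))" using eigenframe_norm_le[OF e l] by (simp add: nn)
      moreover have "norm (hess u x) \<le> norm (?w x) + norm (A x (u x) (grad u x))"
        using norm_triangle_ineq[of "?w x" "A x (u x) (grad u x)"] by (simp add: aug_hess_def aug_hess_wrt_def)
      moreover have "norm (A x (u x) (grad u x)) \<le> N" by (rule A_le[OF xc ub])
      ultimately have 1: "norm (hess u x) \<le> nn * ((1 + N) * (1 + L)) + N" by linarith
      have "1 + L \<le> (1 + exp \<Phi> * (\<Lambda> + N + 1)) * (1 + S)"
      proof -
        have "L + exp \<Phi> * (\<Lambda> + N) * S \<ge> L" using \<Lambda> N S by simp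
        moreover have "(1 + exp \<Phi> * (\<Lambda> + N + 1)) * (1 + S) = 1 + (L + exp \<Phi> * (\<Lambda> + N) * S) + S + exp \<Phi>"
          by (simp add: L_def algebra_simps)
        ultimately show ?thesis using S exp_ge_zero[of \<Phi>] by linarith
      qed
      then have "nn * ((1 + N) * (1 + L)) \<le> nn * ((1 + N) * ((1 + exp \<Phi> * (\<Lambda> + N + 1)) * (1 + S)))"
        using N nn1 by (intro mult_left_mono) simp_all
      moreover have "N * 1 \<le> N * (1 + S)" using N S by (intro mult_left_mono) simp_all
      moreover have "C * (1 + S) = nn * ((1 + N) * ((1 + exp \<Phi> * (\<Lambda> + N + 1)) * (1 + S))) + N * (1 + S)"
        by (simp add: C_def distrib_right mult.assoc)
      ultimately show ?thesis using 1 by linarith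
    qed
    have "(SUP x\<in>\<Omega>. norm (hess u x)) \<le> C * (1 + S)" using \<Omega>(2) hess_le by (intro cSUP_least)
    then show ?thesis unfolding second_deriv_bound_def S_def .
  qed
  then show ?thesis by blast
qed

text \<open>Case (i): the trace dominates for large \<open>r\<close>.\<close>

lemma barrier_F5:
  assumes F5: "F5_plus \<Gamma> F" and S: "compact S" "S \<subseteq> \<Gamma>"
  obtains \<epsilon> R where "\<epsilon> > 0" "\<And>u x. solution u \<Longrightarrow> aug_hess_wrt A u ubar ` \<Omega> \<subseteq> S \<Longrightarrow> x \<in> \<Omega> \<Longrightarrow>
    R \<le> norm (aug_hess A u x) \<Longrightarrow> barrier_alternative \<epsilon> u x"
proof -
  obtain \<delta> m where \<delta>: "\<delta> > 0" "\<And>r s. r \<in> \<Gamma> \<Longrightarrow> s \<in> S \<Longrightarrow> \<delta> * trace (G r) + m - F r \<le> G r \<bullet> (s - r)"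
    using gap_trace[OF S] by blast
  have "is_interval {c..b}" "bounded {c..b}" by (simp_all add: is_interval_cc)
  moreover have "closure {c..b} \<subseteq> F ` \<Gamma>"
  proof -
    have "F ` \<Gamma> = {t. a0 < ereal t}" using F3 by (simp add: F3_def)
    then show ?thesis using B_le(1) by (auto intro: less_le_trans)
  qed
  \<comment> \<open>The threshold lets half of \<open>\<delta>\<close> times the trace pay for
    \<open>- m\<close>, for \<open>F\<close> and for two values of \<open>B\<close>, and leave
    \<open>\<delta> / 2\<close> over.\<close>
  ultimately obtain R where R: "\<forall>r\<in>\<Gamma>. F r \<in> {c..b} \<and> R \<le> norm r \<longrightarrow> (2 / \<delta>) * (3 * b - m + \<delta> / 2) \<le> trace (G r)"
    using F5 unfolding F5_plus_def by blast
  show ?thesis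
  proof (rule that[of "\<delta> / 2" R])
    show "\<delta> / 2 > 0" using \<delta>(1) by simp
    fix u x assume u: "solution u" and sub: "aug_hess_wrt A u ubar ` \<Omega> \<subseteq> S" and x: "x \<in> \<Omega>" and big: "R \<le> norm (aug_hess A u x)"
    let ?r = "aug_hess A u x"
    have xc: "x \<in> closure \<Omega>" using x closure_subset by blast
    note ub = solution_le[OF u x]
    have r: "?r \<in> \<Gamma>" "F ?r = B x (u x) (grad u x)"
      using u x by (simp_all add: solution_def admissible_solution_def)
    have s: "aug_hess_wrt A u ubar x \<in> S" using sub x by blast
    have B1: "c \<le> F ?r" "\<bar>F ?r\<bar> \<le> b" unfolding r(2) using B_le(2,3)[OF xc ub] by simp_all
    then have FI: "F ?r \<in> {c..b}" by simp
    have B2: "\<bar>B x (u x) (grad ubar x)\<bar> \<le> b" by (rule B_le(3)[OF xc ub(1) ubar_le(2)[OF x]])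
    have "(2 / \<delta>) * (3 * b - m + \<delta> / 2) \<le> trace (G ?r)" using R r(1) FI big by blast
    then have "3 * b - m + \<delta> / 2 \<le> \<delta> / 2 * trace (G ?r)" using \<delta>(1) by (simp add: field_simps)
    then have "\<delta> / 2 * (1 + trace (G ?r)) \<le> \<delta> * trace (G ?r) + m - 3 * b" by (simp add: algebra_simps)
    also have "\<dots> \<le> G ?r \<bullet> (aug_hess_wrt A u ubar x - ?r) - (B x (u x) (grad ubar x) - B x (u x) (grad u x))"
      using \<delta>(2)[OF r(1) s] B1 B2 unfolding r(2) by linarith
    finally show "barrier_alternative (\<delta> / 2) u x" unfolding barrier_alternative_def Let_def by blast
  qed
qed

text \<open>Case (ii): the values of \<open>M\<^sub>u[ubar]\<close> lie in a bounded superlevel set of \<open>F\<close>, which is compact by F3. The bound on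
  the second derivatives of \<open>ubar\<close> comes from a single solution \<open>v\<close> for which \<open>ubar\<close> is admissible.\<close>

lemma barrier_subsolution:
  assumes v: "solution v" "admissible_wrt \<Omega> \<Gamma> A v ubar"
  obtains \<epsilon> where "\<epsilon> > 0" "\<And>u x. solution u \<Longrightarrow> admissible_wrt \<Omega> \<Gamma> A u ubar \<Longrightarrow> subsolution_wrt \<Omega> F A B u ubar \<Longrightarrow> x \<in> \<Omega> \<Longrightarrow>
    barrier_alternative \<epsilon> u x"
proof -
  obtain S where S: "compact S" "aug_hess_wrt A v ubar ` \<Omega> \<subseteq> S" using v(2) unfolding admissible_wrt_def by blast
  from bounded_iff[THEN iffD1, OF compact_imp_bounded[OF S(1)]] obtain d where d: "\<forall>y\<in>S. norm y \<le> d" by (elim exE)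
  have Abar: "norm (A x (u x) (grad ubar x)) \<le> N" if "solution u" "x \<in> \<Omega>" for u x
    using A_le[OF _ solution_le(1)[OF that] ubar_le(2)[OF that(2)]] that(2) closure_subset by blast
  have hb: "norm (hess ubar x) \<le> d + N" if x: "x \<in> \<Omega>" for x
  proof -
    have "norm (aug_hess_wrt A v ubar x) \<le> d" using d S(2) x by blast
    then show ?thesis
      using norm_triangle_ineq[of "aug_hess_wrt A v ubar x" "A x (v x) (grad ubar x)"] Abar[OF v(1) x]
      by (simp add: aug_hess_wrt_def)
  qed
  \<comment> \<open>\<open>d + N\<close> bounds the Hessian of \<open>ubar\<close>, the other
    \<open>N\<close> bounds \<open>A\<close> at \<open>u\<close> and the gradient of
    \<open>ubar\<close>, for every solution \<open>u\<close>.\<close>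
  define S' where "S' = {r \<in> \<Gamma>. norm r \<le> d + 2 * N \<and> c \<le> F r}"
  have S': "compact S'" "S' \<subseteq> \<Gamma>" unfolding S'_def using compact_superlevel[OF F3 B_le(1)] by auto
  obtain \<epsilon> where \<epsilon>: "\<epsilon> > 0" "\<And>r s. r \<in> \<Gamma> \<Longrightarrow> s \<in> S' \<Longrightarrow>
    \<epsilon> * (1 + trace (G r)) \<le> F r + G r \<bullet> (s - r) - F s \<or>
    trace (G r) \<le> 1 / \<epsilon> \<and> (\<forall>\<xi>. norm \<xi> = 1 \<longrightarrow> \<epsilon> \<le> \<xi> \<bullet> (G r *v \<xi>))"
    using gap_dichotomy[OF S'] by blast
  show ?thesis
  proof (rule that[OF \<epsilon>(1)])
    fix u x assume u: "solution u" and adm: "admissible_wrt \<Omega> \<Gamma> A u ubar" and sub: "subsolution_wrt \<Omega> F A B u ubar" and x: "x \<in> \<Omega>"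
    let ?r = "aug_hess A u x" and ?s = "aug_hess_wrt A u ubar x"
    have xc: "x \<in> closure \<Omega>" using x closure_subset by blast
    have r: "?r \<in> \<Gamma>" "F ?r = B x (u x) (grad u x)"
      using u x by (simp_all add: solution_def admissible_solution_def)
    have sG: "?s \<in> \<Gamma>" using adm x unfolding admissible_wrt_def by blast
    have sB: "B x (u x) (grad ubar x) \<le> F ?s" using sub x by (simp add: subsolution_wrt_def)
    have "c \<le> B x (u x) (grad ubar x)" by (rule B_le(2)[OF xc solution_le(1)[OF u x] ubar_le(2)[OF x]])
    moreover have "norm ?s \<le> d + 2 * N"
      unfolding aug_hess_wrt_def using norm_triangle_ineq4[of "hess ubar x" "A x (u x) (grad ubar x)"] hb[OF x] Abar[OF u x] by linarith
    ultimately have sS: "?s \<in> S'" using sG sB by (simp add: S'_def)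
    define gap where "gap = G ?r \<bullet> (?s - ?r) - (B x (u x) (grad ubar x) - B x (u x) (grad u x))"
    \<comment> \<open>The subsolution inequality replaces \<open>B\<close> at the gradient of
      \<open>ubar\<close> by the larger \<open>F ?s\<close>. So the barrier gap dominates the
      concavity gap, which is nonnegative.\<close>
    have 1: "F ?r + G ?r \<bullet> (?s - ?r) - F ?s \<le> gap" using sB r(2) by (simp add: gap_def)
    have 2: "0 \<le> gap" using supergradient[OF r(1) sG] 1 by linarith
    show "barrier_alternative \<epsilon> u x"
      unfolding barrier_alternative_def Let_def gap_def[symmetric]
      using \<epsilon>(2)[OF r(1) sS] 1 2 by (meson order_trans)
  qed
qed

end

theorem theorem3p1:
  fixes \<Omega> :: "(real^'n) set"
    and \<Gamma> :: "(real^'n^'n) set"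
    and F :: "real^'n^'n \<Rightarrow> real"
    and a0 :: ereal
    and A :: "real^'n \<Rightarrow> real \<Rightarrow> real^'n \<Rightarrow> real^'n^'n"
    and B :: "real^'n \<Rightarrow> real \<Rightarrow> real^'n \<Rightarrow> real"
    and ubar :: "real^'n \<Rightarrow> real"
    and K :: real
  assumes "bounded_smooth_domain \<Omega>"
    and "open_convex_cone \<Gamma>" and "pos_def_mats \<subseteq> \<Gamma>"
    and "mat_C2_on \<Gamma> F" and "orth_invariant \<Gamma> F"
    and "F1 \<Gamma> F" and "F2 \<Gamma> F" and "F3 \<Gamma> F a0"
    and "\<forall>x\<in>closure \<Omega>. \<forall>z p. A x z p \<in> sym_mats"
    and "Ck_closure 2 (\<Omega> \<times> UNIV \<times> UNIV) (\<lambda>(x, z, p). A x z p)"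
    and "regular_on (closure \<Omega>) A"
    and "Ck_closure 2 (\<Omega> \<times> UNIV \<times> UNIV) (\<lambda>(x, z, p). B x z p)"
    and "\<forall>x\<in>closure \<Omega>. \<forall>z p. a0 < ereal (B x z p)"
    and "\<forall>x\<in>closure \<Omega>. \<forall>z. convex_on UNIV (B x z)"
    and "Ck_on 2 \<Omega> ubar" and "Ck_closure 1 \<Omega> ubar"
  shows "(F5_plus \<Gamma> F \<longrightarrow>
      (\<forall>S. compact S \<and> S \<subseteq> \<Gamma> \<longrightarrow>
        (\<exists>C. \<forall>u. Ck_on 4 \<Omega> u \<and> Ck_closure 2 \<Omega> u \<and> C1_norm \<Omega> u \<le> K \<and>
               admissible_solution \<Omega> \<Gamma> F A B u \<and>
               admissible_wrt \<Omega> \<Gamma> A u ubar \<and> aug_hess_wrt A u ubar ` \<Omega> \<subseteq> S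
             \<longrightarrow> second_deriv_bound \<Omega> u C)))
    \<and> (\<exists>C. \<forall>u. Ck_on 4 \<Omega> u \<and> Ck_closure 2 \<Omega> u \<and> C1_norm \<Omega> u \<le> K \<and>
               admissible_solution \<Omega> \<Gamma> F A B u \<and>
               admissible_wrt \<Omega> \<Gamma> A u ubar \<and> subsolution_wrt \<Omega> F A B u ubar
             \<longrightarrow> second_deriv_bound \<Omega> u C)"
proof -
  interpret estimate_data \<Gamma> F \<Omega> A B ubar K a0
    using assms unfolding bounded_smooth_domain_def by unfold_locales blast+
  obtain P N c b nn where "estimate_constants \<Gamma> F \<Omega> A B ubar K a0 P N c b nn"
    by (rule constants_exist)
  then interpret estimate_constants \<Gamma> F \<Omega> A B ubar K a0 P N c b nn .
  show ?thesis
  proof (intro conjI impI allI)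
    fix S assume F5: "F5_plus \<Gamma> F" and S: "compact S \<and> S \<subseteq> \<Gamma>"
    obtain \<epsilon> R where \<epsilon>: "\<epsilon> > 0" "\<And>u x. solution u \<Longrightarrow> aug_hess_wrt A u ubar ` \<Omega> \<subseteq> S \<Longrightarrow> x \<in> \<Omega> \<Longrightarrow>
      R \<le> norm (aug_hess A u x) \<Longrightarrow> barrier_alternative \<epsilon> u x"
      using barrier_F5[OF F5 conjunct1[OF S] conjunct2[OF S]] by blast
    from estimate[of \<epsilon> "\<lambda>u. aug_hess_wrt A u ubar ` \<Omega> \<subseteq> S" R, OF \<epsilon>]
    show "\<exists>C. \<forall>u. Ck_on 4 \<Omega> u \<and> Ck_closure 2 \<Omega> u \<and> C1_norm \<Omega> u \<le> K \<and> admissible_solution \<Omega> \<Gamma> F A B u \<and>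
      admissible_wrt \<Omega> \<Gamma> A u ubar \<and> aug_hess_wrt A u ubar ` \<Omega> \<subseteq> S \<longrightarrow> second_deriv_bound \<Omega> u C"
      unfolding solution_def by blast
  next
    let ?Q = "\<lambda>u. admissible_wrt \<Omega> \<Gamma> A u ubar \<and> subsolution_wrt \<Omega> F A B u ubar"
    have "\<exists>C. \<forall>u. solution u \<and> ?Q u \<longrightarrow> second_deriv_bound \<Omega> u C"
    \<comment> \<open>Without any such solution the claim is vacuous; with one, it supplies the
      bound for the second derivatives of \<open>ubar\<close>.\<close>
    proof (cases "\<exists>v. solution v \<and> ?Q v")
      case True
      then obtain v where v: "solution v" "admissible_wrt \<Omega> \<Gamma> A v ubar" by blast
      obtain \<epsilon> where \<epsilon>: "\<epsilon> > 0" "\<And>u x. solution u \<Longrightarrow> admissible_wrt \<Omega> \<Gamma> A u ubar \<Longrightarrow>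
        subsolution_wrt \<Omega> F A B u ubar \<Longrightarrow> x \<in> \<Omega> \<Longrightarrow> barrier_alternative \<epsilon> u x"
        using barrier_subsolution[OF v] by blast
      \<comment> \<open>Threshold 0: the subsolution barrier works for \<open>M[u]\<close> of every
        size.\<close>
      show ?thesis by (rule estimate[of \<epsilon> ?Q 0]) (use \<epsilon> in blast)+
    next
      case False
      then show ?thesis by blast
    qed
    then show "\<exists>C. \<forall>u. Ck_on 4 \<Omega> u \<and> Ck_closure 2 \<Omega> u \<and> C1_norm \<Omega> u \<le> K \<and> admissible_solution \<Omega> \<Gamma> F A B u \<and>
      admissible_wrt \<Omega> \<Gamma> A u ubar \<and> subsolution_wrt \<Omega> F A B u ubar \<longrightarrow> second_deriv_bound \<Omega> u C"
      unfolding solution_def by blast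
  qed
qed

end
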